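(* Let $U: D\to\Omega$ be the semiflow selection constructed from the sets $\mathcal U^\infty$ described in the context, let $[\varrho_0,\mathbf m_0,E_0]\in D$ and $[\varrho,\mathbf m,E]=U\{\varrho_0,\mathbf m_0,E_0\}$. Put $M=\int_{T^N}\varrho_0\,dx$ and $\varrho_M\equiv\frac{M}{|T^N|}$ (a constant function). Suppose that $$\varrho(T,\cdot)=\varrho_M,\qquad \mathbf m(T,\cdot)=0\qquad\text{for some } T\ge0.$$ Then $$\varrho(\tau,\cdot)=\varrho_M,\qquad \mathbf m(\tau,\cdot)=0\qquad\text{for all }\tau\ge T.$$
   Context: Throughout, $N\in\{1,2,3\}$, $a>0$ and $\gamma>1$ are fixed, and $T^N=([-1,1]|_{\{-1;1\}})^N$ is the flat torus. The isentropic Euler system is $\partial_t \varrho + \mathrm{div}_x \mathbf m = 0$, $\partial_t \mathbf m + \mathrm{div}_x(\frac{\mathbf m\otimes \mathbf m}{\varrho}) + a\nabla_x \varrho^\gamma = 0$. Convention: for $\varrho\ge 0$, $\mathbf m\in R^N$, the convex function $\frac{|\mathbf m|^2}{\varrho}$ equals $0$ if $\mathbf m=0$, the usual quotient if $\varrho>0$, and $+\infty$ otherwise. Let $\mathcal S=\{[\tilde\varrho,\tilde{\mathbf m}] : \tilde\varrho\ge 0,\ \tilde{\mathbf m}\in R^N\}$, $\mathcal P(\cdot)$ denote probability measures, $\mathcal M^+(\cdot)$ positive bounded Radon measures, $S^{N-1}\subset R^N$ the unit sphere. Dissipative solution. A triple $[\varrho,\mathbf m,E]\in C_{\rm weak,loc}([0,\infty);L^\gamma(T^N))\times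 C_{\rm weak,loc}([0,\infty);L^{\frac{2\gamma}{\gamma+1}}(T^N;R^N))\times BV_{\rm loc}([0,\infty))$ is a dissipative solution of the Euler system with initial data $[\varrho_0,\mathbf m_0,E_0]\in L^\gamma(T^N)\times L^{\frac{2\gamma}{\gamma+1}}(T^N;R^N)\times[0,\infty)$ if there exist: a Young measure $(t,x)\mapsto\nu_x(t)\in L^\infty_{{\rm weak}-( * )}((0,\infty)\times T^N;\mathcal P(\mathcal S))$; measures $\mathfrak C_{\rm kin},\mathfrak C_{\rm int},\mathfrak C_{\rm press}\in L^\infty_{{\rm weak}-( * )}(0,\infty;\mathcal M^+(T^N))$ and $\mathfrak C_{\rm conv}\in L^\infty_{{\rm weak}-( * )}(0,\infty;\mathcal M^+(T^N\times S^{N-1}))$ with $\mathfrak C_{\rm conv}(t,dx,d\xi)=2r_x(t,d\xi)\otimes\mathfrak C_{\rm kin}(t,dx)$ for some $r_x(t)\in\mathcal P(S^{N-1})$ (the disintegration of $\mathfrak C_{\rm conv}(t)$), and $\mathfrak C_{\rm press}=(\gamma-1)\mathfrak C_{\rm int}$; such that: (a) for a.a. $\tau>0$: $\varrho(\tau,x)=\langle\nu_x(\tau);\tilde\varrho\rangle\ge 0$ and $\mathbf m(\tau,x)=\langle\nu_x(\tau);\tilde{\mathbf m}\rangle$ for a.a. $x\in T^N$, and $$E(\tau)=\int_{T^N}\Big\langle\nu_x(\tau);\tfrac12\tfrac{|\tilde{\mathbf m}|^2}{\tilde\varrho}+\tfrac{a}{\gamma-1}\tilde\varrho^\gamma\Big\rangle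 dx+\int_{T^N}d\mathfrak C_{\rm kin}(\tau)+\int_{T^N}d\mathfrak C_{\rm int}(\tau);$$ (b) for any $\tau>0$ and $\varphi\in C^1_c([0,\infty)\times T^N)$: $\big[\int_{T^N}\varrho\varphi\,dx\big]_{t=0}^{t=\tau}=\int_0^\tau\int_{T^N}[\varrho\partial_t\varphi+\mathbf m\cdot\nabla_x\varphi]\,dx\,dt$, with $\varrho(0,\cdot)=\varrho_0$; (c) for any $\tau>0$ and $\boldsymbol\varphi\in C^1_c([0,\infty)\times T^N;R^N)$, with $\mathbf m(0,\cdot)=\mathbf m_0$: $$\Big[\int_{T^N}\mathbf m\cdot\boldsymbol\varphi\,dx\Big]_{t=0}^{t=\tau}-\int_0^\tau\!\!\int_{T^N}\mathbf m\cdot\partial_t\boldsymbol\varphi\,dx\,dt=\int_0^\tau\!\!\int_{T^N}\Big[\Big\langle\nu_x(t);1_{\tilde\varrho>0}\tfrac{\tilde{\mathbf m}\otimes\tilde{\mathbf m}}{\tilde\varrho}\Big\rangle:\nabla_x\boldsymbol\varphi+\langle\nu_x(t);a\tilde\varrho^\gamma\rangle\,\mathrm{div}_x\boldsymbol\varphi\Big]dx\,dt$$ $$+2\int_0^\tau\!\!\int_{T^N}\langle r_x(t);\xi\otimes\xi\rangle:\nabla_x\boldsymbol\varphi\,d\mathfrak C_{\rm kin}\,dt+(\gamma-1)\int_0^\tau\!\!\int_{T^N}\mathrm{div}_x\boldsymbol\varphi\,d\mathfrak C_{\rm int}\,dt;$$ (d) for any $0\le\tau_1\le\tau_2$ and $\psi\in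 C^1_c([0,\infty))$, $\psi\ge0$: $[E\psi]_{t=\tau_1-}^{t=\tau_2+}-\int_{\tau_1}^{\tau_2}E\,\partial_t\psi\,dt\le0$, with $E(0-)=E_0$. Here $E(t\pm)$ are one-sided limits. Spaces. Fix $\ell>N/2+1$. $X=W^{-\ell,2}(T^N)\times W^{-\ell,2}(T^N;R^N)\times R$; $$D=\Big\{[\varrho_0,\mathbf m_0,E_0]\in X : \varrho_0\ge0,\ \int_{T^N}\Big[\tfrac12\tfrac{|\mathbf m_0|^2}{\varrho_0}+\tfrac{a}{\gamma-1}\varrho_0^\gamma\Big]dx\le E_0\Big\}$$ (with $\varrho_0,\mathbf m_0$ represented by functions for which this integral is finite); $$\Omega=C_{\rm loc}([0,\infty);W^{-\ell,2}(T^N))\times C_{\rm loc}([0,\infty);W^{-\ell,2}(T^N;R^N))\times L^1_{\rm loc}(0,\infty).$$ For $[\varrho_0,\mathbf m_0,E_0]\in D$, $\mathcal U[\varrho_0,\mathbf m_0,E_0]$ is the set of all $[\varrho,\mathbf m,E]\in\Omega$ that are dissipative solutions with initial data $[\varrho_0,\mathbf m_0,E_0]$. The constructed semiflow $U$. For a functional $I:\Omega\to R$ and a set-valued map $\mathcal V: D\to 2^\Omega$, let $I\circ\mathcal V[\varrho_0,\mathbf m_0,E_0]$ be the set of minimizers of $I$ over $\mathcal V[\varrho_0,\mathbf m_0,E_0]$. Fix a smooth, bounded, strictly increasing $\beta:R\to R$, a countable basis $\{e_n\}_{n\ge1}$ of $L^2(T^N)$ formed by trigonometric polynomials, its vector-valued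 analogue $\{\mathbf w_m\}_{m\ge1}$ in $L^2(T^N;R^N)$, and a countable set $\{\lambda_k\}_{k\ge1}$ dense in $(0,\infty)$. Put $I_{1,\beta}[\varrho,\mathbf m,E]=\int_0^\infty e^{-t}\beta(E(t))\,dt$, $I_{k,0,0}[\varrho,\mathbf m,E]=\int_0^\infty e^{-\lambda_kt}\beta(E(t))\,dt$, $I_{k,n,0}[\varrho,\mathbf m,E]=\int_0^\infty e^{-\lambda_kt}\beta(\int_{T^N}\varrho e_n\,dx)\,dt$, $I_{k,0,m}[\varrho,\mathbf m,E]=\int_0^\infty e^{-\lambda_kt}\beta(\int_{T^N}\mathbf m\cdot\mathbf w_m\,dx)\,dt$. Let $\{(k(j),n(j),m(j))\}_{j\ge1}$ enumerate $(\mathbb N\times\{0\}\times\{0\})\cup(\mathbb N\times\mathbb N\times\{0\})\cup(\mathbb N\times\{0\}\times\mathbb N)$ and set $\mathcal U^j=I_{k(j),n(j),m(j)}\circ\dots\circ I_{k(1),n(1),m(1)}\circ I_{1,\beta}\circ\mathcal U$, $\mathcal U^\infty=\bigcap_{j\ge1}\mathcal U^j$. For each $[\varrho_0,\mathbf m_0,E_0]\in D$ the set $\mathcal U^\infty[\varrho_0,\mathbf m_0,E_0]$ is a singleton, and $U\{\varrho_0,\mathbf m_0,E_0\}$ denotes its unique element. *)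

theory Defs
  imports "HOL-Probability.Probability"
begin

section \<open>The flat torus\<close>

text \<open>
  The torus is modelled by the half-open cube below, a fundamental domain of R^N modulo the lattice
  2Z^N.  Functions that only matter almost everywhere (densities, momenta, Young measures) are used
  through their values on the cube.  Continuous functions on the torus are continuous
  functions on R^N that are 2-periodic in every coordinate.  Borel measures on the torus are Borel
  measures on the cube (the quotient map restricted to the cube is a Borel isomorphism).
\<close>

definition torus :: "(real^'n) set" where
  "torus = {x. \<forall>i. -1 \<le> x $ i \<and> x $ i < 1}"

abbreviation LT :: "(real^'n) measure" where
  "LT \<equiv> lebesgue_on torus"

definition periodic :: "(real^'n \<Rightarrow> 'b) \<Rightarrow> bool" where
  "periodic f \<longleftrightarrow> (\<forall>x i. f (x + axis i 2) = f x)"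

definition C_torus :: "(real^'n \<Rightarrow> real) set" where
  "C_torus = {f. continuous_on UNIV f \<and> periodic f}"

definition C_torus_sphere :: "((real^'n) \<times> (real^'n) \<Rightarrow> real) set" where
  "C_torus_sphere = {f. continuous_on (UNIV \<times> sphere 0 1) f \<and>
     (\<forall>\<xi>\<in>sphere 0 1. periodic (\<lambda>x. f (x, \<xi>)))}"


section \<open>Function spaces\<close>

text \<open>Elements of Lebesgue spaces are given by representatives.\<close>

definition Lp_torus :: "real \<Rightarrow> (real^'n \<Rightarrow> 'b::euclidean_space) set" where
  "Lp_torus p = {f. f \<in> borel_measurable LT \<and> integrable LT (\<lambda>x. norm (f x) powr p)}"

text \<open>The space of weakly continuous maps from [0,\<open>\<infinity>\<close>) into L^p, for p in (1,\<open>\<infinity>\<close>).\<close>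

definition C_weak_Lp :: "real \<Rightarrow> (real \<Rightarrow> real^'n \<Rightarrow> 'b::euclidean_space) set" where
  "C_weak_Lp p = {u. (\<forall>t\<ge>0. u t \<in> Lp_torus p) \<and>
     (\<forall>g\<in>Lp_torus (p / (p - 1)). continuous_on {0..} (\<lambda>t. \<integral>x. u t x \<bullet> g x \<partial>LT))}"

definition BV_loc :: "(real \<Rightarrow> real) set" where
  "BV_loc = {E. \<forall>K>0. \<exists>B. \<forall>s n. mono s \<and> range s \<subseteq> {0..K} \<longrightarrow>
     (\<Sum>i<(n::nat). \<bar>E (s (Suc i)) - E (s i)\<bar>) \<le> B}"

definition L1_loc :: "(real \<Rightarrow> real) set" where
  "L1_loc = {E. \<forall>a b. 0 < a \<and> a < b \<longrightarrow> set_integrable lebesgue {a..b} E}"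

definition freq :: "int^'n \<Rightarrow> real^'n" where
  "freq k = (\<chi> i. pi * of_int (k $ i))"

text \<open>
  The (Hilbert) norm of W^(-l,2) on the torus, up to a constant factor, through Fourier coefficients: the two integrals are the real and
  (up to sign) imaginary parts of the coefficient of f at the frequency k.
\<close>

definition Wneg_term :: "real \<Rightarrow> (real^'n \<Rightarrow> 'b::euclidean_space) \<Rightarrow> int^'n \<Rightarrow> real" where
  "Wneg_term l f k = (1 + (norm (freq k))\<^sup>2) powr (- l) *
     ((norm (\<integral>x. cos (freq k \<bullet> x) *\<^sub>R f x \<partial>LT))\<^sup>2 + (norm (\<integral>x. sin (freq k \<bullet> x) *\<^sub>R f x \<partial>LT))\<^sup>2)"

text \<open>
  The elements of W^(-l,2) that are represented by integrable functions; the data and solutions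
  considered below take values there.
\<close>

definition Wneg :: "real \<Rightarrow> (real^'n \<Rightarrow> 'b::euclidean_space) set" where
  "Wneg l = {f. integrable LT f \<and> Wneg_term l f summable_on UNIV}"

definition Wneg_norm :: "real \<Rightarrow> (real^'n \<Rightarrow> 'b::euclidean_space) \<Rightarrow> real" where
  "Wneg_norm l f = sqrt (\<Sum>\<^sub>\<infinity>k. Wneg_term l f k)"

definition C_Wneg :: "real \<Rightarrow> (real \<Rightarrow> real^'n \<Rightarrow> 'b::euclidean_space) set" where
  "C_Wneg l = {u. (\<forall>t\<ge>0. u t \<in> Wneg l) \<and>
     (\<forall>t\<ge>0. ((\<lambda>s. Wneg_norm l (\<lambda>x. u s x - u t x)) \<longlongrightarrow> 0) (at t within {0..}))}"

text \<open>
  Test functions of class C^1 with compact support in [0,\<open>\<infinity>\<close>) times the torus; time derivatives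
  at 0 are one-sided.
\<close>

definition dt :: "(real \<Rightarrow> 'b::real_normed_vector) \<Rightarrow> real \<Rightarrow> 'b" where
  "dt f t = vector_derivative f (at t within {0..})"

definition C1c :: "(real \<Rightarrow> real) set" where
  "C1c = {\<psi>. (\<forall>t\<ge>0. \<psi> differentiable (at t within {0..})) \<and> continuous_on {0..} (dt \<psi>) \<and>
     (\<exists>K. \<forall>t\<ge>K. \<psi> t = 0)}"

definition C1c_torus :: "(real \<Rightarrow> real^'n \<Rightarrow> 'b::euclidean_space) set" where
  "C1c_torus = {\<phi>.
     (\<forall>t\<ge>0. periodic (\<phi> t)) \<and>
     (\<exists>K. \<forall>t\<ge>K. \<forall>x. \<phi> t x = 0) \<and>
     continuous_on ({0..} \<times> UNIV) (\<lambda>(t, x). \<phi> t x) \<and>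
     (\<forall>t\<ge>0. \<forall>x. (\<lambda>s. \<phi> s x) differentiable (at t within {0..}) \<and> \<phi> t differentiable (at x)) \<and>
     continuous_on ({0..} \<times> UNIV) (\<lambda>(t, x). dt (\<lambda>s. \<phi> s x) t) \<and>
     (\<forall>v. continuous_on ({0..} \<times> UNIV) (\<lambda>(t, x). frechet_derivative (\<phi> t) (at x) v))}"

definition grad :: "(real^'n \<Rightarrow> real) \<Rightarrow> real^'n \<Rightarrow> real^'n" where
  "grad f x = (\<chi> j. frechet_derivative f (at x) (axis j 1))"

definition Grad :: "(real^'n \<Rightarrow> real^'n) \<Rightarrow> real^'n \<Rightarrow> real^'n^'n" where
  "Grad f x = jacobian f (at x)"

definition divergence :: "(real^'n \<Rightarrow> real^'n) \<Rightarrow> real^'n \<Rightarrow> real" where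
  "divergence f x = trace (jacobian f (at x))"

text \<open>On matrices, the inner product \<open>A \<bullet> B\<close> is the Frobenius product A : B.\<close>

definition tensor :: "real^'n \<Rightarrow> real^'n \<Rightarrow> real^'n^'n" where
  "tensor u v = (\<chi> i j. u $ i * v $ j)"


section \<open>Weakly-star measurable families of measures\<close>

text \<open>
  Positive bounded Radon measures on X.  On the spaces used here every finite Borel measure is Radon.
\<close>

definition bounded_measures :: "('x::topological_space) set \<Rightarrow> 'x measure set" where
  "bounded_measures X = {\<mu>. sets \<mu> = sets (restrict_space borel X) \<and> finite_measure \<mu>}"

text \<open>
  L^\<open>\<infinity>\<close>-weak-star of (0,\<open>\<infinity>\<close>) with values in the positive measures on X, where C
  is the space of continuous functions on X.
\<close>

definition Linf_weakstar ::
    "('x::topological_space) set \<Rightarrow> ('x \<Rightarrow> real) set \<Rightarrow> (real \<Rightarrow> 'x measure) set" where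
  "Linf_weakstar X C = {\<mu>. (\<forall>t>0. \<mu> t \<in> bounded_measures X) \<and>
     (\<forall>f\<in>C. (\<lambda>t. \<integral>x. f x \<partial>\<mu> t) \<in> borel_measurable (lebesgue_on {0<..})) \<and>
     (\<exists>K. AE t in lebesgue_on {0<..}. measure (\<mu> t) X \<le> K)}"

definition phase_space :: "(real \<times> (real^'n)) set" where
  "phase_space = {s. fst s \<ge> 0}"

definition C0_phase :: "(real \<times> (real^'n) \<Rightarrow> real) set" where
  "C0_phase = {b. continuous_on phase_space b \<and>
     (\<forall>\<epsilon>>0. \<exists>R. \<forall>s\<in>phase_space. norm s \<ge> R \<longrightarrow> \<bar>b s\<bar> < \<epsilon>)}"

definition young_measures :: "(real \<Rightarrow> real^'n \<Rightarrow> (real \<times> (real^'n)) measure) set" where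
  "young_measures = {\<nu>.
     (\<forall>t>0. \<forall>x\<in>torus. \<nu> t x \<in> space (prob_algebra (restrict_space borel phase_space))) \<and>
     (\<forall>b\<in>C0_phase. (\<lambda>(t, x). \<integral>s. b s \<partial>\<nu> t x) \<in> borel_measurable (lebesgue_on ({0<..} \<times> torus)))}"


section \<open>Dissipative solutions\<close>

text \<open>The convex function |m|^2/r for nonnegative r, with its value \<open>\<infinity>\<close>.\<close>

definition msq_over :: "real \<Rightarrow> real^'n \<Rightarrow> ennreal" where
  "msq_over r m = (if m = 0 then 0 else if r > 0 then ennreal ((norm m)\<^sup>2 / r) else \<infinity>)"

definition energy_density :: "real \<Rightarrow> real \<Rightarrow> real \<Rightarrow> real^'n \<Rightarrow> ennreal" where
  "energy_density a \<gamma> r m = ennreal (1 / 2) * msq_over r m + ennreal (a / (\<gamma> - 1) * r powr \<gamma>)"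

definition convective :: "real \<Rightarrow> real^'n \<Rightarrow> real^'n^'n" where
  "convective r m = (if r > 0 then (1 / r) *\<^sub>R tensor m m else 0)"

definition left_limit :: "(real \<Rightarrow> real) \<Rightarrow> real \<Rightarrow> real \<Rightarrow> real" where
  "left_limit E E0 t = (if t = 0 then E0 else Lim (at_left t) E)"

definition right_limit :: "(real \<Rightarrow> real) \<Rightarrow> real \<Rightarrow> real" where
  "right_limit E t = Lim (at_right t) E"

definition dissipative_solution ::
    "real \<Rightarrow> real \<Rightarrow> (real^'n \<Rightarrow> real) \<Rightarrow> (real^'n \<Rightarrow> real^'n) \<Rightarrow> real \<Rightarrow>
     (real \<Rightarrow> real^'n \<Rightarrow> real) \<Rightarrow> (real \<Rightarrow> real^'n \<Rightarrow> real^'n) \<Rightarrow> (real \<Rightarrow> real) \<Rightarrow> bool" where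
  "dissipative_solution a \<gamma> \<rho>0 m0 E0 \<rho> m E \<longleftrightarrow>
     \<rho>0 \<in> Lp_torus \<gamma> \<and> m0 \<in> Lp_torus (2 * \<gamma> / (\<gamma> + 1)) \<and> E0 \<ge> 0 \<and>
     \<rho> \<in> C_weak_Lp \<gamma> \<and> m \<in> C_weak_Lp (2 * \<gamma> / (\<gamma> + 1)) \<and> E \<in> BV_loc \<and>
     (\<exists>\<nu> Ckin Cint Cpress Cconv r.
        \<nu> \<in> young_measures \<and>
        Ckin \<in> Linf_weakstar torus C_torus \<and>
        Cint \<in> Linf_weakstar torus C_torus \<and>
        Cpress \<in> Linf_weakstar torus C_torus \<and>
        Cconv \<in> Linf_weakstar (torus \<times> sphere 0 1) C_torus_sphere \<and>
        (AE t in lebesgue_on {0<..}.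
           r t \<in> restrict_space borel torus \<rightarrow>\<^sub>M prob_algebra (restrict_space borel (sphere 0 1)) \<and>
           (\<forall>A\<in>sets (restrict_space borel torus). \<forall>B\<in>sets (restrict_space borel (sphere 0 1)).
              emeasure (Cconv t) (A \<times> B) = 2 * (\<integral>\<^sup>+x\<in>A. emeasure (r t x) B \<partial>Ckin t))) \<and>
        (AE t in lebesgue_on {0<..}. Cpress t = scale_measure (ennreal (\<gamma> - 1)) (Cint t)) \<and>
        \<comment> \<open>barycenters and total energy\<close>
        (AE \<tau> in lebesgue_on {0<..}.
           (AE x in LT. \<rho> \<tau> x = (\<integral>s. fst s \<partial>\<nu> \<tau> x) \<and> \<rho> \<tau> x \<ge> 0 \<and> m \<tau> x = (\<integral>s. snd s \<partial>\<nu> \<tau> x)) \<and>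
           E \<tau> \<ge> 0 \<and>
           ennreal (E \<tau>) =
             (\<integral>\<^sup>+x. (\<integral>\<^sup>+s. energy_density a \<gamma> (fst s) (snd s) \<partial>\<nu> \<tau> x) \<partial>LT)
             + emeasure (Ckin \<tau>) torus + emeasure (Cint \<tau>) torus) \<and>
        \<comment> \<open>continuity equation\<close>
        (AE x in LT. \<rho> 0 x = \<rho>0 x) \<and>
        (\<forall>\<tau>>0. \<forall>\<phi>\<in>C1c_torus.
           (\<integral>x. \<rho> \<tau> x * \<phi> \<tau> x \<partial>LT) - (\<integral>x. \<rho> 0 x * \<phi> 0 x \<partial>LT)
           = (LINT t:{0..\<tau>}|lebesgue. (\<integral>x. \<rho> t x * dt (\<lambda>s. \<phi> s x) t + m t x \<bullet> grad (\<phi> t) x \<partial>LT))) \<and>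
        \<comment> \<open>momentum equation\<close>
        (AE x in LT. m 0 x = m0 x) \<and>
        (\<forall>\<tau>>0. \<forall>\<phi>\<in>C1c_torus.
           (\<integral>x. m \<tau> x \<bullet> \<phi> \<tau> x \<partial>LT) - (\<integral>x. m 0 x \<bullet> \<phi> 0 x \<partial>LT)
           - (LINT t:{0..\<tau>}|lebesgue. (\<integral>x. m t x \<bullet> dt (\<lambda>s. \<phi> s x) t \<partial>LT))
           = (LINT t:{0..\<tau>}|lebesgue.
                (\<integral>x. (\<integral>s. convective (fst s) (snd s) \<partial>\<nu> t x) \<bullet> Grad (\<phi> t) x
                    + (\<integral>s. a * fst s powr \<gamma> \<partial>\<nu> t x) * divergence (\<phi> t) x \<partial>LT))
           + 2 * (LINT t:{0..\<tau>}|lebesgue.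
                (\<integral>x. (\<integral>\<xi>. tensor \<xi> \<xi> \<partial>r t x) \<bullet> Grad (\<phi> t) x \<partial>Ckin t))
           + (\<gamma> - 1) * (LINT t:{0..\<tau>}|lebesgue. (\<integral>x. divergence (\<phi> t) x \<partial>Cint t))) \<and>
        \<comment> \<open>energy inequality\<close>
        (\<forall>\<tau>1 \<tau>2. \<forall>\<psi>\<in>C1c. 0 \<le> \<tau>1 \<and> \<tau>1 \<le> \<tau>2 \<and> (\<forall>t\<ge>0. \<psi> t \<ge> 0) \<longrightarrow>
           right_limit E \<tau>2 * \<psi> \<tau>2 - left_limit E E0 \<tau>1 * \<psi> \<tau>1
           - (LINT t:{\<tau>1..\<tau>2}|lebesgue. E t * dt \<psi> t) \<le> 0))"


section \<open>The semiflow selection\<close>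

type_synonym 'n data = "(real^'n \<Rightarrow> real) \<times> (real^'n \<Rightarrow> real^'n) \<times> real"
type_synonym 'n traj = "(real \<Rightarrow> real^'n \<Rightarrow> real) \<times> (real \<Rightarrow> real^'n \<Rightarrow> real^'n) \<times> (real \<Rightarrow> real)"

text \<open>The condition \<open>0 \<le> E0\<close> is needed since \<open>ennreal\<close> maps negative reals to 0.\<close>

definition data_set :: "real \<Rightarrow> real \<Rightarrow> real \<Rightarrow> 'n::finite data set" where
  "data_set a \<gamma> l = {(\<rho>0, m0, E0). \<rho>0 \<in> Wneg l \<and> m0 \<in> Wneg l \<and> (AE x in LT. \<rho>0 x \<ge> 0) \<and> 0 \<le> E0 \<and>
     (\<integral>\<^sup>+x. energy_density a \<gamma> (\<rho>0 x) (m0 x) \<partial>LT) \<le> ennreal E0}"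

definition traj_space :: "real \<Rightarrow> 'n::finite traj set" where
  "traj_space l = {(\<rho>, m, E). \<rho> \<in> C_Wneg l \<and> m \<in> C_Wneg l \<and> E \<in> L1_loc}"

text \<open>Equality as elements of the trajectory space.\<close>

definition traj_eq :: "'n::finite traj \<Rightarrow> 'n traj \<Rightarrow> bool" where
  "traj_eq = (\<lambda>(\<rho>, m, E) (\<rho>', m', E').
     (\<forall>t\<ge>0. (AE x in LT. \<rho> t x = \<rho>' t x) \<and> (AE x in LT. m t x = m' t x)) \<and>
     (AE t in lebesgue_on {0<..}. E t = E' t))"

definition solution_set :: "real \<Rightarrow> real \<Rightarrow> real \<Rightarrow> 'n::finite data \<Rightarrow> 'n traj set" where
  "solution_set a \<gamma> l = (\<lambda>(\<rho>0, m0, E0).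
     {(\<rho>, m, E). (\<rho>, m, E) \<in> traj_space l \<and> dissipative_solution a \<gamma> \<rho>0 m0 E0 \<rho> m E})"

definition minimize :: "('u \<Rightarrow> real) \<Rightarrow> ('d \<Rightarrow> 'u set) \<Rightarrow> 'd \<Rightarrow> 'u set" where
  "minimize I V d = {u \<in> V d. \<forall>v\<in>V d. I u \<le> I v}"

definition smooth :: "(real \<Rightarrow> real) \<Rightarrow> bool" where
  "smooth \<beta> \<longleftrightarrow> (\<forall>n x. (deriv ^^ n) \<beta> differentiable (at x))"

definition trig_polynomial :: "(real^'n \<Rightarrow> 'b::euclidean_space) \<Rightarrow> bool" where
  "trig_polynomial f \<longleftrightarrow> (\<exists>K A B. finite K \<and>
     (\<forall>x. f x = (\<Sum>k\<in>K. cos (freq k \<bullet> x) *\<^sub>R A k + sin (freq k \<bullet> x) *\<^sub>R B k)))"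

text \<open>
  A (Schauder) basis e 1, e 2, ... of L^2 consisting of trigonometric polynomials; the value e 0
  is irrelevant.
\<close>

definition trig_basis :: "(nat \<Rightarrow> real^'n \<Rightarrow> 'b::euclidean_space) \<Rightarrow> bool" where
  "trig_basis e \<longleftrightarrow> (\<forall>n\<ge>1. trig_polynomial (e n)) \<and>
     (\<forall>f\<in>Lp_torus 2. \<exists>!c :: nat \<Rightarrow> real.
        (\<lambda>n. \<integral>x. (norm (f x - (\<Sum>k<n. c k *\<^sub>R e (Suc k) x)))\<^sup>2 \<partial>LT) \<longlonglongrightarrow> 0)"

definition index_triples :: "(nat \<times> nat \<times> nat) set" where
  "index_triples = {1..} \<times> {0} \<times> {0} \<union> {1..} \<times> {1..} \<times> {0} \<union> {1..} \<times> {0} \<times> {1..}"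

definition I_first :: "(real \<Rightarrow> real) \<Rightarrow> 'n::finite traj \<Rightarrow> real" where
  "I_first \<beta> = (\<lambda>(\<rho>, m, E). LINT t:{0<..}|lebesgue. exp (- t) * \<beta> (E t))"

definition I_triple ::
    "(real \<Rightarrow> real) \<Rightarrow> (nat \<Rightarrow> real) \<Rightarrow> (nat \<Rightarrow> real^'n \<Rightarrow> real) \<Rightarrow> (nat \<Rightarrow> real^'n \<Rightarrow> real^'n) \<Rightarrow>
     nat \<times> nat \<times> nat \<Rightarrow> 'n::finite traj \<Rightarrow> real" where
  "I_triple \<beta> lam e w = (\<lambda>(k, i, j) (\<rho>, m, E).
     LINT t:{0<..}|lebesgue. exp (- lam k * t) *
       \<beta> (if i = 0 \<and> j = 0 then E t
           else if j = 0 then (\<integral>x. \<rho> t x * e i x \<partial>LT)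
           else (\<integral>x. m t x \<bullet> w j x \<partial>LT)))"

text \<open>\<open>U_step \<dots> 0\<close> is the set of minimizers of the first functional; later steps follow the enumeration.\<close>

primrec U_step ::
    "real \<Rightarrow> real \<Rightarrow> real \<Rightarrow> (real \<Rightarrow> real) \<Rightarrow> (nat \<Rightarrow> real) \<Rightarrow> (nat \<Rightarrow> real^'n \<Rightarrow> real) \<Rightarrow>
     (nat \<Rightarrow> real^'n \<Rightarrow> real^'n) \<Rightarrow> (nat \<Rightarrow> nat \<times> nat \<times> nat) \<Rightarrow>
     nat \<Rightarrow> 'n::finite data \<Rightarrow> 'n traj set" where
  "U_step a \<gamma> l \<beta> lam e w enum 0 = minimize (I_first \<beta>) (solution_set a \<gamma> l)"
| "U_step a \<gamma> l \<beta> lam e w enum (Suc j) =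
     minimize (I_triple \<beta> lam e w (enum (Suc j))) (U_step a \<gamma> l \<beta> lam e w enum j)"

definition U_infinity ::
    "real \<Rightarrow> real \<Rightarrow> real \<Rightarrow> (real \<Rightarrow> real) \<Rightarrow> (nat \<Rightarrow> real) \<Rightarrow> (nat \<Rightarrow> real^'n \<Rightarrow> real) \<Rightarrow>
     (nat \<Rightarrow> real^'n \<Rightarrow> real^'n) \<Rightarrow> (nat \<Rightarrow> nat \<times> nat \<times> nat) \<Rightarrow>
     'n::finite data \<Rightarrow> 'n traj set" where
  "U_infinity a \<gamma> l \<beta> lam e w enum d = (\<Inter>j\<in>{1..}. U_step a \<gamma> l \<beta> lam e w enum j d)"

text \<open>
  U assigns to every datum in D the unique element of \<open>U_infinity\<close>; uniqueness refers to equality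
  in the trajectory space, that is, of the classes of functions modulo null sets.
\<close>

definition semiflow_selection ::
    "real \<Rightarrow> real \<Rightarrow> real \<Rightarrow> (real \<Rightarrow> real) \<Rightarrow> (nat \<Rightarrow> real) \<Rightarrow> (nat \<Rightarrow> real^'n \<Rightarrow> real) \<Rightarrow>
     (nat \<Rightarrow> real^'n \<Rightarrow> real^'n) \<Rightarrow> (nat \<Rightarrow> nat \<times> nat \<times> nat) \<Rightarrow>
     ('n::finite data \<Rightarrow> 'n traj) \<Rightarrow> bool" where
  "semiflow_selection a \<gamma> l \<beta> lam e w enum U \<longleftrightarrow>
     (\<forall>d\<in>data_set a \<gamma> l. U d \<in> U_infinity a \<gamma> l \<beta> lam e w enum d \<and>
        (\<forall>v\<in>U_infinity a \<gamma> l \<beta> lam e w enum d. traj_eq v (U d)))"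

end

theory Submission
  imports Defs "HOL-Real_Asymp.Real_Asymp"
begin
text \<open>
  An equilibrium state, once reached, is kept because the selected solution minimises the functional
  \<open>I_first\<close> among all dissipative solutions with the same data, and stopping a solution at the moment
  it reaches equilibrium produces a competitor with less energy.

  Let \<open>V\<close> be the volume of the torus, \<open>q = M / V\<close> and \<open>EM = a / (\<gamma> - 1) * q powr \<gamma> * V\<close>, the energy of the
  equilibrium.  For the selected solution \<open>(\<rho>, m, E)\<close> with \<open>\<rho> T = q\<close> and \<open>m T = 0\<close>, consider the
  trajectory \<open>\<rho> (min t T)\<close>, \<open>m (min t T)\<close> whose energy is \<open>E t\<close> for \<open>t < T\<close> and \<open>EM\<close> afterwards.  With the
  Young measure replaced after \<open>T\<close> by the Dirac measure at \<open>(q, 0)\<close> and the concentration measures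
  replaced by zero, it is again a dissipative solution with the same initial data
  (\<open>dissipative_solution_stop\<close>).  The three weak relations behave as follows.

  \<^item> Momentum equation: after \<open>T\<close> the only flux is the constant pressure, and the divergence of a periodic
    field has integral zero (\<open>integral_divergence\<close>).

  \<^item> Continuity equation: the time integral must be split at \<open>T\<close>, so the old integrand has to be integrable
    on \<open>{0..T}\<close>.  This holds because the weak formulation is required of every test function
    (\<open>continuity_flux_integrable\<close>).

  \<^item> Energy inequality: the energy may jump down at \<open>T\<close>, since the right limit of \<open>E\<close>, which exists by
    bounded variation, is at least \<open>EM\<close>.

  That \<open>EM \<le> E t\<close> for almost every \<open>t\<close> is Jensen's inequality, applied first to the Young
  measure at each point \<open>x\<close> (\<open>Jensen_energy_density\<close>) and then on the torus with the conserved mass;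
  equality forces \<open>\<rho> t = q\<close> and \<open>m t = 0\<close> (\<open>minimal_energy_rigidity\<close>).  Hence the competitor has pointwise
  smaller energy.  Minimality and strict monotonicity of \<open>\<beta>\<close> leave only \<open>E t = EM\<close> for almost every
  \<open>t > T\<close> (\<open>discounted_integral_strict\<close>), so that the state at almost every \<open>t > T\<close> is the equilibrium.  Weak
  continuity in time extends this to every \<open>t \<ge> T\<close> (\<open>C_weak_Lp_constant_after\<close>).
\<close>

section \<open>Integration of periodic functions\<close>

lemma torus_measurable [measurable]: "(torus :: (real^'n) set) \<in> sets borel"
  unfolding torus_def by measurable

lemma torus_lmeasurable: "(torus :: (real^'n) set) \<in> lmeasurable"
proof -
  have "torus \<subseteq> cbox (-1) (1 :: real^'n)"
    by (auto simp: torus_def mem_box_cart less_imp_le)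
  then have "bounded (torus :: (real^'n) set)"
    by (rule bounded_subset[OF bounded_cbox])
  then show ?thesis
    by (intro bounded_set_imp_lmeasurable) auto
qed

lemma torus_measure_pos: "0 < measure lebesgue (torus :: (real^'n) set)"
proof -
  have sub: "box (-1) (1 :: real^'n) \<subseteq> torus"
    by (auto simp: torus_def mem_box_cart less_imp_le)
  have ne: "box (-1) (1 :: real^'n) \<noteq> {}"
    by (auto simp: interval_ne_empty_cart)
  have "\<not> negligible (box (-1) (1 :: real^'n))"
    using ne by (intro open_not_negligible) auto
  then have "0 < measure lebesgue (box (-1) (1 :: real^'n))"
    by (metis lmeasurable_box measure_nonneg negligible_iff_measure0 order_le_less)
  also have "\<dots> \<le> measure lebesgue (torus :: (real^'n) set)"
    by (intro measure_mono_fmeasurable sub torus_lmeasurable) auto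
  finally show ?thesis .
qed

lemma finite_measure_LT: "finite_measure (LT :: (real^'n) measure)"
  using torus_lmeasurable by (intro finite_measure_lebesgue_on) 

lemma integrable_LT_const [simp]: "integrable (LT :: (real^'n) measure) (\<lambda>x. c :: 'b::{banach,second_countable_topology})"
  by (rule finite_measure.integrable_const[OF finite_measure_LT])

lemma integral_LT_const: "(\<integral>x. c \<partial>(LT :: (real^'n) measure)) = measure lebesgue (torus :: (real^'n) set) *\<^sub>R (c :: 'b::{banach,second_countable_topology})"
  by (subst lebesgue_integral_const) (simp add: measure_restrict_space)

text \<open>
  The half-open cube differs from the closed cube by a null set.  The closed cube is the form in
  which compactness, differentiation under the integral sign and the fundamental theorem of
  calculus apply.
\<close>

lemma integral_LT_cbox:
  fixes f :: "real^'n \<Rightarrow> 'b::euclidean_space"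
  assumes "continuous_on UNIV f"
  shows "integrable LT f" "(\<integral>x. f x \<partial>LT) = integral (cbox (-1) 1) f"
proof -
  let ?C = "cbox (-1) (1 :: real^'n)"
  have sub: "torus \<subseteq> ?C"
    by (auto simp: torus_def mem_box_cart less_imp_le)
  have ai: "f absolutely_integrable_on ?C"
    using assms by (intro absolutely_integrable_continuous) (auto intro: continuous_on_subset)
  then have "f absolutely_integrable_on torus"
    by (rule set_integrable_subset) (use sub in auto)
  then show i: "integrable LT f"
    by (simp add: integrable_restrict_space set_integrable_def)
  have "?C - torus \<subseteq> frontier ?C"
  proof -
    have "box (-1) (1 :: real^'n) \<subseteq> torus"
      by (auto simp: torus_def mem_box_cart less_imp_le)
    then show ?thesis
      by (auto simp: frontier_def interior_cbox)
  qed
  then have n: "negligible (?C - torus)"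
    using negligible_frontier_interval negligible_subset by (metis frontier_cbox)
  have "(\<integral>x. f x \<partial>LT) = integral torus f"
    by (intro lebesgue_integral_eq_integral i) auto
  also have "\<dots> = integral ?C f"
    by (rule integral_subset_negligible) (use sub n in auto)
  finally show "(\<integral>x. f x \<partial>LT) = integral ?C f" .
qed

lemma integrable_inner_continuous:
  fixes f g :: "real^'n \<Rightarrow> 'b::euclidean_space"
  assumes f: "integrable LT f" and g: "continuous_on UNIV g"
  shows "integrable LT (\<lambda>x. f x \<bullet> g x)"
proof -
  have "bounded (g ` cbox (-1) 1)"
    using g by (intro compact_imp_bounded compact_continuous_image) (auto intro: continuous_on_subset)
  then obtain B where B: "\<And>x. x \<in> cbox (-1) 1 \<Longrightarrow> norm (g x) \<le> B"
    by (auto simp: bounded_iff)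
  have sub: "torus \<subseteq> cbox (-1) (1 :: real^'n)"
    by (auto simp: torus_def mem_box_cart less_imp_le)
  have [measurable]: "f \<in> borel_measurable LT"
    using f by auto
  have [measurable]: "g \<in> borel_measurable LT"
    using integral_LT_cbox(1)[OF g] by auto
  show ?thesis
  proof (rule Bochner_Integration.integrable_bound)
    show "integrable LT (\<lambda>x. B * norm (f x))"
      using f by auto
    have "norm (f x \<bullet> g x) \<le> norm (B * norm (f x))" if "x \<in> torus" for x
    proof -
      have "norm (f x \<bullet> g x) \<le> norm (f x) * norm (g x)"
        by (simp add: Cauchy_Schwarz_ineq2)
      also have "\<dots> \<le> norm (f x) * B"
        using B that sub by (intro mult_left_mono) auto
      finally show ?thesis
        by (simp add: mult.commute abs_if split: if_splits) 
    qed
    then show "AE x in LT. norm (f x \<bullet> g x) \<le> norm (B * norm (f x))"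
      by (intro AE_I2) auto
  qed measurable
qed

text \<open>
  The translated cube splits into the part \<open>A\<close> that stays inside the fundamental domain and a part
  that is carried back to \<open>B\<close> by the period in direction \<open>j\<close>.
\<close>

lemma integral_periodic_shift:
  fixes f :: "real^'n \<Rightarrow> 'b::euclidean_space"
  assumes f: "continuous_on UNIV f" "periodic f" and s: "0 \<le> s" "s \<le> 2"
  shows "(\<integral>x. f (x + s *\<^sub>R axis j 1) \<partial>LT) = (\<integral>x. f x \<partial>LT)"
proof -
  let ?e = "axis j 1 :: real^'n"
  \<comment> \<open>\<open>A\<close> is the overlap of the cube with its translate; \<open>B\<close> is the rest of the translate, moved back by one period.\<close>
  define A where "A = {x::real^'n. x \<in> torus \<and> x $ j \<ge> -1 + s}"
  define B where "B = {x::real^'n. x \<in> torus \<and> x $ j < -1 + s}"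
  have [measurable]: "A \<in> sets borel" "B \<in> sets borel"
    unfolding A_def B_def by measurable
  have [measurable]: "f \<in> borel_measurable borel"
    using f(1) by (rule borel_measurable_continuous_onI)
  have eq: "(\<integral>x. g x \<partial>LT) = (\<integral>x. indicator torus x *\<^sub>R g x \<partial>lborel)"
    if "g \<in> borel_measurable borel" for g :: "real^'n \<Rightarrow> 'b"
    using that by (subst integral_restrict_space) (auto simp: integral_completion)
  have transl: "(\<integral>x. g (c + x) \<partial>lborel) = (\<integral>x. g x \<partial>lborel)"
    if "g \<in> borel_measurable borel" for g :: "real^'n \<Rightarrow> 'b" and c
    using that by (subst (2) lborel_distr_plus[symmetric, of c]) (simp add: integral_distr)
  have intA: "integrable lborel (\<lambda>x. indicator D x *\<^sub>R f x)" if "D \<subseteq> torus" "D \<in> sets borel" for D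
  proof -
    have "set_integrable lebesgue torus f"
      using integral_LT_cbox(1)[OF f(1)] by (simp add: integrable_restrict_space set_integrable_def)
    then have "set_integrable lebesgue D f"
      by (rule set_integrable_subset) (use that in auto)
    then show ?thesis
      using that unfolding set_integrable_def by (simp add: integrable_completion)
  qed
  have per: "f (x + axis i 2) = f x" for x i
    using f(2) by (auto simp: periodic_def)
  have "(\<integral>x. f (x + s *\<^sub>R ?e) \<partial>LT) = (\<integral>x. indicator torus x *\<^sub>R f (x + s *\<^sub>R ?e) \<partial>lborel)"
    by (rule eq) measurable
  also have "\<dots> = (\<integral>x. indicator torus ((- s *\<^sub>R ?e) + x) *\<^sub>R f ((- s *\<^sub>R ?e) + x + s *\<^sub>R ?e) \<partial>lborel)"
    by (rule transl[symmetric]) measurable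
  also have "\<dots> = (\<integral>x. indicator A x *\<^sub>R f x + indicator B ((- axis j 2) + x) *\<^sub>R f ((- axis j 2) + x) \<partial>lborel)"
  proof (rule Bochner_Integration.integral_cong[OF refl])
    fix x :: "real^'n"
    have fx: "f ((- axis j 2) + x) = f x"
      using per[of "(- axis j 2) + x" j] by simp
    have "indicator torus ((- s *\<^sub>R ?e) + x) = (indicator A x + indicator B ((- axis j 2) + x) :: real)"
    proof -
      have 1: "(- s *\<^sub>R ?e) + x \<in> torus \<longleftrightarrow> (\<forall>i. i \<noteq> j \<longrightarrow> -1 \<le> x $ i \<and> x $ i < 1) \<and> -1 \<le> x $ j - s \<and> x $ j - s < 1"
        unfolding torus_def by (auto simp: axis_def split: if_splits)
      have 2: "x \<in> A \<longleftrightarrow> (\<forall>i. i \<noteq> j \<longrightarrow> -1 \<le> x $ i \<and> x $ i < 1) \<and> -1 \<le> x $ j - s \<and> x $ j < 1"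
        using s unfolding A_def torus_def by (auto; smt (verit))
      have 3: "(- axis j 2) + x \<in> B \<longleftrightarrow> (\<forall>i. i \<noteq> j \<longrightarrow> -1 \<le> x $ i \<and> x $ i < 1) \<and> 1 \<le> x $ j \<and> x $ j - s < 1"
        using s unfolding B_def torus_def by (auto simp: axis_def split: if_splits; smt (verit))
      show ?thesis
        using 1 2 3 s unfolding indicator_def by auto
    qed
    moreover have "(- s *\<^sub>R ?e) + x + s *\<^sub>R ?e = x"
      by simp
    ultimately show "indicator torus ((- s *\<^sub>R ?e) + x) *\<^sub>R f ((- s *\<^sub>R ?e) + x + s *\<^sub>R ?e) =
      indicator A x *\<^sub>R f x + indicator B ((- axis j 2) + x) *\<^sub>R f ((- axis j 2) + x)"
      by (simp only: fx scaleR_left_distrib)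
  qed
  also have "\<dots> = (\<integral>x. indicator A x *\<^sub>R f x \<partial>lborel)
      + (\<integral>x. indicator B ((- axis j 2) + x) *\<^sub>R f ((- axis j 2) + x) \<partial>lborel)"
  proof (rule Bochner_Integration.integral_add)
    show "integrable lborel (\<lambda>x. indicator A x *\<^sub>R f x)"
      by (rule intA) (auto simp: A_def)
    have iB: "integrable lborel (\<lambda>x. indicator B x *\<^sub>R f x)"
      by (rule intA) (auto simp: B_def)
    have "integrable (distr lborel borel ((+) (- axis j 2))) (\<lambda>x. indicator B x *\<^sub>R f x)"
      using iB by (simp only: lborel_distr_plus)
    then show "integrable lborel (\<lambda>x. indicator B ((- axis j 2) + x) *\<^sub>R f ((- axis j 2) + x))"
      by (rule integrable_distr[rotated]) simp
  qed
  also have "(\<integral>x. indicator B ((- axis j 2) + x) *\<^sub>R f ((- axis j 2) + x) \<partial>lborel)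
      = (\<integral>x. indicator B x *\<^sub>R f x \<partial>lborel)"
    by (rule transl[of "\<lambda>x. indicator B x *\<^sub>R f x"]) measurable
  also have "(\<integral>x. indicator A x *\<^sub>R f x \<partial>lborel) + (\<integral>x. indicator B x *\<^sub>R f x \<partial>lborel)
      = (\<integral>x. indicator A x *\<^sub>R f x + indicator B x *\<^sub>R f x \<partial>lborel)"
    by (rule Bochner_Integration.integral_add[symmetric]; rule intA) (auto simp: A_def B_def)
  also have "\<dots> = (\<integral>x. indicator torus x *\<^sub>R f x \<partial>lborel)"
    by (rule Bochner_Integration.integral_cong) (auto simp: A_def B_def indicator_def)
  also have "\<dots> = (\<integral>x. f x \<partial>LT)"
    by (rule eq[symmetric]) measurable
  finally show ?thesis .
qed

text \<open>
  By \<open>integral_periodic_shift\<close> the integral over the translated torus does not depend on the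
  length of the translation; differentiating it under the integral sign at zero gives the claim
  without any iterated integral.
\<close>

lemma integral_periodic_partial_derivative:
  fixes f :: "real^'n \<Rightarrow> 'b::euclidean_space"
  assumes per: "periodic f" and diff: "\<And>x. f differentiable (at x)"
    and cont: "continuous_on UNIV (\<lambda>x. frechet_derivative f (at x) (axis j 1))"
  shows "(\<integral>x. frechet_derivative f (at x) (axis j 1) \<partial>LT) = 0"
proof -
  let ?e = "axis j 1 :: real^'n" and ?C = "cbox (-1) (1 :: real^'n)"
  have cf: "continuous_on UNIV f"
    using diff by (simp add: differentiable_imp_continuous_on differentiable_on_def)
  have "((\<lambda>s. integral ?C (\<lambda>x. f (x + s *\<^sub>R ?e))) has_vector_derivative
      integral ?C (\<lambda>x. frechet_derivative f (at (x + 0 *\<^sub>R ?e)) ?e)) (at 0 within {0..2})"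
  proof (rule leibniz_rule_vector_derivative)
    fix s :: real and x :: "real^'n"
    have "(f has_derivative frechet_derivative f (at (x + s *\<^sub>R ?e))) (at (x + s *\<^sub>R ?e))"
      using diff frechet_derivative_works by blast
    moreover have "((\<lambda>s. x + s *\<^sub>R ?e) has_derivative (\<lambda>h. h *\<^sub>R ?e)) (at s within {0..2})"
      by (auto intro!: derivative_eq_intros)
    ultimately have "(f \<circ> (\<lambda>s. x + s *\<^sub>R ?e) has_derivative
        frechet_derivative f (at (x + s *\<^sub>R ?e)) \<circ> (\<lambda>h. h *\<^sub>R ?e)) (at s within {0..2})"
      using diff_chain_within has_derivative_at_withinI by blast
    then show "((\<lambda>s. f (x + s *\<^sub>R ?e)) has_vector_derivative
        frechet_derivative f (at (x + s *\<^sub>R ?e)) ?e) (at s within {0..2})"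
      using linear_frechet_derivative[OF diff, of "x + s *\<^sub>R ?e"]
      by (simp add: has_vector_derivative_def o_def linear_cmul)
  next
    show "(\<lambda>x. f (x + s *\<^sub>R ?e)) integrable_on ?C" for s
      by (intro integrable_continuous continuous_on_compose2[OF cf] continuous_intros) auto
    show "continuous_on ({0..2} \<times> ?C) (\<lambda>(s, x). frechet_derivative f (at (x + s *\<^sub>R ?e)) ?e)"
      unfolding split_beta
      by (intro continuous_on_compose2[OF cont] continuous_intros) auto
  qed auto
  moreover have "integral ?C (\<lambda>x. f (x + s *\<^sub>R ?e)) = integral ?C f" if "s \<in> {0..2}" for s
  proof -
    have "continuous_on UNIV (\<lambda>x. f (x + s *\<^sub>R ?e))"
      by (intro continuous_on_compose2[OF cf] continuous_intros) auto
    then have "integral ?C (\<lambda>x. f (x + s *\<^sub>R ?e)) = (\<integral>x. f (x + s *\<^sub>R ?e) \<partial>LT)"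
      by (rule integral_LT_cbox(2)[symmetric])
    also have "\<dots> = integral ?C f"
      using integral_periodic_shift[OF cf per, of s j] integral_LT_cbox(2)[OF cf] that by simp
    finally show ?thesis .
  qed
  ultimately have "((\<lambda>s. integral ?C f) has_vector_derivative
      integral ?C (\<lambda>x. frechet_derivative f (at x) ?e)) (at 0 within {0..2})"
    by (subst (asm) has_vector_derivative_cong_ev[where g = "\<lambda>s. integral ?C f"])
       (auto simp: eventually_at_filter)
  moreover have "((\<lambda>s::real. integral ?C f) has_vector_derivative 0) (at 0 within {0..2})"
    by simp
  ultimately have "integral ?C (\<lambda>x. frechet_derivative f (at x) ?e) = 0"
    by (rule vector_derivative_unique_within[rotated]) (simp add: at_within_Icc_at_right)
  then show ?thesis
    using integral_LT_cbox(2)[OF cont] by simp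
qed

lemma integral_divergence:
  fixes f :: "real^'n \<Rightarrow> real^'n"
  assumes per: "periodic f" and diff: "\<And>x. f differentiable (at x)"
    and cont: "\<And>v. continuous_on UNIV (\<lambda>x. frechet_derivative f (at x) v)"
  shows "(\<integral>x. divergence f x \<partial>LT) = 0"
proof -
  have "(\<integral>x. divergence f x \<partial>LT) = (\<integral>x. (\<Sum>j\<in>UNIV. frechet_derivative f (at x) (axis j 1) $ j) \<partial>LT)"
    by (simp add: divergence_def jacobian_def trace_def matrix_def)
  also have "\<dots> = (\<Sum>j\<in>UNIV. \<integral>x. frechet_derivative f (at x) (axis j 1) $ j \<partial>LT)"
    by (intro Bochner_Integration.integral_sum integral_LT_cbox(1) continuous_intros cont)
  also have "\<dots> = (\<Sum>j\<in>UNIV. (\<integral>x. frechet_derivative f (at x) (axis j 1) \<partial>LT) $ j)"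
    by (intro sum.cong refl integral_bounded_linear bounded_linear_vec_nth integral_LT_cbox(1) cont)
  also have "\<dots> = 0"
    by (simp add: integral_periodic_partial_derivative[OF per diff cont])
  finally show ?thesis .
qed

section \<open>Test functions\<close>

text \<open>One-sided derivatives within \<open>{0..}\<close> are unique, also at the origin.\<close>

lemma at_within_atLeast_nontrivial: "t \<ge> (0::real) \<Longrightarrow> at t within {0..} \<noteq> bot"
proof -
  assume "t \<ge> 0"
  then have "t islimpt {0..}"
    by (intro islimpt_subset[OF islimpt_greaterThanLessThan1[of t "t + 1"]]) auto
  then show ?thesis
    by (simp add: trivial_limit_within)
qed

lemma dt_eqI:
  assumes "(f has_vector_derivative D) (at t within {0..})" "t \<ge> 0"
  shows "dt f t = D"
  unfolding dt_def using assms at_within_atLeast_nontrivial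
  by (auto intro: vector_derivative_within)

lemma dt_works:
  "f differentiable (at t within {0..}) \<Longrightarrow> (f has_vector_derivative dt f t) (at t within {0..})"
  unfolding dt_def by (simp add: vector_derivative_works)

lemma fundamental_theorem_dt:
  fixes f :: "real \<Rightarrow> real"
  assumes diff: "\<And>t. t \<ge> 0 \<Longrightarrow> (f has_vector_derivative f' t) (at t within {0..})"
    and cont: "continuous_on {0..} f'" and ab: "0 \<le> a" "a \<le> b"
  shows "set_integrable lebesgue {a..b} f'" "(LINT t:{a..b}|lebesgue. f' t) = f b - f a"
proof -
  have c: "continuous_on {a..b} f'"
    using cont by (rule continuous_on_subset) (use ab in auto)
  then show i: "set_integrable lebesgue {a..b} f'"
    using absolutely_integrable_continuous_real by blast
  have "(f' has_integral (f b - f a)) {a..b}"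
  proof (rule fundamental_theorem_of_calculus[OF ab(2)])
    fix x assume "x \<in> {a..b}"
    then show "(f has_vector_derivative f' x) (at x within {a..b})"
      using ab by (intro has_vector_derivative_within_subset[OF diff]) auto
  qed
  then show "(LINT t:{a..b}|lebesgue. f' t) = f b - f a"
    using set_lebesgue_integral_eq_integral(2)[OF i] by (simp add: integral_unique)
qed

lemma C1c_fundamental_theorem:
  assumes "\<psi> \<in> C1c" "0 \<le> a" "a \<le> b"
  shows "set_integrable lebesgue {a..b} (dt \<psi>)" "(LINT t:{a..b}|lebesgue. dt \<psi> t) = \<psi> b - \<psi> a"
  using fundamental_theorem_dt[of \<psi> "dt \<psi>" a b] assms dt_works unfolding C1c_def by auto

lemma C1c_torus_D:
  assumes "\<phi> \<in> C1c_torus" "t \<ge> 0"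
  shows "periodic (\<phi> t)" "continuous_on UNIV (\<phi> t)" "continuous_on UNIV (\<lambda>x. dt (\<lambda>s. \<phi> s x) t)"
    "\<And>x. \<phi> t differentiable (at x)" "\<And>v. continuous_on UNIV (\<lambda>x. frechet_derivative (\<phi> t) (at x) v)"
    "\<And>x. (\<lambda>s. \<phi> s x) differentiable (at t within {0..})"
proof -
  have slice: "continuous_on UNIV (f t)"
    if "continuous_on ({0..} \<times> UNIV) (\<lambda>(t, x). f t x)" for f :: "real \<Rightarrow> real^'a \<Rightarrow> 'c::topological_space"
  proof -
    have "continuous_on UNIV (\<lambda>x :: real^'a. (t, x))"
      by (intro continuous_on_Pair continuous_on_const continuous_on_id)
    from continuous_on_compose2[OF that this] show ?thesis
      using assms(2) by auto
  qed
  show "periodic (\<phi> t)" "\<And>x. \<phi> t differentiable (at x)"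
    "\<And>x. (\<lambda>s. \<phi> s x) differentiable (at t within {0..})"
    using assms by (auto simp: C1c_torus_def)
  show "continuous_on UNIV (\<phi> t)" "continuous_on UNIV (\<lambda>x. dt (\<lambda>s. \<phi> s x) t)"
    "\<And>v. continuous_on UNIV (\<lambda>x. frechet_derivative (\<phi> t) (at x) v)"
    using assms slice[of \<phi>] slice[of "\<lambda>t x. dt (\<lambda>s. \<phi> s x) t"]
      slice[of "\<lambda>t x. frechet_derivative (\<phi> t) (at x) v" for v]
    by (auto simp: C1c_torus_def)
qed

lemma continuous_grad:
  assumes "\<phi> \<in> C1c_torus" "t \<ge> 0"
  shows "continuous_on UNIV (grad (\<phi> t))"
  unfolding grad_def by (intro continuous_on_vec_lambda C1c_torus_D(5)[OF assms])

text \<open>Leibniz rule on the closed cube, followed by the fundamental theorem of calculus in time.\<close>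

lemma integral_time_derivative:
  fixes \<phi> :: "real \<Rightarrow> real^'n \<Rightarrow> real"
  assumes \<phi>: "\<phi> \<in> C1c_torus" and ab: "0 \<le> a" "a \<le> b"
  shows "set_integrable lebesgue {a..b} (\<lambda>t. \<integral>x. dt (\<lambda>s. \<phi> s x) t \<partial>LT)"
    "(LINT t:{a..b}|lebesgue. (\<integral>x. dt (\<lambda>s. \<phi> s x) t \<partial>LT)) = (\<integral>x. \<phi> b x \<partial>LT) - (\<integral>x. \<phi> a x \<partial>LT)"
proof -
  let ?C = "cbox (-1) (1 :: real^'n)"
  let ?g = "\<lambda>t. integral ?C (\<lambda>x. dt (\<lambda>s. \<phi> s x) t)"
  have cont: "continuous_on ({0..} \<times> ?C) (\<lambda>(t, x). dt (\<lambda>s. \<phi> s x) t)"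
    using \<phi> unfolding C1c_torus_def by (auto intro: continuous_on_subset)
  have d: "((\<lambda>t. integral ?C (\<phi> t)) has_vector_derivative ?g t) (at t within {0..})" if "t \<ge> 0" for t
  proof (rule leibniz_rule_vector_derivative[OF _ _ cont])
    show "((\<lambda>s. \<phi> s x) has_vector_derivative dt (\<lambda>s. \<phi> s x) s) (at s within {0..})" if "s \<in> {0..}" for s x
      using that C1c_torus_D(6)[OF \<phi>] by (intro dt_works) auto
    show "\<phi> s integrable_on ?C" if "s \<in> {0..}" for s
      using that C1c_torus_D(2)[OF \<phi>] by (intro integrable_continuous) (auto intro: continuous_on_subset)
  qed (use that in auto)
  have c: "continuous_on {0..} ?g"
    by (rule integral_continuous_on_param[OF cont])
  note ft = fundamental_theorem_dt[OF d c ab]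
  have eq: "(\<integral>x. dt (\<lambda>s. \<phi> s x) t \<partial>LT) = ?g t" if "t \<ge> 0" for t
    by (rule integral_LT_cbox(2)[OF C1c_torus_D(3)[OF \<phi> that]])
  have eq2: "(\<integral>x. \<phi> t x \<partial>LT) = integral ?C (\<phi> t)" if "t \<ge> 0" for t
    by (rule integral_LT_cbox(2)[OF C1c_torus_D(2)[OF \<phi> that]])
  have "set_integrable lebesgue {a..b} (\<lambda>t. \<integral>x. dt (\<lambda>s. \<phi> s x) t \<partial>LT) \<longleftrightarrow> set_integrable lebesgue {a..b} ?g"
    by (rule set_integrable_cong) (use eq ab in auto)
  then show "set_integrable lebesgue {a..b} (\<lambda>t. \<integral>x. dt (\<lambda>s. \<phi> s x) t \<partial>LT)"
    using ft(1) by simp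
  have "(LINT t:{a..b}|lebesgue. (\<integral>x. dt (\<lambda>s. \<phi> s x) t \<partial>LT)) = (LINT t:{a..b}|lebesgue. ?g t)"
    by (rule set_lebesgue_integral_cong) (use eq ab in auto)
  then show "(LINT t:{a..b}|lebesgue. (\<integral>x. dt (\<lambda>s. \<phi> s x) t \<partial>LT)) = (\<integral>x. \<phi> b x \<partial>LT) - (\<integral>x. \<phi> a x \<partial>LT)"
    using ft(2) eq2 ab by simp
qed

text \<open>
  A function of class \<open>C^1\<close> that is zero on a half line; the ramp and the cutoff below are built
  from it.
\<close>

lemma has_real_derivative_max_square:
  "((\<lambda>u::real. (max 0 u)\<^sup>2) has_real_derivative 2 * max 0 u) (at u)"
proof -
  consider "u > 0" | "u < 0" | "u = 0" by linarith
  then show ?thesis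
  proof cases
    case 1
    have "((\<lambda>u::real. u\<^sup>2) has_real_derivative 2 * max 0 u) (at u)"
      using 1 by (auto intro!: derivative_eq_intros)
    moreover have "\<forall>\<^sub>F v in nhds u. (max 0 v)\<^sup>2 = v\<^sup>2"
      using eventually_nhds_in_open[of "{0<..}" u] 1 by (auto elim!: eventually_mono)
    ultimately show ?thesis
      by (subst DERIV_cong_ev[OF refl _ refl])
  next
    case 2
    have "((\<lambda>u::real. 0) has_real_derivative 2 * max 0 u) (at u)"
      using 2 by auto
    moreover have "\<forall>\<^sub>F v in nhds u. (max 0 v)\<^sup>2 = 0"
      using eventually_nhds_in_open[of "{..<0}" u] 2 by (auto elim!: eventually_mono)
    ultimately show ?thesis
      by (subst DERIV_cong_ev[OF refl _ refl])
  next
    case 3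
    have "((\<lambda>h. ((max 0 (0 + h))\<^sup>2 - (max 0 (0::real))\<^sup>2) / h) \<longlongrightarrow> 0) (at 0)"
    proof (rule Lim_null_comparison)
      show "\<forall>\<^sub>F h in at 0. norm (((max 0 (0 + h))\<^sup>2 - (max 0 (0::real))\<^sup>2) / h) \<le> \<bar>h\<bar>"
        by (intro always_eventually) (auto simp: max_def power2_eq_square)
      show "((\<lambda>h::real. \<bar>h\<bar>) \<longlongrightarrow> 0) (at 0)"
        by (intro tendsto_rabs_zero tendsto_ident_at)
    qed
    then show ?thesis
      using 3 by (simp add: DERIV_def)
  qed
qed

lemma C1c_I:
  assumes "\<And>t. (f has_real_derivative f' t) (at t)" "continuous_on UNIV f'" "\<And>t. t \<ge> K \<Longrightarrow> f t = 0"
  shows "f \<in> C1c" "\<And>t. t \<ge> 0 \<Longrightarrow> dt f t = f' t"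
proof -
  have v: "(f has_vector_derivative f' t) (at t within {0..})" for t
    using assms(1) has_real_derivative_iff_has_vector_derivative has_vector_derivative_at_within by blast
  show d: "dt f t = f' t" if "t \<ge> 0" for t
    by (rule dt_eqI[OF v that])
  have "continuous_on {0..} (dt f) \<longleftrightarrow> continuous_on {0..} f'"
    by (rule continuous_on_cong) (auto simp: d)
  then have "continuous_on {0..} (dt f)"
    using assms(2) continuous_on_subset by blast
  moreover have "f differentiable (at t within {0..})" for t
    using v vector_derivative_works has_vector_derivative_def differentiable_def by blast
  ultimately show "f \<in> C1c"
    using assms(3) by (auto simp: C1c_def)
qed

text \<open>
  A time-dependent test function that vanishes at \<open>T\<close> but, for positive \<open>T\<close>, not at \<open>0\<close>; it
  detects mass in \<open>continuity_flux_integrable\<close>.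
\<close>

lemma ramp_C1c:
  fixes T :: real
  shows "(\<lambda>t. (max 0 (T - t))\<^sup>2) \<in> C1c"
proof (rule C1c_I(1)[where K = T])
  show "((\<lambda>t. (max 0 (T - t))\<^sup>2) has_real_derivative - (2 * max 0 (T - t))) (at t)" for t
  proof -
    have "((\<lambda>t. T - t) has_real_derivative - 1) (at t)"
      by (auto intro!: derivative_eq_intros)
    from DERIV_chain2[OF has_real_derivative_max_square this] show ?thesis
      by simp
  qed
qed (auto intro!: continuous_intros)

lemma time_cutoff_exists:
  fixes K :: real
  obtains \<zeta> where "\<zeta> \<in> C1c" "\<And>t. t \<le> K \<Longrightarrow> \<zeta> t = 1" "\<And>t. 0 \<le> t \<Longrightarrow> t \<le> K \<Longrightarrow> dt \<zeta> t = 0"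
proof
  let ?q = "\<lambda>u::real. (max 0 u)\<^sup>2"
  \<comment> \<open>Equal to \<open>1\<close> up to \<open>K\<close> and to \<open>0\<close> from \<open>K + 1\<close> on.\<close>
  let ?\<zeta> = "\<lambda>t. ?q (1 - ?q (t - K))"
  let ?d = "\<lambda>t. 2 * max 0 (1 - ?q (t - K)) * - (2 * max 0 (t - K))"
  have 1: "(?\<zeta> has_real_derivative ?d t) (at t)" for t
  proof (rule DERIV_chain2[OF has_real_derivative_max_square])
    have "((\<lambda>t. ?q (t - K)) has_real_derivative 2 * max 0 (t - K) * 1) (at t)"
      by (rule DERIV_chain2[OF has_real_derivative_max_square]) (auto intro!: derivative_eq_intros)
    then show "((\<lambda>t. 1 - ?q (t - K)) has_real_derivative - (2 * max 0 (t - K))) (at t)"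
      using DERIV_diff[OF DERIV_const, of _ _ t UNIV 1] by simp
  qed
  have 2: "continuous_on UNIV ?d"
    by (intro continuous_intros)
  have 3: "?\<zeta> t = 0" if "t \<ge> K + 1" for t
  proof -
    have "max 0 (1 - (max 0 (t - K))\<^sup>2) = 0"
      using that one_le_power[of "t - K" 2] by (simp add: max_absorb2)
    then show ?thesis
      by simp
  qed
  show "?\<zeta> \<in> C1c"
    by (rule C1c_I(1)[OF 1 2 3])
  show "dt ?\<zeta> t = 0" if "0 \<le> t" "t \<le> K" for t
    using C1c_I(2)[OF 1 2 3 that(1)] that by simp
qed auto

text \<open>
  Adding a function of time alone to a test function changes the weak continuity equation only
  through the total mass.
\<close>

lemma C1c_torus_add_time:
  fixes \<phi> :: "real \<Rightarrow> real^'n \<Rightarrow> real"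
  assumes \<phi>: "\<phi> \<in> C1c_torus" and \<eta>: "\<eta> \<in> C1c"
  shows "(\<lambda>t x. \<phi> t x + \<eta> t) \<in> C1c_torus"
    "\<And>t x. t \<ge> 0 \<Longrightarrow> dt (\<lambda>s. \<phi> s x + \<eta> s) t = dt (\<lambda>s. \<phi> s x) t + dt \<eta> t"
    "\<And>t x. t \<ge> 0 \<Longrightarrow> grad (\<lambda>x. \<phi> t x + \<eta> t) x = grad (\<phi> t) x"
proof -
  have d\<eta>: "\<eta> differentiable (at t within {0..})" if "t \<ge> 0" for t
    using \<eta> that by (auto simp: C1c_def)
  show dteq: "dt (\<lambda>s. \<phi> s x + \<eta> s) t = dt (\<lambda>s. \<phi> s x) t + dt \<eta> t" if "t \<ge> 0" for t x
    by (rule dt_eqI[OF has_vector_derivative_add that])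
       (use C1c_torus_D(6)[OF \<phi> that] d\<eta>[OF that] in \<open>auto intro: dt_works\<close>)
  have fd: "frechet_derivative (\<lambda>x. \<phi> t x + \<eta> t) (at x) = frechet_derivative (\<phi> t) (at x)" if "t \<ge> 0" for t x
  proof -
    have "((\<lambda>x. \<phi> t x + \<eta> t) has_derivative frechet_derivative (\<phi> t) (at x)) (at x)"
      using C1c_torus_D(4)[OF \<phi> that, of x] frechet_derivative_works
      by (auto intro!: derivative_eq_intros)
    then show ?thesis
      using frechet_derivative_at by metis
  qed
  then show "grad (\<lambda>x. \<phi> t x + \<eta> t) x = grad (\<phi> t) x" if "t \<ge> 0" for t x
    using that by (simp add: grad_def)
  obtain K where K: "\<forall>t\<ge>K. \<forall>x. \<phi> t x = 0"
    using \<phi> by (auto simp: C1c_torus_def)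
  obtain L where L: "\<forall>t\<ge>L. \<eta> t = 0"
    using \<eta> by (auto simp: C1c_def)
  have c\<eta>: "continuous_on {0..} \<eta>"
    using d\<eta> by (simp add: differentiable_imp_continuous_on differentiable_on_def)
  have cd\<eta>: "continuous_on {0..} (dt \<eta>)"
    using \<eta> by (auto simp: C1c_def)
  have cfst: "continuous_on ({0..} \<times> UNIV) (\<lambda>(t, x :: real^'n). f t)"
    if "continuous_on {0..} f" for f :: "real \<Rightarrow> real"
    unfolding split_beta by (rule continuous_on_compose2[OF that]) (auto intro: continuous_intros)
  show "(\<lambda>t x. \<phi> t x + \<eta> t) \<in> C1c_torus"
    unfolding C1c_torus_def mem_Collect_eq
  proof (intro conjI allI impI)
    show "periodic (\<lambda>x. \<phi> t x + \<eta> t)" if "t \<ge> 0" for t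
      using C1c_torus_D(1)[OF \<phi> that] by (simp add: periodic_def)
    show "\<exists>K. \<forall>t\<ge>K. \<forall>x. \<phi> t x + \<eta> t = 0"
      using K L by (intro exI[of _ "max K L"]) auto
    have "continuous_on ({0..} \<times> UNIV) (\<lambda>z. (case z of (t, x) \<Rightarrow> \<phi> t x) + (case z of (t, x) \<Rightarrow> \<eta> t))"
      using \<phi> by (intro continuous_on_add cfst c\<eta>) (simp add: C1c_torus_def)
    then show "continuous_on ({0..} \<times> UNIV) (\<lambda>(t, x). \<phi> t x + \<eta> t)"
      by (simp add: split_beta)
    show "(\<lambda>s. \<phi> s x + \<eta> s) differentiable (at t within {0..})" if "t \<ge> 0" for t x
      by (intro differentiable_add C1c_torus_D(6)[OF \<phi> that] d\<eta>[OF that])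
    show "(\<lambda>x. \<phi> t x + \<eta> t) differentiable (at x)" if "t \<ge> 0" for t x
      by (intro differentiable_add C1c_torus_D(4)[OF \<phi> that] differentiable_const)
    have "continuous_on ({0..} \<times> UNIV) (\<lambda>z. (case z of (t, x) \<Rightarrow> dt (\<lambda>s. \<phi> s x) t) + (case z of (t, x) \<Rightarrow> dt \<eta> t))"
      using \<phi> by (intro continuous_on_add cfst cd\<eta>) (simp add: C1c_torus_def)
    also have "?this \<longleftrightarrow> continuous_on ({0..} \<times> UNIV) (\<lambda>(t, x). dt (\<lambda>s. \<phi> s x + \<eta> s) t)"
      by (rule continuous_on_cong) (auto simp: dteq)
    finally show "continuous_on ({0..} \<times> UNIV) (\<lambda>(t, x). dt (\<lambda>s. \<phi> s x + \<eta> s) t)" .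
    show "continuous_on ({0..} \<times> UNIV) (\<lambda>(t, x). frechet_derivative (\<lambda>x. \<phi> t x + \<eta> t) (at x) v)" for v
    proof -
      have "continuous_on ({0..} \<times> UNIV) (\<lambda>(t, x). frechet_derivative (\<phi> t) (at x) v)"
        using \<phi> by (simp add: C1c_torus_def)
      also have "?this \<longleftrightarrow> ?thesis"
        by (rule continuous_on_cong) (auto simp: fd)
      finally show ?thesis .
    qed
  qed
qed

lemma C1c_torus_zero: "(\<lambda>t x. 0 :: real) \<in> C1c_torus"
proof -
  have "dt (\<lambda>s. 0 :: real) t = 0" if "t \<ge> 0" for t
    by (rule dt_eqI[OF _ that]) simp
  then have "continuous_on ({0..} \<times> UNIV) (\<lambda>(t, x :: real^'n). dt (\<lambda>s. 0 :: real) t) \<longleftrightarrow>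
      continuous_on ({0..} \<times> UNIV) (\<lambda>_ :: real \<times> (real^'n). 0 :: real)"
    by (intro continuous_on_cong) auto
  then show ?thesis
    by (simp add: C1c_torus_def periodic_def split_beta frechet_derivative_const)
qed

section \<open>Energies of bounded variation\<close>

lemma BV_locD:
  assumes "E \<in> BV_loc" "0 < K"
  obtains B where "\<And>s n. mono s \<Longrightarrow> range s \<subseteq> {0..K} \<Longrightarrow> (\<Sum>i<(n::nat). \<bar>E (s (Suc i)) - E (s i)\<bar>) \<le> B"
  using assms unfolding BV_loc_def by blast

text \<open>
  Choose finitely many points to the right of \<open>T\<close> whose variation is within \<open>\<epsilon>\<close> of the
  supremum over \<open>{T<..T + 1}\<close>.  To the left of these points no further oscillation of size
  \<open>\<epsilon>\<close> fits, so \<open>E\<close> is Cauchy at \<open>T\<close> from the right.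
\<close>

lemma BV_loc_right_limit_exists:
  assumes E: "E \<in> BV_loc" and T: "T \<ge> 0"
  shows "\<exists>L. (E \<longlongrightarrow> L) (at_right T)"
proof -
  let ?V = "\<lambda>s n. \<Sum>i<n. \<bar>E (s (Suc i)) - E (s i)\<bar>"
  define W where "W = {?V s n | s n. mono s \<and> range s \<subseteq> {T<..T + 1}}"
  obtain B where B: "\<And>s n. mono s \<Longrightarrow> range s \<subseteq> {0..T + 1} \<Longrightarrow> ?V s n \<le> B"
    using BV_locD[OF E, of "T + 1"] T by auto
  have bdd: "bdd_above W"
  proof (rule bdd_aboveI[of _ B])
    fix w assume "w \<in> W"
    then obtain s n where "w = ?V s n" "mono s" "range s \<subseteq> {T<..T + 1}"
      unfolding W_def by blast
    then show "w \<le> B"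
      using B[of s n] T by force
  qed
  have "?V (\<lambda>_. T + 1) 0 \<in> W"
    unfolding W_def by (intro CollectI exI[of _ "\<lambda>_. T + 1"] exI[of _ 0]) (auto simp: mono_def)
  then have ne: "W \<noteq> {}"
    by auto
  have cauchy: "\<exists>c>T. \<forall>p q. T < p \<longrightarrow> p \<le> q \<longrightarrow> q < c \<longrightarrow> \<bar>E q - E p\<bar> < \<epsilon>" if "\<epsilon> > 0" for \<epsilon>
  proof -
    have "Sup W - \<epsilon> < Sup W"
      using that by simp
    then obtain w where w: "w \<in> W" "Sup W - \<epsilon> < w"
      using less_cSup_iff[OF ne bdd] by blast
    then obtain s n where s: "w = ?V s n" "mono s" "range s \<subseteq> {T<..T + 1}"
      unfolding W_def by blast
    have "\<bar>E q - E p\<bar> < \<epsilon>" if pq: "T < p" "p \<le> q" "q < s 0" for p q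
    proof -
      \<comment> \<open>Prepend the two points \<open>p\<close> and \<open>q\<close> to the nearly optimal sequence.\<close>
      define s' where "s' = (\<lambda>i. case i of 0 \<Rightarrow> p | Suc 0 \<Rightarrow> q | Suc (Suc j) \<Rightarrow> s j)"
      have sT: "T < s i \<and> s i \<le> T + 1" for i
        using s(3) by (metis greaterThanAtMost_iff rangeI subsetD)
      have "s' i \<le> s' (Suc i)" for i
        using pq s(2) by (auto simp: s'_def split: nat.splits intro: monoD)
      then have "mono s'"
        by (simp add: mono_iff_le_Suc)
      moreover have "p \<le> T + 1" "q \<le> T + 1"
        using pq sT[of 0] by linarith+
      then have "s' i \<in> {T<..T + 1}" for i
        using pq sT by (auto simp: s'_def split: nat.splits)
      ultimately have "?V s' (Suc (Suc n)) \<in> W"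
        unfolding W_def by blast
      then have "?V s' (Suc (Suc n)) \<le> Sup W"
        using bdd by (rule cSup_upper)
      moreover have "?V s' (Suc (Suc n)) = \<bar>E q - E p\<bar> + (\<bar>E (s 0) - E q\<bar> + ?V s n)"
        by (simp add: sum.lessThan_Suc_shift s'_def del: sum.lessThan_Suc)
      ultimately show ?thesis
        using w(2) s(1) by linarith
    qed
    moreover have "s 0 > T"
      using s(3) by (metis greaterThanAtMost_iff rangeI subsetD)
    ultimately show ?thesis
      by blast
  qed
  let ?u = "\<lambda>n::nat. T + 1 / (real n + 1)"
  have u0: "?u \<longlonglongrightarrow> T + 0"
    by (intro tendsto_add tendsto_const) real_asymp
  have "Cauchy (\<lambda>n. E (?u n))"
    unfolding Cauchy_iff
  proof (intro allI impI)
    fix \<epsilon> :: real assume "\<epsilon> > 0"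
    then obtain c where c: "c > T" "\<And>p q. T < p \<Longrightarrow> p \<le> q \<Longrightarrow> q < c \<Longrightarrow> \<bar>E q - E p\<bar> < \<epsilon>"
      using cauchy by blast
    have "\<forall>\<^sub>F n in sequentially. ?u n < c"
      using order_tendstoD(2)[OF u0] c(1) by simp
    then obtain N where N: "\<And>n. n \<ge> N \<Longrightarrow> ?u n < c"
      by (auto simp: eventually_sequentially)
    have "\<bar>E (?u m) - E (?u n)\<bar> < \<epsilon>" if "m \<ge> N" "n \<ge> N" for m n
    proof (cases "?u m \<le> ?u n")
      case True
      then show ?thesis
        using c(2)[of "?u m" "?u n"] N[OF that(2)] by (simp add: abs_minus_commute)
    next
      case False
      then show ?thesis
        using c(2)[of "?u n" "?u m"] N[OF that(1)] by simp
    qed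
    then show "\<exists>M. \<forall>m\<ge>M. \<forall>n\<ge>M. norm (E (?u m) - E (?u n)) < \<epsilon>"
      by auto
  qed
  then obtain L where L: "(\<lambda>n. E (?u n)) \<longlonglongrightarrow> L"
    using Cauchy_convergent_iff convergent_def by blast
  have "(E \<longlongrightarrow> L) (at_right T)"
  proof (rule tendstoI)
    fix \<epsilon> :: real assume "\<epsilon> > 0"
    then obtain c where c: "c > T" "\<And>p q. T < p \<Longrightarrow> p \<le> q \<Longrightarrow> q < c \<Longrightarrow> \<bar>E q - E p\<bar> < \<epsilon> / 2"
      using cauchy[of "\<epsilon> / 2"] by auto
    have "\<forall>\<^sub>F n in sequentially. ?u n < c"
      using order_tendstoD(2)[OF u0] c(1) by simp
    moreover have "\<forall>\<^sub>F n in sequentially. dist (E (?u n)) L < \<epsilon> / 2"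
      using tendstoD[OF L, of "\<epsilon> / 2"] \<open>\<epsilon> > 0\<close> by simp
    ultimately have "\<forall>\<^sub>F n in sequentially. ?u n < c \<and> dist (E (?u n)) L < \<epsilon> / 2"
      by eventually_elim auto
    then obtain n where n: "?u n < c" "\<bar>E (?u n) - L\<bar> < \<epsilon> / 2"
      by (auto simp: eventually_sequentially dist_real_def)
    have "dist (E t) L < \<epsilon>" if "T < t" "t < c" for t
    proof -
      have "\<bar>E t - E (?u n)\<bar> < \<epsilon> / 2"
        using c(2)[of t "?u n"] c(2)[of "?u n" t] that n(1)
        by (cases "t \<le> ?u n") (auto simp: abs_minus_commute)
      then show ?thesis
        using n(2) unfolding dist_real_def by linarith
    qed
    then show "\<forall>\<^sub>F t in at_right T. dist (E t) L < \<epsilon>"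
      using c(1) by (auto simp: eventually_at_right)
  qed
  then show ?thesis
    by blast
qed

lemma BV_loc_bounded:
  assumes E: "E \<in> BV_loc" and K: "0 < K"
  obtains B where "\<And>t. 0 \<le> t \<Longrightarrow> t \<le> K \<Longrightarrow> \<bar>E t\<bar> \<le> B"
proof -
  obtain B where B: "\<And>s n. mono s \<Longrightarrow> range s \<subseteq> {0..K} \<Longrightarrow> (\<Sum>i<(n::nat). \<bar>E (s (Suc i)) - E (s i)\<bar>) \<le> B"
    using BV_locD[OF E K] by blast
  have "\<bar>E t\<bar> \<le> B + \<bar>E 0\<bar>" if "0 \<le> t" "t \<le> K" for t
  proof -
    have "mono (\<lambda>i::nat. if i = 0 then 0 else t)" "range (\<lambda>i::nat. if i = 0 then 0 else t) \<subseteq> {0..K}"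
      using that by (auto simp: mono_def)
    from B[OF this, of 1] show ?thesis
      by simp
  qed
  then show ?thesis
    using that by blast
qed

text \<open>The new function is \<open>E (min t T)\<close> plus a multiple of the monotone step at \<open>T\<close>.\<close>

lemma BV_loc_stop:
  assumes E: "E \<in> BV_loc" and T: "T \<ge> 0"
  shows "(\<lambda>t. if t < T then E t else c) \<in> BV_loc"
  unfolding BV_loc_def mem_Collect_eq
proof (intro allI impI)
  fix K :: real assume K: "K > 0"
  obtain B where B: "\<And>s n. mono s \<Longrightarrow> range s \<subseteq> {0..K} \<Longrightarrow> (\<Sum>i<(n::nat). \<bar>E (s (Suc i)) - E (s i)\<bar>) \<le> B"
    using BV_locD[OF E K] by blast
  let ?E = "\<lambda>t. if t < T then E t else c"
  have "(\<Sum>i<n. \<bar>?E (s (Suc i)) - ?E (s i)\<bar>) \<le> B + \<bar>c - E T\<bar>" if s: "mono s" "range s \<subseteq> {0..K}" for s and n :: nat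
  proof -
    let ?o = "\<lambda>i. of_bool (T \<le> s i) :: real"
    have o: "?o i \<le> ?o (Suc i)" for i
      using monoD[OF s(1), of i "Suc i"] by auto
    have "?E t = E (min t T) + of_bool (T \<le> t) * (c - E T)" for t
      by (auto simp: min_def)
    then have "\<bar>?E (s (Suc i)) - ?E (s i)\<bar>
        = \<bar>(E (min (s (Suc i)) T) - E (min (s i) T)) + (?o (Suc i) - ?o i) * (c - E T)\<bar>" for i
      by (simp add: algebra_simps)
    also have "\<dots> i \<le> \<bar>E (min (s (Suc i)) T) - E (min (s i) T)\<bar> + (?o (Suc i) - ?o i) * \<bar>c - E T\<bar>" for i
      using abs_triangle_ineq[of "E (min (s (Suc i)) T) - E (min (s i) T)" "(?o (Suc i) - ?o i) * (c - E T)"] o[of i]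
      by (simp add: abs_mult)
    finally have "(\<Sum>i<n. \<bar>?E (s (Suc i)) - ?E (s i)\<bar>)
        \<le> (\<Sum>i<n. \<bar>E (min (s (Suc i)) T) - E (min (s i) T)\<bar> + (?o (Suc i) - ?o i) * \<bar>c - E T\<bar>)"
      by (intro sum_mono)
    also have "\<dots> = (\<Sum>i<n. \<bar>E (min (s (Suc i)) T) - E (min (s i) T)\<bar>) + (?o n - ?o 0) * \<bar>c - E T\<bar>"
      using sum_lessThan_telescope[of ?o n] by (simp only: sum.distrib sum_distrib_right[symmetric])
    also have "\<dots> \<le> B + 1 * \<bar>c - E T\<bar>"
    proof (intro add_mono mult_right_mono)
      have "mono (\<lambda>i. min (s i) T)"
        using s(1) by (auto simp: mono_def min_le_iff_disj)
      moreover have "range (\<lambda>i. min (s i) T) \<subseteq> {0..K}"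
        using s(2) T by (fastforce simp: min_le_iff_disj)
      ultimately show "(\<Sum>i<n. \<bar>E (min (s (Suc i)) T) - E (min (s i) T)\<bar>) \<le> B"
        by (rule B)
    qed auto
    finally show ?thesis
      by simp
  qed
  then show "\<exists>B. \<forall>s n. mono s \<and> range s \<subseteq> {0..K} \<longrightarrow> (\<Sum>i<n. \<bar>?E (s (Suc i)) - ?E (s i)\<bar>) \<le> B"
    by blast
qed

text \<open>
  Local integrability concerns compact subintervals of the open half line, so measurability is
  obtained by exhaustion.
\<close>

lemma L1_loc_measurable:
  assumes "E \<in> L1_loc"
  shows "E \<in> borel_measurable (lebesgue_on {0<..})"
proof (rule borel_measurable_LIMSEQ_real)
  let ?f = "\<lambda>n t. indicator {1 / (real n + 2)..real n + 2} t *\<^sub>R E t"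
  show "?f n \<in> borel_measurable (lebesgue_on {0<..})" for n
  proof -
    have "1 / (real n + 2) < real n + 2"
      by (simp add: divide_less_eq) (smt (verit) mult_less_cancel_left1 of_nat_0_le_iff)
    then have "set_integrable lebesgue {1 / (real n + 2)..real n + 2} E"
      using assms unfolding L1_loc_def by auto
    then show ?thesis
      unfolding set_integrable_def by (intro measurable_restrict_space1 borel_measurable_integrable)
  qed
  fix t :: real assume "t \<in> space (lebesgue_on {0<..})"
  then have t: "t > 0" by simp
  have "\<forall>\<^sub>F n in sequentially. 1 / (real n + 2) < t" "\<forall>\<^sub>F n in sequentially. t < real n + 2"
    using t by real_asymp+
  then have "\<forall>\<^sub>F n in sequentially. ?f n t = E t"
    by eventually_elim auto
  then show "(\<lambda>n. ?f n t) \<longlonglongrightarrow> E t"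
    by (rule tendsto_eventually)
qed

text \<open>
  Local integrability says nothing near the origin; there the bound comes from the bounded
  variation.
\<close>

lemma BV_loc_times_continuous_integrable:
  fixes g :: "real \<Rightarrow> real"
  assumes BV: "E \<in> BV_loc" and L1: "E \<in> L1_loc" and g: "continuous_on {0..} g" and ab: "0 \<le> a"
  shows "set_integrable lebesgue {a..b} (\<lambda>t. E t * g t)"
proof -
  obtain B where B: "\<And>t. 0 \<le> t \<Longrightarrow> t \<le> \<bar>b\<bar> + 1 \<Longrightarrow> \<bar>E t\<bar> \<le> B"
    using BV_loc_bounded[OF BV, of "\<bar>b\<bar> + 1"] by (metis abs_ge_zero add_nonneg_pos zero_less_one)
  have gi: "set_integrable lebesgue {a..b} g"
    by (intro absolutely_integrable_continuous_real continuous_on_subset[OF g]) (use ab in auto)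
  have "(\<lambda>t. if t \<in> {0<..} then E t else 0) \<in> borel_measurable lebesgue"
    using L1_loc_measurable[OF L1] by (subst borel_measurable_if) auto
  moreover have "(\<lambda>t. indicator {a..b} t *\<^sub>R g t) \<in> borel_measurable lebesgue"
    using gi unfolding set_integrable_def by auto
  ultimately have "(\<lambda>t. (if t \<in> {0<..} then E t else 0) * (indicator {a..b} t *\<^sub>R g t)
      + indicator {0} t * (indicator {a..b} t * E 0 * g 0)) \<in> borel_measurable lebesgue"
    by (intro borel_measurable_add borel_measurable_times borel_measurable_indicator borel_measurable_const) auto
  also have "(\<lambda>t. (if t \<in> {0<..} then E t else 0) * (indicator {a..b} t *\<^sub>R g t)
      + indicator {0} t * (indicator {a..b} t * E 0 * g 0)) = (\<lambda>t. indicator {a..b} t *\<^sub>R (E t * g t))"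
    using ab by (auto simp: fun_eq_iff indicator_def not_less dest: order.antisym order.trans)
  finally have meas: "(\<lambda>t. indicator {a..b} t *\<^sub>R (E t * g t)) \<in> borel_measurable lebesgue" .
  show ?thesis
    unfolding set_integrable_def
  proof (rule Bochner_Integration.integrable_bound[OF _ meas])
    show "integrable lebesgue (\<lambda>t. \<bar>B\<bar> * (indicator {a..b} t *\<^sub>R g t))"
      using gi unfolding set_integrable_def by (rule integrable_mult_right)
    have "\<bar>E t\<bar> * \<bar>g t\<bar> \<le> \<bar>B\<bar> * \<bar>g t\<bar>" if "t \<in> {a..b}" for t
      using B[of t] that ab by (intro mult_right_mono) auto
    then show "AE t in lebesgue. norm (indicator {a..b} t *\<^sub>R (E t * g t)) \<le> norm (\<bar>B\<bar> * (indicator {a..b} t *\<^sub>R g t))"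
      by (intro AE_I2) (auto simp: indicator_def abs_mult)
  qed
qed

lemma L1_loc_stop:
  assumes "E \<in> L1_loc"
  shows "(\<lambda>t. if t < T then E t else c) \<in> L1_loc"
  unfolding L1_loc_def mem_Collect_eq
proof (intro allI impI)
  fix a b :: real assume ab: "0 < a \<and> a < b"
  then have "set_integrable lebesgue {a..b} E"
    using assms by (auto simp: L1_loc_def)
  then have "set_integrable lebesgue ({a..b} \<inter> {..<T}) E"
    by (rule set_integrable_subset) auto
  then have "set_integrable lebesgue ({a..b} \<inter> {..<T}) (\<lambda>t. if t < T then E t else c)"
    by (subst set_integrable_cong[OF refl refl, where f' = E]) auto
  moreover have "set_integrable lebesgue {a..b} (\<lambda>t. c)"
    by (intro absolutely_integrable_continuous_real) simp
  then have "set_integrable lebesgue ({a..b} \<inter> {T..}) (\<lambda>t. c)"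
    by (rule set_integrable_subset) auto
  then have "set_integrable lebesgue ({a..b} \<inter> {T..}) (\<lambda>t. if t < T then E t else c)"
    by (subst set_integrable_cong[OF refl refl, where f' = "\<lambda>t. c"]) auto
  ultimately have "set_integrable lebesgue ({a..b} \<inter> {..<T} \<union> {a..b} \<inter> {T..}) (\<lambda>t. if t < T then E t else c)"
    by (rule set_integrable_Un) auto
  also have "{a..b} \<inter> {..<T} \<union> {a..b} \<inter> {T..} = {a..b}"
    by auto
  finally show "set_integrable lebesgue {a..b} (\<lambda>t. if t < T then E t else c)" .
qed

section \<open>Jensen's inequality and minimal energy\<close>

text \<open>
  The power minus its tangent at \<open>r\<close> is strictly decreasing up to \<open>r\<close> and strictly increasing
  afterwards.  For \<open>r = 0\<close> the slope \<open>r powr (\<gamma> - 1)\<close> is zero.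
\<close>

lemma powr_tangent_strict:
  fixes r s \<gamma> :: real
  assumes "\<gamma> > 1" "r \<ge> 0" "s \<ge> 0" "s \<noteq> r"
  shows "r powr \<gamma> + \<gamma> * r powr (\<gamma> - 1) * (s - r) < s powr \<gamma>"
proof (cases "r = 0")
  case True
  then show ?thesis
    using assms by simp
next
  case False
  then have r: "r > 0"
    using assms by simp
  let ?f = "\<lambda>u. u powr \<gamma> - \<gamma> * r powr (\<gamma> - 1) * u"
  have cont: "continuous_on {0..} ?f"
    using assms by (intro continuous_intros continuous_on_powr') auto
  have der: "(?f has_real_derivative \<gamma> * (u powr (\<gamma> - 1) - r powr (\<gamma> - 1))) (at u)" if "u > 0" for u
    using that by (auto intro!: derivative_eq_intros simp: algebra_simps)
  have "?f r < ?f s"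
  proof (cases "r < s")
    case True
    then show ?thesis
    proof (rule DERIV_pos_imp_increasing_open)
      fix u assume u: "r < u" "u < s"
      then have "r powr (\<gamma> - 1) < u powr (\<gamma> - 1)"
        using r assms by (intro powr_less_mono2) auto
      then show "\<exists>y. (?f has_real_derivative y) (at u) \<and> 0 < y"
        using der[of u] u r assms by (intro exI[of _ "\<gamma> * (u powr (\<gamma> - 1) - r powr (\<gamma> - 1))"] conjI) auto
    qed (use r in \<open>auto intro: continuous_on_subset[OF cont]\<close>)
  next
    case False
    then have "s < r"
      using assms by simp
    then show ?thesis
    proof (rule DERIV_neg_imp_decreasing_open)
      fix u assume u: "s < u" "u < r"
      then have "u powr (\<gamma> - 1) < r powr (\<gamma> - 1)"
        using r assms by (intro powr_less_mono2) auto
      then show "\<exists>y. (?f has_real_derivative y) (at u) \<and> y < 0"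
        using der[of u] u r assms by (intro exI[of _ "\<gamma> * (u powr (\<gamma> - 1) - r powr (\<gamma> - 1))"] conjI) (auto simp: mult_less_0_iff)
    qed (use assms in \<open>auto intro: continuous_on_subset[OF cont]\<close>)
  qed
  moreover have "\<gamma> * r powr (\<gamma> - 1) * r = \<gamma> * r powr \<gamma>"
    using r by (simp add: powr_diff)
  ultimately show ?thesis
    by (simp add: algebra_simps)
qed

lemma powr_tangent:
  fixes r s \<gamma> :: real
  assumes "\<gamma> > 1" "r \<ge> 0" "s \<ge> 0"
  shows "r powr \<gamma> + \<gamma> * r powr (\<gamma> - 1) * (s - r) \<le> s powr \<gamma>"
  using powr_tangent_strict[OF assms] by (cases "s = r") auto

lemma energy_density_measurable [measurable]:
  "(\<lambda>s. energy_density a \<gamma> (fst s) (snd s :: real^'n)) \<in> borel_measurable borel"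
  unfolding energy_density_def msq_over_def borel_prod[symmetric] by measurable

text \<open>
  Completing the square: \<open>(norm m - c * s)\<^sup>2 \<ge> 0\<close>.  The bound is linear in \<open>s\<close> and
  \<open>norm m\<close>, so it survives averaging.  The free slope \<open>c\<close> shows later that the momentum vanishes.
\<close>

lemma kinetic_lower_bound:
  assumes "s \<ge> 0"
  shows "ennreal (c * norm m - c\<^sup>2 / 2 * s) \<le> ennreal (1 / 2) * msq_over s m"
proof (cases "m = 0 \<or> s = 0")
  case True
  then show ?thesis
    using assms by (auto simp: msq_over_def ennreal_neg ennreal_mult_top)
next
  case False
  then have "s > 0"
    using assms by auto
  have "0 \<le> (norm m - c * s)\<^sup>2"
    by simp
  then have "c * norm m * s - c\<^sup>2 / 2 * s * s \<le> 1 / 2 * (norm m)\<^sup>2"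
    by (simp add: power2_eq_square algebra_simps)
  then have "c * norm m - c\<^sup>2 / 2 * s \<le> 1 / 2 * ((norm m)\<^sup>2 / s)"
    using \<open>s > 0\<close> by (simp add: field_simps)
  then show ?thesis
    using False \<open>s > 0\<close> by (simp add: msq_over_def ennreal_mult[symmetric] del: ennreal_half)
qed

lemma energy_density_lower_bound:
  assumes "s \<ge> 0" "y \<le> a / (\<gamma> - 1) * s powr \<gamma>" "a > 0" "\<gamma> > 1"
  shows "ennreal (c * norm m - c\<^sup>2 / 2 * s + y) \<le> energy_density a \<gamma> s m"
proof -
  have "ennreal (c * norm m - c\<^sup>2 / 2 * s + y) \<le> ennreal (max 0 (c * norm m - c\<^sup>2 / 2 * s) + max 0 y)"
    by (intro ennreal_leI add_mono) auto
  also have "\<dots> = ennreal (c * norm m - c\<^sup>2 / 2 * s) + ennreal (max 0 y)"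
    by (subst ennreal_plus) (auto simp: ennreal_max_0)
  also have "\<dots> \<le> ennreal (1 / 2) * msq_over s m + ennreal (a / (\<gamma> - 1) * s powr \<gamma>)"
    using assms by (intro add_mono kinetic_lower_bound ennreal_leI) auto
  finally show ?thesis
    by (simp add: energy_density_def)
qed

text \<open>
  Turns Jensen's inequality for real integrands of either sign into a statement about the extended
  nonnegative energy.
\<close>

lemma ennreal_integral_le_nn_integral:
  assumes "integrable N h"
  shows "ennreal (\<integral>s. h s \<partial>N) \<le> (\<integral>\<^sup>+s. ennreal (h s) \<partial>N)"
proof -
  have "ennreal (\<integral>s. h s \<partial>N) \<le> ennreal (\<integral>s. max 0 (h s) \<partial>N)"
    using assms by (intro ennreal_leI integral_mono) auto
  also have "\<dots> = (\<integral>\<^sup>+s. ennreal (max 0 (h s)) \<partial>N)"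
    using assms by (intro nn_integral_eq_integral[symmetric]) auto
  finally show ?thesis
    by (simp add: ennreal_max_0)
qed

lemma phase_measurable:
  assumes "N \<in> space (prob_algebra (restrict_space borel (phase_space :: (real \<times> (real^'n)) set)))"
    and "f \<in> borel_measurable borel"
  shows "f \<in> borel_measurable N"
proof -
  have "sets N = sets (restrict_space borel (phase_space :: (real \<times> (real^'n)) set))"
    using assms(1) by (simp add: space_prob_algebra)
  then show ?thesis
    using measurable_restrict_space1[OF assms(2)] measurable_cong_sets by blast
qed

text \<open>
  Below the energy density lies the sum of the tangent of \<open>s powr \<gamma>\<close> at the barycentre \<open>r\<close>
  and the kinetic bound with slope \<open>c\<close>; averaging an affine function evaluates it at the
  barycentre.  If the averaged energy is finite, \<open>fst\<close> and \<open>snd\<close> are integrable, so the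
  barycentres are genuine integrals.
\<close>

lemma Jensen_energy_density:
  fixes N :: "(real \<times> (real^'n)) measure"
  assumes N: "N \<in> space (prob_algebra (restrict_space borel phase_space))"
    and a: "a > 0" and \<gamma>: "\<gamma> > 1" and c: "c \<ge> 0"
    and r: "r = (\<integral>s. fst s \<partial>N)" "r \<ge> 0" and m: "m = (\<integral>s. snd s \<partial>N)"
  shows "ennreal (c * norm m - c\<^sup>2 / 2 * r + a / (\<gamma> - 1) * r powr \<gamma>)
    \<le> (\<integral>\<^sup>+s. energy_density a \<gamma> (fst s) (snd s) \<partial>N)" (is "_ \<le> ?energy")
proof (cases "?energy = \<infinity>")
  case False
  interpret prob_space N
    using N by (simp add: space_prob_algebra)
  have spN: "space N = phase_space"
    using N sets_eq_imp_space_eq[of N "restrict_space borel phase_space"]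
    by (simp add: space_prob_algebra space_restrict_space)
  have pos: "fst s \<ge> 0" if "s \<in> space N" for s
    using that by (auto simp: spN phase_space_def)
  have mf: "fst \<in> borel_measurable N" and ms: "snd \<in> borel_measurable N"
    and me: "(\<lambda>s. energy_density a \<gamma> (fst s) (snd s)) \<in> borel_measurable N"
    by (rule phase_measurable[OF N borel_measurable_continuous_onI[OF continuous_on_fst[OF continuous_on_id]]]
        phase_measurable[OF N borel_measurable_continuous_onI[OF continuous_on_snd[OF continuous_on_id]]]
        phase_measurable[OF N energy_density_measurable])+
  define A where "A = a / (\<gamma> - 1)"
  have A: "A > 0"
    using a \<gamma> by (simp add: A_def)
  have if1: "integrable N fst"
  proof (rule integrableI_bounded[OF mf])
    have "ennreal (norm (fst s)) \<le> 1 + ennreal (1 / A) * energy_density a \<gamma> (fst s) (snd s)"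
      if s: "s \<in> space N" for s
    proof -
      \<comment> \<open>Either the density is at most \<open>1\<close> or the power dominates it.\<close>
      have "fst s \<le> 1 + fst s powr \<gamma>"
      proof (cases "fst s \<le> 1")
        case False
        then have "fst s powr 1 \<le> fst s powr \<gamma>"
          using \<gamma> by (intro powr_mono) auto
        then show ?thesis
          using False by simp
      qed (simp add: add_increasing2)
      then have "ennreal (norm (fst s)) \<le> ennreal (1 + 1 / A * (A * fst s powr \<gamma>))"
        using pos[OF s] A by (intro ennreal_leI) simp
      also have "\<dots> = 1 + ennreal (1 / A) * ennreal (A * fst s powr \<gamma>)"
        using A by (simp add: ennreal_plus ennreal_mult[symmetric])
      also have "ennreal (A * fst s powr \<gamma>) \<le> energy_density a \<gamma> (fst s) (snd s)"
        by (simp add: energy_density_def A_def)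
      finally show ?thesis
        by (simp add: mult_left_mono add_left_mono)
    qed
    then have "(\<integral>\<^sup>+s. norm (fst s) \<partial>N) \<le> (\<integral>\<^sup>+s. 1 + ennreal (1 / A) * energy_density a \<gamma> (fst s) (snd s) \<partial>N)"
      by (rule nn_integral_mono)
    also have "\<dots> = 1 + ennreal (1 / A) * ?energy"
      using me by (simp add: nn_integral_add nn_integral_cmult emeasure_space_1)
    also have "\<dots> < \<infinity>"
      using False by (simp add: ennreal_mult_less_top less_top)
    finally show "(\<integral>\<^sup>+s. norm (fst s) \<partial>N) < \<infinity>" .
  qed
  have is1: "integrable N snd"
  proof (rule integrableI_bounded[OF ms])
    have "ennreal (norm (snd s)) \<le> energy_density a \<gamma> (fst s) (snd s) + ennreal (fst s)" if s: "s \<in> space N" for s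
    proof -
      have "ennreal (norm (snd s)) \<le> ennreal (max 0 (1 * norm (snd s) - 1\<^sup>2 / 2 * fst s + 0) + fst s)"
        using pos[OF s] by (intro ennreal_leI) (auto simp: max_def)
      also have "\<dots> = ennreal (1 * norm (snd s) - 1\<^sup>2 / 2 * fst s + 0) + ennreal (fst s)"
        using pos[OF s] by (subst ennreal_plus) (auto simp: ennreal_max_0)
      also have "\<dots> \<le> energy_density a \<gamma> (fst s) (snd s) + ennreal (fst s)"
        using pos[OF s] a \<gamma> by (intro add_right_mono energy_density_lower_bound) auto
      finally show ?thesis .
    qed
    then have "(\<integral>\<^sup>+s. norm (snd s) \<partial>N) \<le> (\<integral>\<^sup>+s. energy_density a \<gamma> (fst s) (snd s) + ennreal (fst s) \<partial>N)"
      by (rule nn_integral_mono)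
    also have "\<dots> = ?energy + (\<integral>\<^sup>+s. fst s \<partial>N)"
      using me mf by (intro nn_integral_add) auto
    also have "(\<integral>\<^sup>+s. fst s \<partial>N) = ennreal (\<integral>s. fst s \<partial>N)"
      using pos if1 by (intro nn_integral_eq_integral) auto
    finally show "(\<integral>\<^sup>+s. norm (snd s) \<partial>N) < \<infinity>"
      using False by (auto simp: less_top intro: le_less_trans)
  qed
  let ?h = "\<lambda>s. c * norm (snd s) - c\<^sup>2 / 2 * fst s + A * (r powr \<gamma> + \<gamma> * r powr (\<gamma> - 1) * (fst s - r))"
  have ih: "integrable N ?h"
    using if1 is1 by auto
  have "(\<integral>s. ?h s \<partial>N) = c * (\<integral>s. norm (snd s) \<partial>N) - c\<^sup>2 / 2 * r + A * (r powr \<gamma> + \<gamma> * r powr (\<gamma> - 1) * (r - r))"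
    using if1 is1 by (simp add: r(1)[symmetric] prob_space del: diff_self)
  moreover have "c * norm m \<le> c * (\<integral>s. norm (snd s) \<partial>N)"
    unfolding m using c by (intro mult_left_mono integral_norm_bound) auto
  ultimately have "ennreal (c * norm m - c\<^sup>2 / 2 * r + A * r powr \<gamma>) \<le> ennreal (\<integral>s. ?h s \<partial>N)"
    by (intro ennreal_leI) simp
  also have "\<dots> \<le> (\<integral>\<^sup>+s. ennreal (?h s) \<partial>N)"
    by (rule ennreal_integral_le_nn_integral[OF ih])
  also have "\<dots> \<le> ?energy"
  proof (rule nn_integral_mono)
    fix s assume s: "s \<in> space N"
    have "A * (r powr \<gamma> + \<gamma> * r powr (\<gamma> - 1) * (fst s - r)) \<le> a / (\<gamma> - 1) * fst s powr \<gamma>"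
      unfolding A_def using powr_tangent[OF \<gamma> r(2) pos[OF s]] a \<gamma> by (intro mult_left_mono) auto
    then show "ennreal (?h s) \<le> energy_density a \<gamma> (fst s) (snd s)"
      using pos[OF s] a \<gamma> by (intro energy_density_lower_bound) auto
  qed
  finally show ?thesis
    by (simp add: A_def)
qed simp

text \<open>
  Jensen's inequality is applied for each \<open>x\<close> separately.  The lower bound depends on \<open>x\<close> only
  through the measurable barycentres, so monotonicity of the nonnegative integral carries it over
  to the torus.
\<close>

lemma energy_ge_barycentre:
  fixes \<rho> :: "real^'n \<Rightarrow> real" and m :: "real^'n \<Rightarrow> real^'n"
  assumes \<nu>: "\<And>x. x \<in> torus \<Longrightarrow> \<nu> x \<in> space (prob_algebra (restrict_space borel phase_space))"
    and a: "a > 0" and \<gamma>: "\<gamma> > 1"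
    and bary: "AE x in LT. \<rho> x = (\<integral>s. fst s \<partial>\<nu> x) \<and> \<rho> x \<ge> 0 \<and> m x = (\<integral>s. snd s \<partial>\<nu> x)"
    and E: "E \<ge> 0" "(\<integral>\<^sup>+x. (\<integral>\<^sup>+s. energy_density a \<gamma> (fst s) (snd s) \<partial>\<nu> x) \<partial>LT) \<le> ennreal E"
    and int: "integrable LT \<rho>" "integrable LT m" "integrable LT (\<lambda>x. norm (\<rho> x) powr \<gamma>)" and c: "c \<ge> 0"
  shows "c * (\<integral>x. norm (m x) \<partial>LT) - c\<^sup>2 / 2 * (\<integral>x. \<rho> x \<partial>LT) + a / (\<gamma> - 1) * (\<integral>x. norm (\<rho> x) powr \<gamma> \<partial>LT) \<le> E"
proof -
  let ?h = "\<lambda>x. c * norm (m x) - c\<^sup>2 / 2 * \<rho> x + a / (\<gamma> - 1) * norm (\<rho> x) powr \<gamma>"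
  have ih: "integrable LT ?h"
    using int by auto
  have "ennreal (\<integral>x. ?h x \<partial>LT) \<le> (\<integral>\<^sup>+x. ennreal (?h x) \<partial>LT)"
    by (rule ennreal_integral_le_nn_integral[OF ih])
  also have "\<dots> \<le> (\<integral>\<^sup>+x. (\<integral>\<^sup>+s. energy_density a \<gamma> (fst s) (snd s) \<partial>\<nu> x) \<partial>LT)"
  proof (rule nn_integral_mono_AE)
    show "AE x in LT. ennreal (?h x) \<le> (\<integral>\<^sup>+s. energy_density a \<gamma> (fst s) (snd s) \<partial>\<nu> x)"
      using bary AE_space
    proof eventually_elim
      case (elim x)
      then show ?case
        using Jensen_energy_density[OF \<nu> a \<gamma> c, of x "\<rho> x" "m x"] by auto
    qed
  qed
  also have "\<dots> \<le> ennreal E"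
    by (rule E)
  finally have "(\<integral>x. ?h x \<partial>LT) \<le> E"
    using E(1) by simp
  moreover have "(\<integral>x. ?h x \<partial>LT) = c * (\<integral>x. norm (m x) \<partial>LT) - c\<^sup>2 / 2 * (\<integral>x. \<rho> x \<partial>LT)
      + a / (\<gamma> - 1) * (\<integral>x. norm (\<rho> x) powr \<gamma> \<partial>LT)"
    using int by simp
  ultimately show ?thesis
    by simp
qed

text \<open>
  The tangent defect \<open>?D\<close> at \<open>q = M / V\<close> is nonnegative and its integral is, up to the factor
  \<open>a / (\<gamma> - 1)\<close>, the excess of internal energy over the equilibrium.  If there is no excess,
  strictness of the tangent inequality gives the constant density.  What remains is
  \<open>c * (\<integral>x. norm (m x) \<partial>LT) \<le> c\<^sup>2 / 2 * M\<close> for all \<open>c \<ge> 0\<close>, and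
  letting \<open>c\<close> tend to zero after division by \<open>c\<close> shows that the momentum vanishes.
\<close>

lemma minimal_energy_rigidity:
  fixes \<rho> :: "real^'n \<Rightarrow> real" and m :: "real^'n \<Rightarrow> real^'n"
  defines "V \<equiv> measure lebesgue (torus :: (real^'n) set)"
  assumes a: "a > 0" and \<gamma>: "\<gamma> > 1"
    and bound: "\<And>c. c \<ge> 0 \<Longrightarrow> c * (\<integral>x. norm (m x) \<partial>LT) - c\<^sup>2 / 2 * M + a / (\<gamma> - 1) * (\<integral>x. norm (\<rho> x) powr \<gamma> \<partial>LT) \<le> E"
    and \<rho>: "AE x in LT. \<rho> x \<ge> 0" "(\<integral>x. \<rho> x \<partial>LT) = M"
    and int: "integrable LT \<rho>" "integrable LT m" "integrable LT (\<lambda>x. norm (\<rho> x) powr \<gamma>)"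
  shows "a / (\<gamma> - 1) * (M / V) powr \<gamma> * V \<le> E"
    and "E = a / (\<gamma> - 1) * (M / V) powr \<gamma> * V \<Longrightarrow> (AE x in LT. \<rho> x = M / V) \<and> (AE x in LT. m x = 0)"
proof -
  have V: "V > 0"
    unfolding V_def by (rule torus_measure_pos)
  define q where "q = M / V"
  have "M \<ge> 0"
    using \<rho> integral_nonneg_AE by metis
  then have q: "q \<ge> 0"
    using V by (simp add: q_def)
  let ?D = "\<lambda>x. norm (\<rho> x) powr \<gamma> - (q powr \<gamma> + \<gamma> * q powr (\<gamma> - 1) * (\<rho> x - q))"
  have iD: "integrable LT ?D"
    using int by (intro Bochner_Integration.integrable_diff Bochner_Integration.integrable_add integrable_mult_right integrable_LT_const)
  have D: "(\<integral>x. ?D x \<partial>LT) = (\<integral>x. norm (\<rho> x) powr \<gamma> \<partial>LT) - q powr \<gamma> * V"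
  proof -
    have "(\<integral>x. \<rho> x - q \<partial>LT) = (\<integral>x. \<rho> x \<partial>LT) - (\<integral>x. q \<partial>(LT :: (real^'n) measure))"
      using int by (intro Bochner_Integration.integral_diff integrable_LT_const)
    then have "(\<integral>x. \<rho> x - q \<partial>LT) = 0"
      using V unfolding integral_LT_const by (simp add: \<rho>(2) V_def[symmetric] q_def)
    moreover have "(\<integral>x. ?D x \<partial>LT) = (\<integral>x. norm (\<rho> x) powr \<gamma> \<partial>LT)
        - ((\<integral>x. q powr \<gamma> \<partial>(LT :: (real^'n) measure)) + \<gamma> * q powr (\<gamma> - 1) * (\<integral>x. \<rho> x - q \<partial>LT))"
      using int by (subst Bochner_Integration.integral_diff Bochner_Integration.integral_add integral_mult_right_zero; (auto intro!: integrable_add integrable_mult_right)?)+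
    ultimately show ?thesis
      unfolding integral_LT_const by (simp add: V_def)
  qed
  have D0: "AE x in LT. ?D x \<ge> 0"
    using \<rho>(1) by eventually_elim (use powr_tangent[OF \<gamma> q] in auto)
  then have D1: "(\<integral>x. ?D x \<partial>LT) \<ge> 0"
    by (rule integral_nonneg_AE)
  define A where "A = a / (\<gamma> - 1)"
  define J where "J = (\<integral>x. ?D x \<partial>LT)"
  have A: "A > 0"
    using a \<gamma> by (simp add: A_def)
  have low: "c * (\<integral>x. norm (m x) \<partial>LT) - c\<^sup>2 / 2 * M + A * J + A * q powr \<gamma> * V \<le> E"
    if "c \<ge> 0" for c
    using bound[OF that] unfolding J_def D A_def by (simp add: algebra_simps)
  have AJ: "0 \<le> A * J"
    using A D1 by (simp add: J_def)
  show "a / (\<gamma> - 1) * (M / V) powr \<gamma> * V \<le> E"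
    using low[of 0] AJ by (simp add: q_def A_def)
  assume eq: "E = a / (\<gamma> - 1) * (M / V) powr \<gamma> * V"
  have "A * J \<le> 0"
    using low[of 0] eq by (simp add: q_def A_def)
  then have "(\<integral>x. ?D x \<partial>LT) = 0"
    using A D1 by (simp add: mult_le_0_iff J_def)
  then have "AE x in LT. ?D x = 0"
    using integral_nonneg_eq_0_iff_AE[OF iD D0] by simp
  then have 1: "AE x in LT. \<rho> x = M / V"
    using \<rho>(1)
  proof eventually_elim
    case (elim x)
    then show ?case
      using powr_tangent_strict[OF \<gamma> q, of "\<rho> x"] by (auto simp: q_def)
  qed
  let ?m = "\<integral>x. norm (m x) \<partial>LT"
  have "?m \<le> 0"
  proof (rule ccontr)
    assume "\<not> ?m \<le> 0"
    then have pos: "?m > 0" by simp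
    \<comment> \<open>Any positive \<open>c\<close> with \<open>c * M < 2 * ?m\<close> would do; adding \<open>1\<close> covers the case \<open>M = 0\<close>.\<close>
    define c where "c = ?m / (M + 1)"
    have c: "c > 0"
      using pos \<open>M \<ge> 0\<close> by (simp add: c_def)
    have "c * ?m - c\<^sup>2 / 2 * M \<le> 0"
      using low[of c] c eq AJ by (simp add: q_def A_def)
    then have "c * (?m - c / 2 * M) \<le> 0"
      by (simp add: power2_eq_square algebra_simps)
    then have "?m \<le> c / 2 * M"
      using c by (simp add: mult_le_0_iff)
    also have "\<dots> \<le> c * M / 2"
      by simp
    also have "c * M \<le> c * (M + 1)"
      using c by simp
    also have "c * (M + 1) = ?m"
      using \<open>M \<ge> 0\<close> by (simp add: c_def)
    finally show False
      using pos by simp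
  qed
  then have "?m = 0"
    by (simp add: order.antisym)
  then have "AE x in LT. norm (m x) = 0"
    using integral_nonneg_eq_0_iff_AE[of LT "\<lambda>x. norm (m x)"] int(2) by simp
  then show "(AE x in LT. \<rho> x = M / V) \<and> (AE x in LT. m x = 0)"
    using 1 by simp
qed

section \<open>Weak continuity in time\<close>

lemma AE_lebesgue_on_imp_ex_between:
  assumes "AE t in lebesgue_on {0<..}. P t" "0 \<le> a" "a < (b::real)"
  shows "\<exists>t. a < t \<and> t < b \<and> P t"
proof (rule ccontr)
  assume none: "\<not> ?thesis"
  have "AE t in lebesgue. t > 0 \<longrightarrow> P t"
    using assms(1) by (simp add: AE_restrict_space_iff)
  then obtain N where "N \<in> null_sets lebesgue" "{t. \<not> (t > 0 \<longrightarrow> P t)} \<subseteq> N"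
    by (auto simp: eventually_ae_filter)
  then have "negligible N" "{t. \<not> (t > 0 \<longrightarrow> P t)} \<subseteq> N"
    by (auto simp: negligible_iff_null_sets)
  moreover have "{a<..<b} \<subseteq> {t. \<not> (t > 0 \<longrightarrow> P t)}"
    using none assms(2) by auto
  ultimately have "negligible {a<..<b}"
    using negligible_subset by blast
  then show False
    using open_not_negligible[of "{a<..<b}"] assms(3) by auto
qed

text \<open>
  Times at which \<open>u t = c\<close> accumulate at \<open>\<tau>\<close> from the right.  Passing to the limit in the
  pairing with the bounded function \<open>sgn (u \<tau> - c)\<close> yields that the integral of
  \<open>norm (u \<tau> - c)\<close> is zero.
\<close>

lemma C_weak_Lp_constant_after:
  fixes u :: "real \<Rightarrow> real^'n \<Rightarrow> 'b::euclidean_space"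
  assumes u: "u \<in> C_weak_Lp p" and p: "p > 1" and T: "T \<ge> 0" "\<tau> \<ge> T" and int: "\<And>t. t \<ge> 0 \<Longrightarrow> integrable LT (u t)"
    and const: "AE t in lebesgue_on {0<..}. t > T \<longrightarrow> (AE x in LT. u t x = c)"
  shows "AE x in LT. u \<tau> x = c"
proof -
  define g where "g = (\<lambda>x. sgn (u \<tau> x - c))"
  have i\<tau>: "integrable LT (\<lambda>x. u \<tau> x - c)"
    using int[of \<tau>] T by auto
  have [measurable]: "(\<lambda>x. u \<tau> x - c) \<in> borel_measurable LT"
    using i\<tau> by auto
  have g_meas: "g \<in> borel_measurable LT"
    unfolding g_def sgn_div_norm by measurable
  have g1: "norm (g x) \<le> 1" for x
    by (simp add: g_def norm_sgn)
  have q: "p / (p - 1) > 0"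
    using p by simp
  have "g \<in> Lp_torus (p / (p - 1))"
    unfolding Lp_torus_def
  proof (intro CollectI conjI g_meas finite_measure.integrable_const_bound[OF finite_measure_LT, where B = 1])
    show "AE x in LT. norm (norm (g x) powr (p / (p - 1))) \<le> 1"
      using g1 q by (intro AE_I2) (simp add: powr_le1)
    show "(\<lambda>x. norm (g x) powr (p / (p - 1))) \<in> borel_measurable LT"
      using g_meas by measurable
  qed
  then have cont: "continuous_on {0..} (\<lambda>t. \<integral>x. u t x \<bullet> g x \<partial>LT)"
    using u by (auto simp: C_weak_Lp_def)
  \<comment> \<open>Points strictly to the right of \<open>\<tau> \<ge> T\<close> are later than \<open>T\<close>.\<close>
  have "\<exists>t. \<tau> < t \<and> t < \<tau> + 1 / (real n + 1) \<and> (t > T \<longrightarrow> (AE x in LT. u t x = c))" for n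
    using AE_lebesgue_on_imp_ex_between[OF const, of \<tau> "\<tau> + 1 / (real n + 1)"] T by auto
  then obtain s where s: "\<And>n. \<tau> < s n" "\<And>n. s n < \<tau> + 1 / (real n + 1)" "\<And>n. AE x in LT. u (s n) x = c"
    using le_less_trans[OF T(2)] by metis
  have "s \<longlonglongrightarrow> \<tau>"
  proof (rule tendsto_sandwich[OF _ _ tendsto_const])
    show "(\<lambda>n. \<tau> + 1 / (real n + 1)) \<longlonglongrightarrow> \<tau>"
      using tendsto_add[OF tendsto_const[of \<tau>] LIMSEQ_inverse_real_of_nat]
      by (simp add: inverse_eq_divide add.commute)
  qed (use s in \<open>auto intro!: always_eventually less_imp_le\<close>)
  moreover have "\<tau> \<ge> 0" "\<And>n. s n \<ge> 0"
    using T s(1) by (auto intro: less_imp_le le_less_trans)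
  ultimately have "(\<lambda>n. \<integral>x. u (s n) x \<bullet> g x \<partial>LT) \<longlonglongrightarrow> (\<integral>x. u \<tau> x \<bullet> g x \<partial>LT)"
    by - (rule continuous_on_tendsto_compose[OF cont], auto)
  moreover have "(\<integral>x. u (s n) x \<bullet> g x \<partial>LT) = (\<integral>x. c \<bullet> g x \<partial>LT)" for n
  proof (rule integral_cong_AE)
    have "s n \<ge> 0"
      using s(1)[of n] T by linarith
    then show "(\<lambda>x. u (s n) x \<bullet> g x) \<in> borel_measurable LT"
      using int g_meas by (intro borel_measurable_inner) auto
    show "(\<lambda>x. c \<bullet> g x) \<in> borel_measurable LT"
      using g_meas by measurable
    show "AE x in LT. u (s n) x \<bullet> g x = c \<bullet> g x"
      using s(3)[of n] by eventually_elim simp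
  qed
  ultimately have eq: "(\<integral>x. u \<tau> x \<bullet> g x \<partial>LT) = (\<integral>x. c \<bullet> g x \<partial>LT)"
    by (simp add: LIMSEQ_const_iff)
  have ib: "integrable LT (\<lambda>x. v x \<bullet> g x)" if "integrable LT v" for v
  proof (rule Bochner_Integration.integrable_bound[OF integrable_norm[OF that]])
    show "AE x in LT. norm (v x \<bullet> g x) \<le> norm (norm (v x))"
    proof (intro AE_I2)
      fix x
      have "norm (v x \<bullet> g x) \<le> norm (v x) * norm (g x)"
        by (simp add: Cauchy_Schwarz_ineq2)
      also have "\<dots> \<le> norm (v x) * 1"
        by (intro mult_left_mono g1) auto
      finally show "norm (v x \<bullet> g x) \<le> norm (norm (v x))"
        by simp
    qed
    show "(\<lambda>x. v x \<bullet> g x) \<in> borel_measurable LT"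
      using that g_meas by (intro borel_measurable_inner) auto
  qed
  have "(\<integral>x. norm (u \<tau> x - c) \<partial>LT) = (\<integral>x. u \<tau> x \<bullet> g x - c \<bullet> g x \<partial>LT)"
  proof (rule Bochner_Integration.integral_cong[OF refl])
    fix x
    have "v \<bullet> sgn v = norm v" for v :: 'b
      by (cases "v = 0") (simp_all add: sgn_div_norm dot_square_norm power2_eq_square)
    from this[of "u \<tau> x - c"] show "norm (u \<tau> x - c) = u \<tau> x \<bullet> g x - c \<bullet> g x"
      by (simp add: g_def inner_diff_left)
  qed
  also have "\<dots> = 0"
    using ib[OF int[of \<tau>]] ib[OF integrable_LT_const] eq T by simp
  finally have "AE x in LT. norm (u \<tau> x - c) = 0"
    using integral_nonneg_eq_0_iff_AE[OF integrable_norm[OF i\<tau>]] by simp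
  then show ?thesis
    by simp
qed

section \<open>Continuity equation of the stopped solution\<close>

definition continuity_eq :: "(real \<Rightarrow> real^'n \<Rightarrow> real) \<Rightarrow> (real \<Rightarrow> real^'n \<Rightarrow> real^'n) \<Rightarrow> bool" where
  "continuity_eq \<rho> m \<longleftrightarrow> (\<forall>\<tau>>0. \<forall>\<phi>\<in>C1c_torus.
     (\<integral>x. \<rho> \<tau> x * \<phi> \<tau> x \<partial>LT) - (\<integral>x. \<rho> 0 x * \<phi> 0 x \<partial>LT)
     = (LINT t:{0..\<tau>}|lebesgue. (\<integral>x. \<rho> t x * dt (\<lambda>s. \<phi> s x) t + m t x \<bullet> grad (\<phi> t) x \<partial>LT)))"

lemma continuity_eqD:
  assumes "continuity_eq \<rho> m" "\<phi> \<in> C1c_torus" "\<tau> > 0"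
  shows "(\<integral>x. \<rho> \<tau> x * \<phi> \<tau> x \<partial>LT) - (\<integral>x. \<rho> 0 x * \<phi> 0 x \<partial>LT)
     = (LINT t:{0..\<tau>}|lebesgue. (\<integral>x. \<rho> t x * dt (\<lambda>s. \<phi> s x) t + m t x \<bullet> grad (\<phi> t) x \<partial>LT))"
  using assms unfolding continuity_eq_def by blast

lemma set_integral_point: "(LINT t:{b..b::real}|lebesgue. f t) = (0::real)"
proof -
  have "AE t in lebesgue. indicator {b..b} t *\<^sub>R f t = 0"
    by (rule AE_I'[of "{b}"]) (auto simp: indicator_def)
  then show ?thesis
    unfolding set_lebesgue_integral_def by (rule integral_eq_zero_AE)
qed

lemma set_integral_split:
  fixes f :: "real \<Rightarrow> real"
  assumes "set_integrable lebesgue {a..b} f" "set_integrable lebesgue {b..c} f" "a \<le> b" "b \<le> c"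
  shows "(LINT t:{a..c}|lebesgue. f t) = (LINT t:{a..b}|lebesgue. f t) + (LINT t:{b..c}|lebesgue. f t)"
proof -
  have "{a..c} = {a..b} \<union> {b..c}"
    using assms by auto
  moreover have "AE t in lebesgue. \<not> (t \<in> {a..b} \<and> t \<in> {b..c})"
    by (rule AE_I'[of "{b}"]) auto
  ultimately show ?thesis
    using assms by (simp add: set_integral_Un_AE)
qed

text \<open>
  Both integrands, extended by zero outside the intervals, are the same function; the identity
  therefore includes the case of divergent integrals.
\<close>

lemma set_integral_stop:
  fixes f g :: "real \<Rightarrow> real"
  assumes "\<And>t. 0 \<le> t \<Longrightarrow> t \<le> T \<Longrightarrow> g t = f t" "\<And>t. T < t \<Longrightarrow> 0 \<le> t \<Longrightarrow> g t = 0"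
  shows "(LINT t:{0..\<tau>}|lebesgue. g t) = (LINT t:{0..min \<tau> T}|lebesgue. f t)"
proof -
  have "(\<lambda>t. indicator {0..\<tau>} t *\<^sub>R g t) = (\<lambda>t. indicator {0..min \<tau> T} t *\<^sub>R f t)"
  proof
    fix t show "indicator {0..\<tau>} t *\<^sub>R g t = indicator {0..min \<tau> T} t *\<^sub>R f t"
      using assms[of t] by (cases "t \<le> T") (auto simp: indicator_def)
  qed
  then show ?thesis
    unfolding set_lebesgue_integral_def by simp
qed

lemma integrable_continuity_terms:
  assumes \<phi>: "\<phi> \<in> C1c_torus" "t \<ge> 0" and int: "integrable LT (r :: real^'n \<Rightarrow> real)" "integrable LT v"
  shows "integrable LT (\<lambda>x. r x * \<phi> t x)" "integrable LT (\<lambda>x. r x * dt (\<lambda>s. \<phi> s x) t + v x \<bullet> grad (\<phi> t) x)"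
  using integrable_inner_continuous[OF int(1) C1c_torus_D(2)[OF \<phi>]]
    integrable_inner_continuous[OF int(1) C1c_torus_D(3)[OF \<phi>]]
    integrable_inner_continuous[OF int(2) continuous_grad[OF \<phi>]]
  by auto

lemma continuity_terms_add_time:
  fixes \<phi> :: "real \<Rightarrow> real^'n \<Rightarrow> real"
  assumes \<phi>: "\<phi> \<in> C1c_torus" and \<eta>: "\<eta> \<in> C1c" and t: "t \<ge> 0" and int: "integrable LT r" "integrable LT v"
  shows "(\<integral>x. r x * (\<phi> t x + \<eta> t) \<partial>LT) = (\<integral>x. r x * \<phi> t x \<partial>LT) + (\<integral>x. r x \<partial>LT) * \<eta> t"
    "(\<integral>x. r x * dt (\<lambda>s. \<phi> s x + \<eta> s) t + v x \<bullet> grad (\<lambda>x. \<phi> t x + \<eta> t) x \<partial>LT)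
      = (\<integral>x. r x * dt (\<lambda>s. \<phi> s x) t + v x \<bullet> grad (\<phi> t) x \<partial>LT) + (\<integral>x. r x \<partial>LT) * dt \<eta> t"
proof -
  note i = integrable_continuity_terms[OF \<phi> t int]
  have "(\<integral>x. r x * (\<phi> t x + \<eta> t) \<partial>LT) = (\<integral>x. r x * \<phi> t x + r x * \<eta> t \<partial>LT)"
    by (simp add: distrib_left)
  also have "\<dots> = (\<integral>x. r x * \<phi> t x \<partial>LT) + (\<integral>x. r x \<partial>LT) * \<eta> t"
    using i int by simp
  finally show "(\<integral>x. r x * (\<phi> t x + \<eta> t) \<partial>LT) = (\<integral>x. r x * \<phi> t x \<partial>LT) + (\<integral>x. r x \<partial>LT) * \<eta> t" .
  have "(\<integral>x. r x * dt (\<lambda>s. \<phi> s x + \<eta> s) t + v x \<bullet> grad (\<lambda>x. \<phi> t x + \<eta> t) x \<partial>LT)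
      = (\<integral>x. (r x * dt (\<lambda>s. \<phi> s x) t + v x \<bullet> grad (\<phi> t) x) + r x * dt \<eta> t \<partial>LT)"
    using C1c_torus_add_time(2,3)[OF \<phi> \<eta> t] by (intro Bochner_Integration.integral_cong) (auto simp: distrib_left)
  also have "\<dots> = (\<integral>x. r x * dt (\<lambda>s. \<phi> s x) t + v x \<bullet> grad (\<phi> t) x \<partial>LT) + (\<integral>x. r x \<partial>LT) * dt \<eta> t"
    using i int by simp
  finally show "(\<integral>x. r x * dt (\<lambda>s. \<phi> s x + \<eta> s) t + v x \<bullet> grad (\<lambda>x. \<phi> t x + \<eta> t) x \<partial>LT)
      = (\<integral>x. r x * dt (\<lambda>s. \<phi> s x) t + v x \<bullet> grad (\<phi> t) x \<partial>LT) + (\<integral>x. r x \<partial>LT) * dt \<eta> t" .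
qed

text \<open>Test with a function of time that is constant on \<open>{0..\<tau>}\<close>.\<close>

lemma mass_conservation:
  fixes \<rho> :: "real \<Rightarrow> real^'n \<Rightarrow> real"
  assumes eq: "continuity_eq \<rho> m" and int: "\<And>t. t \<ge> 0 \<Longrightarrow> integrable LT (\<rho> t)" "\<And>t. t \<ge> 0 \<Longrightarrow> integrable LT (m t)"
    and \<tau>: "\<tau> \<ge> 0"
  shows "(\<integral>x. \<rho> \<tau> x \<partial>LT) = (\<integral>x. \<rho> 0 x \<partial>LT)"
proof (cases "\<tau> = 0")
  case False
  then have \<tau>: "\<tau> > 0"
    using \<tau> by simp
  obtain \<zeta> where \<zeta>: "\<zeta> \<in> C1c" "\<And>t. t \<le> \<tau> \<Longrightarrow> \<zeta> t = 1" "\<And>t. 0 \<le> t \<Longrightarrow> t \<le> \<tau> \<Longrightarrow> dt \<zeta> t = 0"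
    using time_cutoff_exists[of \<tau>] by blast
  let ?\<phi> = "\<lambda>t (x :: real^'n). 0 + \<zeta> t"
  have \<phi>: "?\<phi> \<in> C1c_torus"
    by (rule C1c_torus_add_time(1)[OF C1c_torus_zero \<zeta>(1)])
  have "(\<integral>x. \<rho> \<tau> x * ?\<phi> \<tau> x \<partial>LT) - (\<integral>x. \<rho> 0 x * ?\<phi> 0 x \<partial>LT)
     = (LINT t:{0..\<tau>}|lebesgue. (\<integral>x. \<rho> t x * dt (\<lambda>s. ?\<phi> s x) t + m t x \<bullet> grad (?\<phi> t) x \<partial>LT))"
    by (rule continuity_eqD[OF eq \<phi> \<tau>])
  also have "\<dots> = (LINT t:{0..\<tau>}|lebesgue. 0)"
  proof (rule set_lebesgue_integral_cong)
    have "dt (\<lambda>s. 0 :: real) t = 0" if "t \<ge> 0" for t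
      by (rule dt_eqI[OF _ that]) simp
    moreover have "grad (\<lambda>x :: real^'n. 0) x = 0" for x
      by (simp add: grad_def frechet_derivative_const vec_eq_iff)
    ultimately have "(\<integral>x. \<rho> t x * dt (\<lambda>s. ?\<phi> s x) t + m t x \<bullet> grad (?\<phi> t) x \<partial>LT) = 0"
      if "t \<ge> 0" "t \<le> \<tau>" for t
      using that \<zeta>(3)[OF that]
      by (subst continuity_terms_add_time(2)[OF C1c_torus_zero \<zeta>(1) that(1) int(1)[OF that(1)] int(2)[OF that(1)]]) simp
    then show "\<forall>t. t \<in> {0..\<tau>} \<longrightarrow> (\<integral>x. \<rho> t x * dt (\<lambda>s. ?\<phi> s x) t + m t x \<bullet> grad (?\<phi> t) x \<partial>LT) = 0"
      by simp
  qed auto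
  finally show ?thesis
    using \<zeta>(2) \<tau> by simp
qed simp

text \<open>
  The integral of a function that is not integrable is zero by convention, which would make the
  weak equation say that \<open>\<integral>x. \<rho> t x * \<phi> t x \<partial>LT\<close> has equal values at \<open>0\<close>
  and \<open>T\<close>.  Adding a function \<open>\<eta>\<close> of time to \<open>\<phi>\<close> adds the integrable term \<open>M * dt \<eta>\<close>
  to the flux, so this equality would also hold for \<open>\<phi> + \<eta>\<close>.  Subtracting gives
  \<open>M * \<eta> T = M * \<eta> 0\<close>, which is false for the ramp.
\<close>

lemma continuity_flux_integrable:
  fixes \<rho> :: "real \<Rightarrow> real^'n \<Rightarrow> real"
  assumes eq: "continuity_eq \<rho> m" and int: "\<And>t. t \<ge> 0 \<Longrightarrow> integrable LT (\<rho> t)" "\<And>t. t \<ge> 0 \<Longrightarrow> integrable LT (m t)"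
    and T: "T > 0" and mass: "(\<integral>x. \<rho> 0 x \<partial>LT) \<noteq> 0" and \<phi>: "\<phi> \<in> C1c_torus"
  shows "set_integrable lebesgue {0..T} (\<lambda>t. \<integral>x. \<rho> t x * dt (\<lambda>s. \<phi> s x) t + m t x \<bullet> grad (\<phi> t) x \<partial>LT)"
proof (rule ccontr)
  define M where "M = (\<integral>x. \<rho> 0 x \<partial>LT)"
  have M: "(\<integral>x. \<rho> t x \<partial>LT) = M" if "t \<ge> 0" for t
    using mass_conservation[OF eq int that] by (simp add: M_def)
  define F where "F = (\<lambda>\<phi> t. \<integral>x. \<rho> t x * dt (\<lambda>s. \<phi> s x) t + m t x \<bullet> grad (\<phi> t) x \<partial>LT)"
  assume "\<not> ?thesis"
  then have nF: "\<not> set_integrable lebesgue {0..T} (F \<phi>)"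
    by (simp add: F_def)
  let ?\<eta> = "\<lambda>t. (max 0 (T - t))\<^sup>2"
  let ?\<phi> = "\<lambda>t x. \<phi> t x + ?\<eta> t"
  note \<eta> = ramp_C1c[of T]
  have \<phi>': "?\<phi> \<in> C1c_torus"
    by (rule C1c_torus_add_time(1)[OF \<phi> \<eta>])
  have F': "F ?\<phi> t = F \<phi> t + M * dt ?\<eta> t" if "t \<ge> 0" for t
    using continuity_terms_add_time(2)[OF \<phi> \<eta> that int(1)[OF that] int(2)[OF that]] M[OF that] by (simp add: F_def)
  have "\<not> set_integrable lebesgue {0..T} (F ?\<phi>)"
  proof
    assume "set_integrable lebesgue {0..T} (F ?\<phi>)"
    moreover have "set_integrable lebesgue {0..T} (\<lambda>t. M * dt ?\<eta> t)"
      using C1c_fundamental_theorem(1)[OF \<eta>, of 0 T] T by (intro set_integrable_mult_right) auto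
    ultimately have "set_integrable lebesgue {0..T} (\<lambda>t. F ?\<phi> t - M * dt ?\<eta> t)"
      by (rule set_integral_diff(1))
    also have "?this \<longleftrightarrow> set_integrable lebesgue {0..T} (F \<phi>)"
      by (rule set_integrable_cong) (auto simp: F')
    finally show False
      using nF by simp
  qed
  then have zero: "(LINT t:{0..T}|lebesgue. F ?\<phi> t) = 0" "(LINT t:{0..T}|lebesgue. F \<phi> t) = 0"
    using nF unfolding set_integrable_def set_lebesgue_integral_def by (simp_all add: not_integrable_integral_eq)
  note T' = less_imp_le[OF T]
  have "(\<integral>x. \<rho> T x * ?\<phi> T x \<partial>LT) - (\<integral>x. \<rho> 0 x * ?\<phi> 0 x \<partial>LT) = 0"
    using zero(1) unfolding continuity_eqD[OF eq \<phi>' T] F_def by assumption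
  moreover have "(\<integral>x. \<rho> T x * \<phi> T x \<partial>LT) - (\<integral>x. \<rho> 0 x * \<phi> 0 x \<partial>LT) = 0"
    using zero(2) unfolding continuity_eqD[OF eq \<phi> T] F_def by assumption
  ultimately have "M * ?\<eta> T = M * ?\<eta> 0"
    unfolding continuity_terms_add_time(1)[OF \<phi> \<eta> T' int(1)[OF T'] int(2)[OF T']]
      continuity_terms_add_time(1)[OF \<phi> \<eta> order.refl int(1)[OF order.refl] int(2)[OF order.refl]]
      M[OF T'] M[OF order.refl] by linarith
  then show False
    using T mass by (simp add: M_def)
qed

text \<open>
  After \<open>T\<close> the density is the constant \<open>q\<close> and the flux is \<open>q\<close> times the time derivative of the
  integral of \<open>\<phi>\<close>.  For \<open>q = 0\<close> nothing is added after \<open>T\<close>; otherwise the mass is nonzero and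
  \<open>continuity_flux_integrable\<close> permits splitting the time integral at \<open>T\<close>.
\<close>

lemma continuity_eq_stop:
  fixes \<rho> :: "real \<Rightarrow> real^'n \<Rightarrow> real" and m :: "real \<Rightarrow> real^'n \<Rightarrow> real^'n"
  assumes eq: "continuity_eq \<rho> m" and int: "\<And>t. t \<ge> 0 \<Longrightarrow> integrable LT (\<rho> t)" "\<And>t. t \<ge> 0 \<Longrightarrow> integrable LT (m t)"
    and T: "T \<ge> 0" and \<rho>T: "AE x in LT. \<rho> T x = q" and mT: "AE x in LT. m T x = 0"
  shows "continuity_eq (\<lambda>t. \<rho> (min t T)) (\<lambda>t. m (min t T))"
  unfolding continuity_eq_def
proof (intro allI impI ballI)
  fix \<tau> :: real and \<phi> :: "real \<Rightarrow> real^'n \<Rightarrow> real"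
  assume \<tau>: "\<tau> > 0" and \<phi>: "\<phi> \<in> C1c_torus"
  let ?F = "\<lambda>t. \<integral>x. \<rho> t x * dt (\<lambda>s. \<phi> s x) t + m t x \<bullet> grad (\<phi> t) x \<partial>LT"
  let ?G = "\<lambda>t. \<integral>x. \<rho> (min t T) x * dt (\<lambda>s. \<phi> s x) t + m (min t T) x \<bullet> grad (\<phi> t) x \<partial>LT"
  have eq0: "(\<integral>x. \<rho> t x * \<phi> t x \<partial>LT) - (\<integral>x. \<rho> 0 x * \<phi> 0 x \<partial>LT) = (LINT t:{0..t}|lebesgue. ?F t)" if "t \<ge> 0" for t
    using continuity_eqD[OF eq \<phi>] that set_integral_point[of 0] by (cases "t = 0") auto
  have late: "(\<integral>x. \<rho> T x * \<phi> t x \<partial>LT) = q * (\<integral>x. \<phi> t x \<partial>LT)" if "t \<ge> 0" for t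
  proof -
    have "(\<integral>x. \<rho> T x * \<phi> t x \<partial>LT) = (\<integral>x. q * \<phi> t x \<partial>LT)"
    proof (rule integral_cong_AE)
      show "(\<lambda>x. q * \<phi> t x) \<in> borel_measurable LT"
        using integral_LT_cbox(1)[OF C1c_torus_D(2)[OF \<phi> that]] by auto
      show "AE x in LT. \<rho> T x * \<phi> t x = q * \<phi> t x"
        using \<rho>T by eventually_elim simp
    qed (use integrable_continuity_terms(1)[OF \<phi> that int[OF T]] in auto)
    then show ?thesis
      by simp
  qed
  have lateG: "?G t = q * (\<integral>x. dt (\<lambda>s. \<phi> s x) t \<partial>LT)" if "t \<ge> T" for t
  proof -
    have t: "t \<ge> 0" "min t T = T"
      using that T by auto
    have "(\<integral>x. \<rho> T x * dt (\<lambda>s. \<phi> s x) t + m T x \<bullet> grad (\<phi> t) x \<partial>LT) = (\<integral>x. q * dt (\<lambda>s. \<phi> s x) t \<partial>LT)"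
    proof (rule integral_cong_AE)
      show "(\<lambda>x. q * dt (\<lambda>s. \<phi> s x) t) \<in> borel_measurable LT"
        using integral_LT_cbox(1)[OF C1c_torus_D(3)[OF \<phi> t(1)]] by auto
      show "AE x in LT. \<rho> T x * dt (\<lambda>s. \<phi> s x) t + m T x \<bullet> grad (\<phi> t) x = q * dt (\<lambda>s. \<phi> s x) t"
        using \<rho>T mT by eventually_elim simp
    qed (use integrable_continuity_terms(2)[OF \<phi> t(1) int[OF T]] in auto)
    then show ?thesis
      by (simp add: t)
  qed
  have early: "?G t = ?F t" if "t \<le> T" for t
    using that by (simp add: min_def)
  show "(\<integral>x. \<rho> (min \<tau> T) x * \<phi> \<tau> x \<partial>LT) - (\<integral>x. \<rho> (min 0 T) x * \<phi> 0 x \<partial>LT) = (LINT t:{0..\<tau>}|lebesgue. ?G t)"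
  proof (cases "q = 0 \<or> \<tau> \<le> T")
    case True
    have "(LINT t:{0..\<tau>}|lebesgue. ?G t) = (LINT t:{0..min \<tau> T}|lebesgue. ?F t)"
    proof (cases "q = 0")
      case True
      then show ?thesis
        using early lateG by (intro set_integral_stop) auto
    next
      case False
      then show ?thesis
        using True early by (auto intro!: set_lebesgue_integral_cong simp: min_def)
    qed
    also have "\<dots> = (\<integral>x. \<rho> (min \<tau> T) x * \<phi> (min \<tau> T) x \<partial>LT) - (\<integral>x. \<rho> 0 x * \<phi> 0 x \<partial>LT)"
      using \<tau> T by (intro eq0[symmetric]) auto
    also have "(\<integral>x. \<rho> (min \<tau> T) x * \<phi> (min \<tau> T) x \<partial>LT) = (\<integral>x. \<rho> (min \<tau> T) x * \<phi> \<tau> x \<partial>LT)"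
      using True late[OF T] late[of \<tau>] \<tau> by (cases "\<tau> \<le> T") (auto simp: min_def)
    finally show ?thesis
      using T by (simp add: min_def)
  next
    case False
    then have q: "q \<noteq> 0" and \<tau>T: "T < \<tau>"
      by auto
    have iF: "set_integrable lebesgue {0..T} ?F"
    proof (cases "T = 0")
      case True
      have "AE t in lebesgue. indicator {0..T} t *\<^sub>R ?F t = 0"
        by (rule AE_I'[of "{0}"]) (auto simp: indicator_def True)
      moreover have "(\<lambda>t. indicator {0..T} t *\<^sub>R ?F t) = (\<lambda>t. indicator {0} t *\<^sub>R ?F 0)"
        using True by (auto simp: fun_eq_iff indicator_def)
      ultimately show ?thesis
        unfolding set_integrable_def by (auto intro: integrable_cong_AE_imp[of lebesgue "\<lambda>_. 0"])
    next
      case False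
      have "(\<integral>x. \<rho> 0 x \<partial>LT) = (\<integral>x. \<rho> T x \<partial>LT)"
        using mass_conservation[OF eq int T] by simp
      also have "\<dots> = (\<integral>x. q \<partial>(LT :: (real^'n) measure))"
        using int(1)[OF T] \<rho>T by (intro integral_cong_AE) auto
      also have "\<dots> \<noteq> 0"
        using q torus_measure_pos[where 'n = 'n] unfolding integral_LT_const by simp
      finally show ?thesis
        using False T by (intro continuity_flux_integrable[OF eq int _ _ \<phi>]) auto
    qed
    then have iG: "set_integrable lebesgue {0..T} ?G"
      by (subst set_integrable_cong[OF refl refl early]) auto
    note td = integral_time_derivative[OF \<phi> T less_imp_le[OF \<tau>T]]
    have iG2: "set_integrable lebesgue {T..\<tau>} ?G"
      using set_integrable_mult_right[OF td(1), of q] by (subst set_integrable_cong[OF refl refl lateG]) auto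
    have "(LINT t:{0..\<tau>}|lebesgue. ?G t) = (LINT t:{0..T}|lebesgue. ?G t) + (LINT t:{T..\<tau>}|lebesgue. ?G t)"
      using iG iG2 T \<tau>T by (intro set_integral_split) auto
    also have "(LINT t:{0..T}|lebesgue. ?G t) = (LINT t:{0..T}|lebesgue. ?F t)"
      using early by (intro set_lebesgue_integral_cong) auto
    also have "\<dots> = (\<integral>x. \<rho> T x * \<phi> T x \<partial>LT) - (\<integral>x. \<rho> 0 x * \<phi> 0 x \<partial>LT)"
      by (rule eq0[OF T, symmetric])
    also have "(LINT t:{T..\<tau>}|lebesgue. ?G t) = (LINT t:{T..\<tau>}|lebesgue. q * (\<integral>x. dt (\<lambda>s. \<phi> s x) t \<partial>LT))"
      using lateG by (intro set_lebesgue_integral_cong) auto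
    also have "\<dots> = q * ((\<integral>x. \<phi> \<tau> x \<partial>LT) - (\<integral>x. \<phi> T x \<partial>LT))"
      using td(2) by simp
    finally show ?thesis
      using late[OF T] late[of \<tau>] \<tau> \<tau>T T by (simp add: algebra_simps)
  qed
qed

section \<open>Momentum equation of the stopped solution\<close>

definition momentum_eq ::
    "real \<Rightarrow> real \<Rightarrow> (real \<Rightarrow> real^'n \<Rightarrow> real^'n) \<Rightarrow> (real \<Rightarrow> real^'n \<Rightarrow> (real \<times> (real^'n)) measure) \<Rightarrow>
     (real \<Rightarrow> real^'n \<Rightarrow> (real^'n) measure) \<Rightarrow> (real \<Rightarrow> (real^'n) measure) \<Rightarrow> (real \<Rightarrow> (real^'n) measure) \<Rightarrow> bool" where
  "momentum_eq a \<gamma> m \<nu> r Ckin Cint \<longleftrightarrow> (\<forall>\<tau>>0. \<forall>\<phi>\<in>C1c_torus.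
     (\<integral>x. m \<tau> x \<bullet> \<phi> \<tau> x \<partial>LT) - (\<integral>x. m 0 x \<bullet> \<phi> 0 x \<partial>LT)
     - (LINT t:{0..\<tau>}|lebesgue. (\<integral>x. m t x \<bullet> dt (\<lambda>s. \<phi> s x) t \<partial>LT))
     = (LINT t:{0..\<tau>}|lebesgue.
          (\<integral>x. (\<integral>s. convective (fst s) (snd s) \<partial>\<nu> t x) \<bullet> Grad (\<phi> t) x
              + (\<integral>s. a * fst s powr \<gamma> \<partial>\<nu> t x) * divergence (\<phi> t) x \<partial>LT))
     + 2 * (LINT t:{0..\<tau>}|lebesgue.
          (\<integral>x. (\<integral>\<xi>. tensor \<xi> \<xi> \<partial>r t x) \<bullet> Grad (\<phi> t) x \<partial>Ckin t))
     + (\<gamma> - 1) * (LINT t:{0..\<tau>}|lebesgue. (\<integral>x. divergence (\<phi> t) x \<partial>Cint t)))"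

abbreviation phase_algebra :: "(real \<times> (real^'n)) measure" where
  "phase_algebra \<equiv> restrict_space borel phase_space"

text \<open>
  The old measure is kept at \<open>T\<close> itself, so that integrands in time agree with the old ones on the
  whole closed interval \<open>{0..T}\<close>.
\<close>

abbreviation stopped_young ::
    "real \<Rightarrow> real \<Rightarrow> (real \<Rightarrow> real^'n \<Rightarrow> (real \<times> (real^'n)) measure) \<Rightarrow> real \<Rightarrow> real^'n \<Rightarrow> (real \<times> (real^'n)) measure" where
  "stopped_young T q \<nu> \<equiv> \<lambda>t x. if t \<le> T then \<nu> t x else return phase_algebra (q, 0)"

abbreviation stopped_measure ::
    "real \<Rightarrow> 'x::topological_space set \<Rightarrow> (real \<Rightarrow> 'x measure) \<Rightarrow> real \<Rightarrow> 'x measure" where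
  "stopped_measure T X \<mu> \<equiv> \<lambda>t. if t \<le> T then \<mu> t else null_measure (restrict_space borel X)"

lemma integral_null_measure: "(\<integral>x. f x \<partial>null_measure N) = 0"
proof (rule integral_eq_zero_AE)
  show "AE x in null_measure N. f x = 0"
    by (rule AE_I[of _ _ "space N"]) auto
qed

lemma phase_point: "q \<ge> 0 \<Longrightarrow> (q, 0) \<in> space (phase_algebra :: (real \<times> (real^'n)) measure)"
  by (simp add: space_restrict_space phase_space_def)

lemma tensor_measurable: "(\<lambda>v :: real^'n. tensor v v) \<in> borel_measurable borel"
  unfolding tensor_def
  by (intro borel_measurable_continuous_onI continuous_on_vec_lambda continuous_intros)

lemma convective_measurable:
  "(\<lambda>s. convective (fst s) (snd s :: real^'n)) \<in> borel_measurable borel"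
proof -
  have [measurable]: "(\<lambda>s. tensor (snd s) (snd s :: real^'n)) \<in> borel_measurable (borel \<Otimes>\<^sub>M borel)"
    by (rule measurable_compose[OF measurable_snd tensor_measurable])
  show ?thesis
    unfolding convective_def borel_prod[symmetric] by measurable
qed

lemma integral_phase_return:
  assumes "q \<ge> 0" "f \<in> borel_measurable borel"
  shows "(\<integral>s. f s \<partial>return phase_algebra (q, 0 :: real^'n)) = (f (q, 0) :: 'b::{banach,second_countable_topology})"
  using phase_point[OF assms(1)] measurable_restrict_space1[OF assms(2)] by (rule integral_return)

text \<open>At rest with density \<open>q\<close> the stress is the constant pressure.\<close>

lemma stopped_young_stress:
  assumes "q \<ge> 0"
  shows "(\<integral>s. convective (fst s) (snd s) \<partial>return phase_algebra (q, 0 :: real^'n)) = 0"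
    "(\<integral>s. a * fst s powr \<gamma> \<partial>return phase_algebra (q, 0 :: real^'n)) = a * q powr \<gamma>"
proof -
  have "convective q (0 :: real^'n) = 0"
    by (simp add: convective_def tensor_def vec_eq_iff)
  then show "(\<integral>s. convective (fst s) (snd s) \<partial>return phase_algebra (q, 0 :: real^'n)) = 0"
    by (simp add: integral_phase_return[OF assms convective_measurable])
  have meas: "(\<lambda>s :: real \<times> (real^'n). a * fst s powr \<gamma>) \<in> borel_measurable borel"
    unfolding borel_prod[symmetric] by measurable
  show "(\<integral>s. a * fst s powr \<gamma> \<partial>return phase_algebra (q, 0 :: real^'n)) = a * q powr \<gamma>"
    by (subst integral_phase_return[OF assms meas]) simp
qed

text \<open>
  After \<open>T\<close> every integrand in time vanishes: the momentum is zero, the pressure is constant in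
  space and the concentration measures are null.  Thus each time integral up to \<open>\<tau>\<close> equals the
  old one up to \<open>min \<tau> T\<close>.
\<close>

lemma momentum_eq_stop:
  fixes m :: "real \<Rightarrow> real^'n \<Rightarrow> real^'n"
  assumes eq: "momentum_eq a \<gamma> m \<nu> r Ckin Cint" and T: "T \<ge> 0" and q: "q \<ge> 0" and mT: "AE x in LT. m T x = 0"
  shows "momentum_eq a \<gamma> (\<lambda>t. m (min t T)) (stopped_young T q \<nu>) r
    (stopped_measure T torus Ckin) (stopped_measure T torus Cint)"
  unfolding momentum_eq_def
proof (intro allI impI ballI)
  fix \<tau> :: real and \<phi> :: "real \<Rightarrow> real^'n \<Rightarrow> real^'n"
  assume \<tau>: "\<tau> > 0" and \<phi>: "\<phi> \<in> C1c_torus"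
  have m0: "(\<integral>x. m T x \<bullet> g x \<partial>LT) = 0" for g
    by (rule integral_eq_zero_AE) (use mT in \<open>eventually_elim, simp\<close>)
  have div0: "(\<integral>x. divergence (\<phi> t) x \<partial>LT) = 0" if "t \<ge> 0" for t
    by (rule integral_divergence[OF C1c_torus_D(1,4,5)[OF \<phi> that]])
  have 1: "(LINT t:{0..\<tau>}|lebesgue. (\<integral>x. m (min t T) x \<bullet> dt (\<lambda>s. \<phi> s x) t \<partial>LT))
      = (LINT t:{0..min \<tau> T}|lebesgue. (\<integral>x. m t x \<bullet> dt (\<lambda>s. \<phi> s x) t \<partial>LT))"
    by (rule set_integral_stop) (simp_all add: min_def m0)
  have 2: "(LINT t:{0..\<tau>}|lebesgue.
          (\<integral>x. (\<integral>s. convective (fst s) (snd s) \<partial>stopped_young T q \<nu> t x) \<bullet> Grad (\<phi> t) x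
              + (\<integral>s. a * fst s powr \<gamma> \<partial>stopped_young T q \<nu> t x) * divergence (\<phi> t) x \<partial>LT))
      = (LINT t:{0..min \<tau> T}|lebesgue.
          (\<integral>x. (\<integral>s. convective (fst s) (snd s) \<partial>\<nu> t x) \<bullet> Grad (\<phi> t) x
              + (\<integral>s. a * fst s powr \<gamma> \<partial>\<nu> t x) * divergence (\<phi> t) x \<partial>LT))"
    by (rule set_integral_stop) (simp_all add: stopped_young_stress[OF q] div0)
  have 3: "(LINT t:{0..\<tau>}|lebesgue. (\<integral>x. (\<integral>\<xi>. tensor \<xi> \<xi> \<partial>r t x) \<bullet> Grad (\<phi> t) x \<partial>stopped_measure T torus Ckin t))
      = (LINT t:{0..min \<tau> T}|lebesgue. (\<integral>x. (\<integral>\<xi>. tensor \<xi> \<xi> \<partial>r t x) \<bullet> Grad (\<phi> t) x \<partial>Ckin t))"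
    by (rule set_integral_stop) (simp_all add: integral_null_measure)
  have 4: "(LINT t:{0..\<tau>}|lebesgue. (\<integral>x. divergence (\<phi> t) x \<partial>stopped_measure T torus Cint t))
      = (LINT t:{0..min \<tau> T}|lebesgue. (\<integral>x. divergence (\<phi> t) x \<partial>Cint t))"
    by (rule set_integral_stop) (simp_all add: integral_null_measure)
  have 5: "(\<integral>x. m (min \<tau> T) x \<bullet> \<phi> \<tau> x \<partial>LT) = (\<integral>x. m (min \<tau> T) x \<bullet> \<phi> (min \<tau> T) x \<partial>LT)"
    by (cases "\<tau> \<le> T") (simp_all add: min_def m0)
  have 6: "m (min 0 T) = m 0"
    using T by (simp add: min_def)
  show "(\<integral>x. m (min \<tau> T) x \<bullet> \<phi> \<tau> x \<partial>LT) - (\<integral>x. m (min 0 T) x \<bullet> \<phi> 0 x \<partial>LT)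
     - (LINT t:{0..\<tau>}|lebesgue. (\<integral>x. m (min t T) x \<bullet> dt (\<lambda>s. \<phi> s x) t \<partial>LT))
     = (LINT t:{0..\<tau>}|lebesgue.
          (\<integral>x. (\<integral>s. convective (fst s) (snd s) \<partial>stopped_young T q \<nu> t x) \<bullet> Grad (\<phi> t) x
              + (\<integral>s. a * fst s powr \<gamma> \<partial>stopped_young T q \<nu> t x) * divergence (\<phi> t) x \<partial>LT))
     + 2 * (LINT t:{0..\<tau>}|lebesgue.
          (\<integral>x. (\<integral>\<xi>. tensor \<xi> \<xi> \<partial>r t x) \<bullet> Grad (\<phi> t) x \<partial>stopped_measure T torus Ckin t))
     + (\<gamma> - 1) * (LINT t:{0..\<tau>}|lebesgue. (\<integral>x. divergence (\<phi> t) x \<partial>stopped_measure T torus Cint t))"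
    unfolding 1 2 3 4 5 6
  proof (cases "T = 0")
    case True
    then have "min \<tau> T = 0"
      using \<tau> by simp
    then show "(\<integral>x. m (min \<tau> T) x \<bullet> \<phi> (min \<tau> T) x \<partial>LT) - (\<integral>x. m 0 x \<bullet> \<phi> 0 x \<partial>LT)
     - (LINT t:{0..min \<tau> T}|lebesgue. (\<integral>x. m t x \<bullet> dt (\<lambda>s. \<phi> s x) t \<partial>LT))
     = (LINT t:{0..min \<tau> T}|lebesgue.
          (\<integral>x. (\<integral>s. convective (fst s) (snd s) \<partial>\<nu> t x) \<bullet> Grad (\<phi> t) x
              + (\<integral>s. a * fst s powr \<gamma> \<partial>\<nu> t x) * divergence (\<phi> t) x \<partial>LT))
     + 2 * (LINT t:{0..min \<tau> T}|lebesgue.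
          (\<integral>x. (\<integral>\<xi>. tensor \<xi> \<xi> \<partial>r t x) \<bullet> Grad (\<phi> t) x \<partial>Ckin t))
     + (\<gamma> - 1) * (LINT t:{0..min \<tau> T}|lebesgue. (\<integral>x. divergence (\<phi> t) x \<partial>Cint t))"
      by (simp only: set_integral_point)
  next
    case False
    then have "min \<tau> T > 0"
      using \<tau> T by simp
    with eq \<phi> show "(\<integral>x. m (min \<tau> T) x \<bullet> \<phi> (min \<tau> T) x \<partial>LT) - (\<integral>x. m 0 x \<bullet> \<phi> 0 x \<partial>LT)
     - (LINT t:{0..min \<tau> T}|lebesgue. (\<integral>x. m t x \<bullet> dt (\<lambda>s. \<phi> s x) t \<partial>LT))
     = (LINT t:{0..min \<tau> T}|lebesgue.
          (\<integral>x. (\<integral>s. convective (fst s) (snd s) \<partial>\<nu> t x) \<bullet> Grad (\<phi> t) x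
              + (\<integral>s. a * fst s powr \<gamma> \<partial>\<nu> t x) * divergence (\<phi> t) x \<partial>LT))
     + 2 * (LINT t:{0..min \<tau> T}|lebesgue.
          (\<integral>x. (\<integral>\<xi>. tensor \<xi> \<xi> \<partial>r t x) \<bullet> Grad (\<phi> t) x \<partial>Ckin t))
     + (\<gamma> - 1) * (LINT t:{0..min \<tau> T}|lebesgue. (\<integral>x. divergence (\<phi> t) x \<partial>Cint t))"
      unfolding momentum_eq_def by blast
  qed
qed

section \<open>Energy inequality of the stopped solution\<close>

definition energy_ineq :: "real \<Rightarrow> (real \<Rightarrow> real) \<Rightarrow> bool" where
  "energy_ineq E0 E \<longleftrightarrow> (\<forall>\<tau>1 \<tau>2. \<forall>\<psi>\<in>C1c. 0 \<le> \<tau>1 \<and> \<tau>1 \<le> \<tau>2 \<and> (\<forall>t\<ge>0. \<psi> t \<ge> 0) \<longrightarrow>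
     right_limit E \<tau>2 * \<psi> \<tau>2 - left_limit E E0 \<tau>1 * \<psi> \<tau>1
     - (LINT t:{\<tau>1..\<tau>2}|lebesgue. E t * dt \<psi> t) \<le> 0)"

lemma Lim_cong_eventually:
  assumes "\<forall>\<^sub>F t in F. f t = g t"
  shows "Lim F f = Lim F g"
  unfolding Topological_Spaces.Lim_def using tendsto_cong[OF assms] by simp

text \<open>
  A bound almost everywhere passes to the right limit because sets of full measure meet every
  interval.
\<close>

lemma right_limit_ge:
  assumes E: "E \<in> BV_loc" and t: "t \<ge> 0" and ge: "AE t in lebesgue_on {0<..}. c \<le> E t"
  shows "c \<le> right_limit E t"
proof -
  obtain L where L: "(E \<longlongrightarrow> L) (at_right t)"
    using BV_loc_right_limit_exists[OF E t] by blast
  have "c \<le> L"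
  proof (rule ccontr)
    assume "\<not> c \<le> L"
    then have "\<forall>\<^sub>F s in at_right t. E s < c"
      using order_tendstoD(2)[OF L] by simp
    then obtain b where b: "b > t" "\<And>s. t < s \<Longrightarrow> s < b \<Longrightarrow> E s < c"
      by (auto simp: eventually_at_right_field)
    then show False
      using AE_lebesgue_on_imp_ex_between[OF ge t b(1)] by fastforce
  qed
  then show ?thesis
    using tendsto_Lim[OF _ L] by (simp add: right_limit_def)
qed

text \<open>
  On an interval that contains \<open>T\<close>, add the old inequality up to \<open>T\<close> and the identity for the
  constant \<open>c\<close> after \<open>T\<close>; the jump from \<open>right_limit E T\<close> down to \<open>c\<close> has the right sign.
\<close>

lemma energy_ineq_stop:
  assumes ineq: "energy_ineq E0 E" and BV: "E \<in> BV_loc" and L1: "E \<in> L1_loc" and T: "T \<ge> 0"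
    and ge: "AE t in lebesgue_on {0<..}. c \<le> E t"
  shows "energy_ineq E0 (\<lambda>t. if t < T then E t else c)"
  unfolding energy_ineq_def
proof (intro allI ballI impI)
  fix \<tau>1 \<tau>2 :: real and \<psi> :: "real \<Rightarrow> real"
  assume \<psi>: "\<psi> \<in> C1c" and \<tau>: "0 \<le> \<tau>1 \<and> \<tau>1 \<le> \<tau>2 \<and> (\<forall>t\<ge>0. \<psi> t \<ge> 0)"
  let ?E = "\<lambda>t. if t < T then E t else c"
  have cont: "continuous_on {0..} (dt \<psi>)"
    using \<psi> by (simp add: C1c_def)
  have old: "right_limit E s * \<psi> s - left_limit E E0 \<tau>1 * \<psi> \<tau>1 - (LINT t:{\<tau>1..s}|lebesgue. E t * dt \<psi> t) \<le> 0"
    if "\<tau>1 \<le> s" for s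
    using ineq \<psi> \<tau> that unfolding energy_ineq_def by blast
  have left: "left_limit ?E E0 \<tau>1 = left_limit E E0 \<tau>1" if "\<tau>1 \<le> T"
  proof -
    have "\<forall>\<^sub>F t in at_left \<tau>1. ?E t = E t"
      using that by (auto simp: eventually_at_left_field intro!: exI[of _ "\<tau>1 - 1"])
    then show ?thesis
      by (simp add: left_limit_def Lim_cong_eventually)
  qed
  have right: "right_limit ?E \<tau>2 = c" if "T \<le> \<tau>2"
  proof -
    have "\<forall>\<^sub>F t in at_right \<tau>2. ?E t = c"
      using that by (auto simp: eventually_at_right_field intro!: exI[of _ "\<tau>2 + 1"])
    then have "(?E \<longlongrightarrow> c) (at_right \<tau>2)"
      by (rule tendsto_eventually)
    then show ?thesis
      by (simp add: right_limit_def tendsto_Lim)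
  qed
  have late: "(LINT t:{b..\<tau>2}|lebesgue. ?E t * dt \<psi> t) = c * (\<psi> \<tau>2 - \<psi> b)"
    "set_integrable lebesgue {b..\<tau>2} (\<lambda>t. ?E t * dt \<psi> t)"
    if "T \<le> b" "b \<le> \<tau>2" for b
  proof -
    have b: "0 \<le> b"
      using that T by simp
    have e: "?E t * dt \<psi> t = c * dt \<psi> t" if "t \<in> {b..\<tau>2}" for t
      using that \<open>T \<le> b\<close> by auto
    show "(LINT t:{b..\<tau>2}|lebesgue. ?E t * dt \<psi> t) = c * (\<psi> \<tau>2 - \<psi> b)"
      using C1c_fundamental_theorem(2)[OF \<psi> b that(2)]
      by (subst set_lebesgue_integral_cong[where g = "\<lambda>t. c * dt \<psi> t"]) (use e in auto)
    show "set_integrable lebesgue {b..\<tau>2} (\<lambda>t. ?E t * dt \<psi> t)"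
      using set_integrable_mult_right[OF C1c_fundamental_theorem(1)[OF \<psi> b that(2)], of c]
      by (subst set_integrable_cong[OF refl refl e]) auto
  qed
  have weq: "E t * dt \<psi> t = ?E t * dt \<psi> t" if "t < T" for t
    using that by simp
  consider "\<tau>2 < T" | "\<tau>1 \<le> T" "T \<le> \<tau>2" | "T < \<tau>1"
    using \<tau> by linarith
  then show "right_limit ?E \<tau>2 * \<psi> \<tau>2 - left_limit ?E E0 \<tau>1 * \<psi> \<tau>1
     - (LINT t:{\<tau>1..\<tau>2}|lebesgue. ?E t * dt \<psi> t) \<le> 0"
  proof cases
    case 1
    have "\<forall>\<^sub>F t in at_right \<tau>2. ?E t = E t"
      using 1 by (auto simp: eventually_at_right_field intro!: exI[of _ T])
    then have "right_limit ?E \<tau>2 = right_limit E \<tau>2"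
      by (simp add: right_limit_def Lim_cong_eventually)
    moreover have "(LINT t:{\<tau>1..\<tau>2}|lebesgue. ?E t * dt \<psi> t) = (LINT t:{\<tau>1..\<tau>2}|lebesgue. E t * dt \<psi> t)"
      using 1 by (intro set_lebesgue_integral_cong) auto
    ultimately show ?thesis
      using old[of \<tau>2] left \<tau> 1 by simp
  next
    case 2
    have AE_eq: "AE t in lebesgue. indicator {\<tau>1..T} t *\<^sub>R (?E t * dt \<psi> t) = indicator {\<tau>1..T} t *\<^sub>R (E t * dt \<psi> t)"
      by (rule AE_I'[of "{T}"]) (auto simp: indicator_def)
    have i: "set_integrable lebesgue {\<tau>1..T} (\<lambda>t. E t * dt \<psi> t)"
      using \<tau> by (intro BV_loc_times_continuous_integrable[OF BV L1 cont]) auto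
    have "(\<lambda>t. indicator {\<tau>1..T} t *\<^sub>R (?E t * dt \<psi> t))
        = (\<lambda>t. indicator {\<tau>1..T} t *\<^sub>R (E t * dt \<psi> t) + indicator {T} t *\<^sub>R ((c - E T) * dt \<psi> T))"
      using 2 by (auto simp: fun_eq_iff indicator_def algebra_simps)
    moreover have "(\<lambda>t. indicator {\<tau>1..T} t *\<^sub>R (E t * dt \<psi> t) + indicator {T} t *\<^sub>R ((c - E T) * dt \<psi> T))
        \<in> borel_measurable lebesgue"
      using i unfolding set_integrable_def
      by (intro borel_measurable_add borel_measurable_scaleR borel_measurable_indicator borel_measurable_const borel_measurable_integrable) auto
    ultimately have meas: "(\<lambda>t. indicator {\<tau>1..T} t *\<^sub>R (?E t * dt \<psi> t)) \<in> borel_measurable lebesgue"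
      by simp
    have i': "set_integrable lebesgue {\<tau>1..T} (\<lambda>t. ?E t * dt \<psi> t)"
      using i meas AE_eq unfolding set_integrable_def by (subst integrable_cong_AE[OF _ _ AE_eq]) auto
    have "(LINT t:{\<tau>1..T}|lebesgue. ?E t * dt \<psi> t) = (LINT t:{\<tau>1..T}|lebesgue. E t * dt \<psi> t)"
      using i meas unfolding set_integrable_def set_lebesgue_integral_def by (intro integral_cong_AE[OF _ _ AE_eq]) auto
    then have "(LINT t:{\<tau>1..\<tau>2}|lebesgue. ?E t * dt \<psi> t)
        = (LINT t:{\<tau>1..T}|lebesgue. E t * dt \<psi> t) + c * (\<psi> \<tau>2 - \<psi> T)"
      using set_integral_split[OF i' late(2)] late(1) 2 by auto
    moreover have "c * \<psi> T \<le> right_limit E T * \<psi> T"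
      using right_limit_ge[OF BV T ge] \<tau> T by (intro mult_right_mono) auto
    ultimately show ?thesis
      using old[of T] left right 2 by (simp add: algebra_simps)
  next
    case 3
    have "\<forall>\<^sub>F t in at_left \<tau>1. ?E t = c"
      using 3 by (auto simp: eventually_at_left_field intro!: exI[of _ T])
    then have "(?E \<longlongrightarrow> c) (at_left \<tau>1)"
      by (rule tendsto_eventually)
    then have "left_limit ?E E0 \<tau>1 = c"
      using 3 T by (simp add: left_limit_def tendsto_Lim)
    then show ?thesis
      using late(1)[of \<tau>1] right 3 \<tau> by (simp add: algebra_simps)
  qed
qed

section \<open>Function spaces and measures of the stopped solution\<close>

lemma Linf_weakstar_stop:
  assumes "\<mu> \<in> Linf_weakstar X C"
  shows "stopped_measure T X \<mu> \<in> Linf_weakstar X C"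
  unfolding Linf_weakstar_def mem_Collect_eq
proof (intro conjI allI impI ballI)
  fix t :: real assume "t > 0"
  then show "stopped_measure T X \<mu> t \<in> bounded_measures X"
    using assms by (auto simp: Linf_weakstar_def bounded_measures_def intro!: finite_measureI)
next
  fix f assume f: "f \<in> C"
  have "(\<lambda>t. if t \<le> T then (\<integral>x. f x \<partial>\<mu> t) else 0) \<in> borel_measurable (lebesgue_on {0<..})"
    using assms f by (intro measurable_If) (auto simp: Linf_weakstar_def sets_restrict_space)
  also have "(\<lambda>t. if t \<le> T then (\<integral>x. f x \<partial>\<mu> t) else 0) = (\<lambda>t. \<integral>x. f x \<partial>stopped_measure T X \<mu> t)"
    by (auto simp: fun_eq_iff integral_null_measure)
  finally show "(\<lambda>t. \<integral>x. f x \<partial>stopped_measure T X \<mu> t) \<in> borel_measurable (lebesgue_on {0<..})" .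
next
  obtain K where K: "AE t in lebesgue_on {0<..}. measure (\<mu> t) X \<le> K"
    using assms by (auto simp: Linf_weakstar_def)
  have "AE t in lebesgue_on {0<..}. measure (stopped_measure T X \<mu> t) X \<le> max K 0"
    using K by eventually_elim (auto simp: measure_def)
  then show "\<exists>K. AE t in lebesgue_on {0<..}. measure (stopped_measure T X \<mu> t) X \<le> K"
    by blast
qed

lemma young_measures_stop:
  assumes \<nu>: "\<nu> \<in> young_measures" and q: "q \<ge> 0"
  shows "stopped_young T q \<nu> \<in> (young_measures :: (real \<Rightarrow> real^'n \<Rightarrow> (real \<times> (real^'n)) measure) set)"
  unfolding young_measures_def mem_Collect_eq
proof (intro conjI allI impI ballI)
  fix t :: real and x :: "real^'n" assume "t > 0" "x \<in> torus"
  then show "stopped_young T q \<nu> t x \<in> space (prob_algebra phase_algebra)"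
    using \<nu> prob_space_return[OF phase_point[OF q]] by (auto simp: young_measures_def space_prob_algebra)
next
  fix b assume b: "b \<in> (C0_phase :: (real \<times> (real^'n) \<Rightarrow> real) set)"
  let ?c = "\<integral>s. b s \<partial>return phase_algebra (q, 0)"
  have "(\<lambda>z. if fst z \<le> T then (case z of (t, x) \<Rightarrow> \<integral>s. b s \<partial>\<nu> t x) else ?c)
      \<in> borel_measurable (lebesgue_on ({0<..} \<times> (torus :: (real^'n) set)))"
  proof (rule measurable_If)
    show "(\<lambda>(t, x). \<integral>s. b s \<partial>\<nu> t x) \<in> borel_measurable (lebesgue_on ({0<..} \<times> torus))"
      using \<nu> b by (simp add: young_measures_def)
    have "closed {z :: real \<times> (real^'n). fst z \<le> T}"
      by (intro closed_Collect_le continuous_intros)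
    then have "{z :: real \<times> (real^'n). fst z \<le> T} \<in> sets lebesgue"
      by (simp add: borel_closed)
    then show "{z \<in> space (lebesgue_on ({0<..} \<times> (torus :: (real^'n) set))). fst z \<le> T}
        \<in> sets (lebesgue_on ({0<..} \<times> torus))"
      by (auto simp: sets_restrict_space intro!: image_eqI[of _ _ "{z. fst z \<le> T}"])
  qed simp
  also have "(\<lambda>z. if fst z \<le> T then (case z of (t, x) \<Rightarrow> \<integral>s. b s \<partial>\<nu> t x) else ?c)
      = (\<lambda>(t, x). \<integral>s. b s \<partial>stopped_young T q \<nu> t x)"
    by (auto simp: fun_eq_iff)
  finally show "(\<lambda>(t, x). \<integral>s. b s \<partial>stopped_young T q \<nu> t x) \<in> borel_measurable (lebesgue_on ({0<..} \<times> torus))" .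
qed

lemma C_weak_Lp_stop:
  fixes u :: "real \<Rightarrow> real^'n \<Rightarrow> 'b::euclidean_space"
  assumes "u \<in> C_weak_Lp p" "T \<ge> 0"
  shows "(\<lambda>t. u (min t T)) \<in> C_weak_Lp p"
  unfolding C_weak_Lp_def mem_Collect_eq
proof (intro conjI allI impI ballI)
  show "u (min t T) \<in> Lp_torus p" if "t \<ge> 0" for t
    using assms that by (auto simp: C_weak_Lp_def)
  fix g :: "real^'n \<Rightarrow> 'b" assume "g \<in> Lp_torus (p / (p - 1))"
  then have "continuous_on {0..} (\<lambda>t. \<integral>x. u t x \<bullet> g x \<partial>LT)"
    using assms by (simp add: C_weak_Lp_def)
  then show "continuous_on {0..} (\<lambda>t. \<integral>x. u (min t T) x \<bullet> g x \<partial>LT)"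
    by (rule continuous_on_compose2) (use assms in \<open>auto intro!: continuous_intros\<close>)
qed

text \<open>
  The stopped path is the composition with the continuous time change \<open>min t T\<close>; stating the
  stopped density and momentum in this form makes their continuity immediate.
\<close>

lemma C_Wneg_stop:
  assumes u: "u \<in> C_Wneg l" and T: "T \<ge> 0"
  shows "(\<lambda>t. u (min t T)) \<in> C_Wneg l"
  unfolding C_Wneg_def mem_Collect_eq
proof (intro conjI allI impI)
  show "u (min t T) \<in> Wneg l" if "t \<ge> 0" for t
    using assms that by (auto simp: C_Wneg_def)
  fix t :: real assume t: "t \<ge> 0"
  have lim: "((\<lambda>s. Wneg_norm l (\<lambda>x. u s x - u (min t T) x)) \<longlongrightarrow> 0) (at (min t T) within {0..})"
    using u t T by (auto simp: C_Wneg_def)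
  have "Wneg_term l (\<lambda>x. u (min t T) x - u (min t T) x) k = 0" for k
    by (simp add: Wneg_term_def)
  then have zero: "Wneg_norm l (\<lambda>x. u (min t T) x - u (min t T) x) = 0"
    unfolding Wneg_norm_def by (simp add: infsum_0)
  have "continuous_on {0..} (\<lambda>s. min s T)"
    by (intro continuous_intros)
  then have "((\<lambda>s. min s T) \<longlongrightarrow> min t T) (at t within {0..})"
    using t by (auto simp: continuous_on_def)
  moreover have "\<forall>\<^sub>F s in at t within {0..}. min s T \<in> {0..}"
    using T by (auto simp: eventually_at_filter)
  moreover have "continuous (at (min t T) within {0..}) (\<lambda>s. Wneg_norm l (\<lambda>x. u s x - u (min t T) x))"
    using lim zero by (simp add: continuous_within)
  ultimately have "((\<lambda>s. Wneg_norm l (\<lambda>x. u (min s T) x - u (min t T) x))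
      \<longlongrightarrow> Wneg_norm l (\<lambda>x. u (min t T) x - u (min t T) x)) (at t within {0..})"
    by - (rule continuous_within_tendsto_compose)
  then show "((\<lambda>s. Wneg_norm l (\<lambda>x. u (min s T) x - u (min t T) x)) \<longlongrightarrow> 0) (at t within {0..})"
    by (simp only: zero)
qed

section \<open>Stopping a dissipative solution\<close>

definition barycentre_energy ::
    "real \<Rightarrow> real \<Rightarrow> (real \<Rightarrow> real^'n \<Rightarrow> real) \<Rightarrow> (real \<Rightarrow> real^'n \<Rightarrow> real^'n) \<Rightarrow> (real \<Rightarrow> real) \<Rightarrow>
     (real \<Rightarrow> real^'n \<Rightarrow> (real \<times> (real^'n)) measure) \<Rightarrow> (real \<Rightarrow> (real^'n) measure) \<Rightarrow> (real \<Rightarrow> (real^'n) measure) \<Rightarrow> bool" where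
  "barycentre_energy a \<gamma> \<rho> m E \<nu> Ckin Cint \<longleftrightarrow> (AE \<tau> in lebesgue_on {0<..}.
     (AE x in LT. \<rho> \<tau> x = (\<integral>s. fst s \<partial>\<nu> \<tau> x) \<and> \<rho> \<tau> x \<ge> 0 \<and> m \<tau> x = (\<integral>s. snd s \<partial>\<nu> \<tau> x)) \<and>
     E \<tau> \<ge> 0 \<and>
     ennreal (E \<tau>) =
       (\<integral>\<^sup>+x. (\<integral>\<^sup>+s. energy_density a \<gamma> (fst s) (snd s) \<partial>\<nu> \<tau> x) \<partial>LT)
       + emeasure (Ckin \<tau>) torus + emeasure (Cint \<tau>) torus)"

definition concentration_disintegration ::
    "(real \<Rightarrow> (real^'n) measure) \<Rightarrow> (real \<Rightarrow> ((real^'n) \<times> (real^'n)) measure) \<Rightarrow> (real \<Rightarrow> real^'n \<Rightarrow> (real^'n) measure) \<Rightarrow> bool" where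
  "concentration_disintegration Ckin Cconv r \<longleftrightarrow> (AE t in lebesgue_on {0<..}.
     r t \<in> restrict_space borel torus \<rightarrow>\<^sub>M prob_algebra (restrict_space borel (sphere 0 1)) \<and>
     (\<forall>A\<in>sets (restrict_space borel torus). \<forall>B\<in>sets (restrict_space borel (sphere 0 1)).
        emeasure (Cconv t) (A \<times> B) = 2 * (\<integral>\<^sup>+x\<in>A. emeasure (r t x) B \<partial>Ckin t)))"

text \<open>The definition with its clauses named; each of them is preserved under stopping separately.\<close>

lemma dissipative_solution_iff:
  "dissipative_solution a \<gamma> \<rho>0 m0 E0 \<rho> m E \<longleftrightarrow>
     \<rho>0 \<in> Lp_torus \<gamma> \<and> m0 \<in> Lp_torus (2 * \<gamma> / (\<gamma> + 1)) \<and> E0 \<ge> 0 \<and>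
     \<rho> \<in> C_weak_Lp \<gamma> \<and> m \<in> C_weak_Lp (2 * \<gamma> / (\<gamma> + 1)) \<and> E \<in> BV_loc \<and>
     (\<exists>\<nu> Ckin Cint Cpress Cconv r.
        \<nu> \<in> young_measures \<and>
        Ckin \<in> Linf_weakstar torus C_torus \<and>
        Cint \<in> Linf_weakstar torus C_torus \<and>
        Cpress \<in> Linf_weakstar torus C_torus \<and>
        Cconv \<in> Linf_weakstar (torus \<times> sphere 0 1) C_torus_sphere \<and>
        concentration_disintegration Ckin Cconv r \<and>
        (AE t in lebesgue_on {0<..}. Cpress t = scale_measure (ennreal (\<gamma> - 1)) (Cint t)) \<and>
        barycentre_energy a \<gamma> \<rho> m E \<nu> Ckin Cint \<and>
        (AE x in LT. \<rho> 0 x = \<rho>0 x) \<and> continuity_eq \<rho> m \<and>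
        (AE x in LT. m 0 x = m0 x) \<and> momentum_eq a \<gamma> m \<nu> r Ckin Cint \<and>
        energy_ineq E0 E)"
  unfolding dissipative_solution_def continuity_eq_def momentum_eq_def energy_ineq_def
    barycentre_energy_def concentration_disintegration_def by (rule refl)

lemma AE_lebesgue_on_not_eq: "AE t in lebesgue_on {0<..}. t \<noteq> (T::real)"
proof -
  have "AE t in lebesgue. t \<noteq> T"
    by (rule AE_I'[of "{T}"]) auto
  then have "AE t in lebesgue. t > 0 \<longrightarrow> t \<noteq> T"
    by eventually_elim simp
  then show ?thesis
    by (simp add: AE_restrict_space_iff)
qed

text \<open>
  The single time \<open>T\<close> is discarded: the stopped Young measure is still the old one there, while
  the stopped energy is already \<open>EM\<close>.
\<close>

lemma barycentre_energy_stop: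
  fixes \<rho> :: "real \<Rightarrow> real^'n \<Rightarrow> real" and m :: "real \<Rightarrow> real^'n \<Rightarrow> real^'n"
  assumes be: "barycentre_energy a \<gamma> \<rho> m E \<nu> Ckin Cint" and a: "a > 0" and \<gamma>: "\<gamma> > 1" and q: "q \<ge> 0"
    and \<rho>T: "AE x in LT. \<rho> T x = q" and mT: "AE x in LT. m T x = 0"
    and EM: "EM = a / (\<gamma> - 1) * q powr \<gamma> * measure lebesgue (torus :: (real^'n) set)"
  shows "barycentre_energy a \<gamma> (\<lambda>t. \<rho> (min t T)) (\<lambda>t. m (min t T)) (\<lambda>t. if t < T then E t else EM)
    (stopped_young T q \<nu>) (stopped_measure T torus Ckin) (stopped_measure T torus Cint)"
  using be AE_lebesgue_on_not_eq[of T] unfolding barycentre_energy_def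
proof eventually_elim
  case (elim \<tau>)
  let ?R = "return phase_algebra (q, 0 :: real^'n)"
  have EM0: "EM \<ge> 0"
    using a \<gamma> EM by simp
  have r1: "(\<integral>s. fst s \<partial>?R) = q"
    by (subst integral_phase_return[OF q]) (auto intro!: borel_measurable_continuous_onI continuous_on_fst continuous_on_id)
  have r2: "(\<integral>s. snd s \<partial>?R) = 0"
    by (subst integral_phase_return[OF q]) (auto intro!: borel_measurable_continuous_onI continuous_on_snd continuous_on_id)
  have "(\<integral>\<^sup>+s. energy_density a \<gamma> (fst s) (snd s) \<partial>?R) = energy_density a \<gamma> q (0 :: real^'n)"
    by (subst nn_integral_return[OF phase_point[OF q]])
       (auto intro!: measurable_restrict_space1 energy_density_measurable)
  also have "\<dots> = ennreal (a / (\<gamma> - 1) * q powr \<gamma>)"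
    by (simp add: energy_density_def msq_over_def)
  finally have "(\<integral>\<^sup>+x. (\<integral>\<^sup>+s. energy_density a \<gamma> (fst s) (snd s) \<partial>?R) \<partial>(LT :: (real^'n) measure))
      = ennreal (a / (\<gamma> - 1) * q powr \<gamma>) * emeasure LT (torus :: (real^'n) set)"
    by simp
  also have "emeasure LT (torus :: (real^'n) set) = ennreal (measure lebesgue (torus :: (real^'n) set))"
    by (subst emeasure_restrict_space) (use torus_lmeasurable in \<open>auto intro: emeasure_eq_measure2 simp del: emeasure_completion measure_completion\<close>)
  finally have r3: "(\<integral>\<^sup>+x. (\<integral>\<^sup>+s. energy_density a \<gamma> (fst s) (snd s) \<partial>?R) \<partial>(LT :: (real^'n) measure)) = ennreal EM"
    using a \<gamma> by (simp add: EM ennreal_mult[symmetric])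
  show ?case
  proof (cases "\<tau> < T")
    case True
    then show ?thesis
      using elim by simp
  next
    case False
    then have "T < \<tau>"
      using elim(2) by simp
    moreover have "AE x in LT. \<rho> T x = q \<and> \<rho> T x \<ge> 0 \<and> m T x = 0"
      using \<rho>T mT by eventually_elim (use q in auto)
    ultimately show ?thesis
      using EM0 by (simp add: r1 r2 r3 del: nn_integral_const)
  qed
qed

lemma concentration_disintegration_stop:
  assumes "concentration_disintegration Ckin Cconv r"
  shows "concentration_disintegration (stopped_measure T torus Ckin) (stopped_measure T (torus \<times> sphere 0 1) Cconv) r"
  using assms unfolding concentration_disintegration_def
proof eventually_elim
  case (elim t)
  then show ?case
    by (cases "t \<le> T") (simp_all add: nn_integral_null_measure)
qed

text \<open>
  The same disintegration \<open>r\<close> serves after \<open>T\<close>, because both sides of its defining identity are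
  then zero.
\<close>

lemma dissipative_solution_stop:
  fixes \<rho> :: "real \<Rightarrow> real^'n \<Rightarrow> real" and m :: "real \<Rightarrow> real^'n \<Rightarrow> real^'n"
  assumes sol: "dissipative_solution a \<gamma> \<rho>0 m0 E0 \<rho> m E" and a: "a > 0" and \<gamma>: "\<gamma> > 1" and T: "T \<ge> 0" and q: "q \<ge> 0"
    and int: "\<And>t. t \<ge> 0 \<Longrightarrow> integrable LT (\<rho> t)" "\<And>t. t \<ge> 0 \<Longrightarrow> integrable LT (m t)" and L1: "E \<in> L1_loc"
    and \<rho>T: "AE x in LT. \<rho> T x = q" and mT: "AE x in LT. m T x = 0"
    and EM: "EM = a / (\<gamma> - 1) * q powr \<gamma> * measure lebesgue (torus :: (real^'n) set)"
    and ge: "AE t in lebesgue_on {0<..}. EM \<le> E t"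
  shows "dissipative_solution a \<gamma> \<rho>0 m0 E0 (\<lambda>t. \<rho> (min t T)) (\<lambda>t. m (min t T)) (\<lambda>t. if t < T then E t else EM)"
proof -
  obtain \<nu> Ckin Cint Cpress Cconv r where
    data: "\<rho>0 \<in> Lp_torus \<gamma>" "m0 \<in> Lp_torus (2 * \<gamma> / (\<gamma> + 1))" "E0 \<ge> 0"
      "\<rho> \<in> C_weak_Lp \<gamma>" "m \<in> C_weak_Lp (2 * \<gamma> / (\<gamma> + 1))" "E \<in> BV_loc"
      "AE x in LT. \<rho> 0 x = \<rho>0 x" "AE x in LT. m 0 x = m0 x"
    and meas: "\<nu> \<in> young_measures" "Ckin \<in> Linf_weakstar torus C_torus" "Cint \<in> Linf_weakstar torus C_torus"
      "Cpress \<in> Linf_weakstar torus C_torus" "Cconv \<in> Linf_weakstar (torus \<times> sphere 0 1) C_torus_sphere"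
    and dis: "concentration_disintegration Ckin Cconv r"
    and press: "AE t in lebesgue_on {0<..}. Cpress t = scale_measure (ennreal (\<gamma> - 1)) (Cint t)"
    and be: "barycentre_energy a \<gamma> \<rho> m E \<nu> Ckin Cint"
    and eqs: "continuity_eq \<rho> m" "momentum_eq a \<gamma> m \<nu> r Ckin Cint" "energy_ineq E0 E"
    using sol unfolding dissipative_solution_iff by (elim conjE exE) (rule that)
  have press': "AE t in lebesgue_on {0<..}. stopped_measure T torus Cpress t
      = scale_measure (ennreal (\<gamma> - 1)) (stopped_measure T torus Cint t)"
    using press
  proof eventually_elim
    case (elim t)
    have "scale_measure (ennreal (\<gamma> - 1)) (null_measure (restrict_space borel (torus :: (real^'n) set)))
        = null_measure (restrict_space borel torus)"
      by (rule measure_eqI) auto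
    then show ?case
      using elim by simp
  qed
  have min0: "min 0 T = 0"
    using T by simp
  show ?thesis
    unfolding dissipative_solution_iff min0
    by (intro conjI exI[of _ "stopped_young T q \<nu>"] exI[of _ "stopped_measure T torus Ckin"]
        exI[of _ "stopped_measure T torus Cint"] exI[of _ "stopped_measure T torus Cpress"]
        exI[of _ "stopped_measure T (torus \<times> sphere 0 1) Cconv"] exI[of _ r]
        data C_weak_Lp_stop[OF _ T] BV_loc_stop[OF _ T] young_measures_stop[OF _ q] meas Linf_weakstar_stop press'
        concentration_disintegration_stop[OF dis] barycentre_energy_stop[OF be a \<gamma> q \<rho>T mT EM]
        continuity_eq_stop[OF eqs(1) int T \<rho>T mT] momentum_eq_stop[OF eqs(2) T q mT]
        energy_ineq_stop[OF eqs(3) data(6) L1 T ge])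
qed

section \<open>Rigidity of the selected solution\<close>

text \<open>
  Almost every time satisfies the hypotheses of \<open>energy_ge_barycentre\<close>, and the mass at that time
  is the initial one.
\<close>

lemma energy_above_equilibrium:
  fixes \<rho> :: "real \<Rightarrow> real^'n \<Rightarrow> real" and m :: "real \<Rightarrow> real^'n \<Rightarrow> real^'n"
  defines "V \<equiv> measure lebesgue (torus :: (real^'n) set)"
  assumes sol: "dissipative_solution a \<gamma> \<rho>0 m0 E0 \<rho> m E" and a: "a > 0" and \<gamma>: "\<gamma> > 1"
    and int: "\<And>t. t \<ge> 0 \<Longrightarrow> integrable LT (\<rho> t)" "\<And>t. t \<ge> 0 \<Longrightarrow> integrable LT (m t)"
    and M: "(\<integral>x. \<rho>0 x \<partial>LT) = M" "integrable LT \<rho>0"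
  shows "AE \<tau> in lebesgue_on {0<..}. a / (\<gamma> - 1) * (M / V) powr \<gamma> * V \<le> E \<tau> \<and>
    (E \<tau> = a / (\<gamma> - 1) * (M / V) powr \<gamma> * V \<longrightarrow> (AE x in LT. \<rho> \<tau> x = M / V) \<and> (AE x in LT. m \<tau> x = 0))"
proof -
  obtain \<nu> Ckin Cint where
    data: "\<rho> \<in> C_weak_Lp \<gamma>" "AE x in LT. \<rho> 0 x = \<rho>0 x"
    and \<nu>: "\<nu> \<in> young_measures" and be: "barycentre_energy a \<gamma> \<rho> m E \<nu> Ckin Cint" and eq: "continuity_eq \<rho> m"
    using sol unfolding dissipative_solution_iff by (elim conjE exE) (rule that)
  have mass: "(\<integral>x. \<rho> t x \<partial>LT) = M" if "t \<ge> 0" for t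
  proof -
    have "(\<integral>x. \<rho> 0 x \<partial>LT) = (\<integral>x. \<rho>0 x \<partial>LT)"
      using data(2) int(1)[of 0] M(2) by (intro integral_cong_AE) auto
    then show ?thesis
      using mass_conservation[OF eq int that] M(1) by simp
  qed
  have pos: "AE \<tau> in lebesgue_on {0<..}. \<tau> > (0::real)"
    by (rule AE_I2) simp
  show ?thesis
    using be pos unfolding barycentre_energy_def
  proof eventually_elim
    case (elim \<tau>)
    have \<tau>: "\<tau> \<ge> 0"
      using elim(2) by simp
    have i\<gamma>: "integrable LT (\<lambda>x. norm (\<rho> \<tau> x) powr \<gamma>)"
      using data(1) \<tau> by (simp add: C_weak_Lp_def Lp_torus_def)
    have "\<rho> \<tau> x \<ge> 0" if "\<rho> \<tau> x = (\<integral>s. fst s \<partial>\<nu> \<tau> x) \<and> \<rho> \<tau> x \<ge> 0 \<and> m \<tau> x = (\<integral>s. snd s \<partial>\<nu> \<tau> x)" for x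
      using that by simp
    then have nonneg: "AE x in LT. \<rho> \<tau> x \<ge> 0"
      using elim(1) by (auto elim: eventually_mono)
    have prob: "\<nu> \<tau> x \<in> space (prob_algebra phase_algebra)" if "x \<in> torus" for x
      using \<nu> elim(2) that by (simp add: young_measures_def)
    have le: "(\<integral>\<^sup>+x. (\<integral>\<^sup>+s. energy_density a \<gamma> (fst s) (snd s) \<partial>\<nu> \<tau> x) \<partial>LT) \<le> ennreal (E \<tau>)"
      using elim(1) by (simp add: add_increasing2)
    have bound: "c * (\<integral>x. norm (m \<tau> x) \<partial>LT) - c\<^sup>2 / 2 * M + a / (\<gamma> - 1) * (\<integral>x. norm (\<rho> \<tau> x) powr \<gamma> \<partial>LT) \<le> E \<tau>"
      if "c \<ge> 0" for c
      using energy_ge_barycentre[OF prob a \<gamma> conjunct1[OF elim(1)] _ le int(1)[OF \<tau>] int(2)[OF \<tau>] i\<gamma> that] elim(1)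
      by (simp add: mass[OF \<tau>])
    show ?case
      using minimal_energy_rigidity[OF a \<gamma> bound nonneg mass[OF \<tau>] int(1)[OF \<tau>] int(2)[OF \<tau>] i\<gamma>]
      unfolding V_def by blast
  qed
qed

text \<open>
  The difference of the two integrands is nonnegative and has nonpositive integral, hence is zero
  almost everywhere; a strictly increasing \<open>\<beta>\<close> can be cancelled.
\<close>

lemma discounted_integral_strict:
  fixes E E' :: "real \<Rightarrow> real"
  assumes \<beta>: "continuous_on UNIV \<beta>" "bounded (range \<beta>)" "strict_mono \<beta>"
    and meas: "E \<in> borel_measurable (lebesgue_on {0<..})" "E' \<in> borel_measurable (lebesgue_on {0<..})"
    and le: "AE t in lebesgue_on {0<..}. E' t \<le> E t"
    and min: "(LINT t:{0<..}|lebesgue. exp (- t) * \<beta> (E t)) \<le> (LINT t:{0<..}|lebesgue. exp (- t) * \<beta> (E' t))"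
  shows "AE t in lebesgue_on {0<..}. E t = E' t"
proof -
  let ?L = "lebesgue_on {0::real<..}"
  obtain B where B: "\<And>y. \<bar>\<beta> y\<bar> \<le> B"
    using \<beta>(2) by (auto simp: bounded_iff)
  have "set_integrable lborel {0<..} (\<lambda>t::real. exp (- t))"
    using integrable_I0i_exp_mscale[of 1] by simp
  then have iexp: "integrable ?L (\<lambda>t::real. exp (- t))"
    unfolding set_integrable_def by (simp add: integrable_restrict_space integrable_completion)
  have [measurable]: "\<beta> \<in> borel_measurable borel"
    using \<beta>(1) by (rule borel_measurable_continuous_onI)
  have i: "integrable ?L (\<lambda>t. exp (- t) * \<beta> (F t))" if F: "F \<in> borel_measurable ?L" for F
  proof (rule Bochner_Integration.integrable_bound)
    show "integrable ?L (\<lambda>t. exp (- t) * B)"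
      using iexp by simp
    have "(\<lambda>t. \<beta> (F t)) \<in> borel_measurable ?L"
      by (rule measurable_compose[OF F]) measurable
    then show "(\<lambda>t. exp (- t) * \<beta> (F t)) \<in> borel_measurable ?L"
      using iexp by (intro borel_measurable_times borel_measurable_integrable[OF iexp])
    have "\<bar>\<beta> y\<bar> \<le> \<bar>B\<bar>" for y
      using B[of y] by linarith
    then show "AE t in ?L. norm (exp (- t) * \<beta> (F t)) \<le> norm (exp (- t) * B)"
      by (intro AE_I2) (simp add: abs_mult)
  qed
  let ?D = "\<lambda>t. exp (- t) * \<beta> (E t) - exp (- t) * \<beta> (E' t)"
  have iD: "integrable ?L ?D"
    by (intro Bochner_Integration.integrable_diff i meas)
  have D0: "AE t in ?L. ?D t \<ge> 0"
    using le by eventually_elim (simp add: strict_mono_less_eq[OF \<beta>(3)])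
  have "(\<integral>t. ?D t \<partial>?L) \<le> 0"
    using min i[OF meas(1)] i[OF meas(2)]
    by (simp add: set_lebesgue_integral_def integral_restrict_space)
  then have "(\<integral>t. ?D t \<partial>?L) = 0"
    using integral_nonneg_AE[OF D0] by simp
  then have "AE t in ?L. ?D t = 0"
    using integral_nonneg_eq_0_iff_AE[OF iD D0] by simp
  then show ?thesis
    by eventually_elim (simp add: strict_mono_eq[OF \<beta>(3)])
qed

theorem corollary6p1:
  fixes a \<gamma> l :: real
    and \<beta> :: "real \<Rightarrow> real"
    and lam :: "nat \<Rightarrow> real"
    and e :: "nat \<Rightarrow> real^'n \<Rightarrow> real"
    and w :: "nat \<Rightarrow> real^'n \<Rightarrow> real^'n"
    and enum :: "nat \<Rightarrow> nat \<times> nat \<times> nat"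
    and U :: "'n::finite data \<Rightarrow> 'n traj"
    and \<rho>0 :: "real^'n \<Rightarrow> real" and m0 :: "real^'n \<Rightarrow> real^'n" and E0 :: real
    and \<rho> :: "real \<Rightarrow> real^'n \<Rightarrow> real" and m :: "real \<Rightarrow> real^'n \<Rightarrow> real^'n" and E :: "real \<Rightarrow> real"
    and M \<rho>M T :: real
  assumes "CARD('n) \<in> {1, 2, 3}" and "a > 0" and "\<gamma> > 1" and "l > real CARD('n) / 2 + 1"
    and "smooth \<beta>" and "bounded (range \<beta>)" and "strict_mono \<beta>"
    and "trig_basis e" and "trig_basis w"
    and "\<forall>k\<ge>1. lam k > 0" and "{0<..} \<subseteq> closure (lam ` {1..})"
    and "bij_betw enum {1..} index_triples"
    and "semiflow_selection a \<gamma> l \<beta> lam e w enum U"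
    and "(\<rho>0, m0, E0) \<in> data_set a \<gamma> l"
    and "(\<rho>, m, E) = U (\<rho>0, m0, E0)"
    and "M = (\<integral>x. \<rho>0 x \<partial>LT)"
    and "\<rho>M = M / measure lebesgue (torus :: (real^'n) set)"
    and "T \<ge> 0"
    and "AE x in LT. \<rho> T x = \<rho>M" and "AE x in LT. m T x = 0"
  shows "\<forall>\<tau>\<ge>T. (AE x in LT. \<rho> \<tau> x = \<rho>M) \<and> (AE x in LT. m \<tau> x = 0)"
proof -
  let ?V = "measure lebesgue (torus :: (real^'n) set)"
  let ?d = "(\<rho>0, m0, E0)"
  let ?S = "solution_set a \<gamma> l ?d"
  note a = \<open>a > 0\<close> and \<gamma> = \<open>\<gamma> > 1\<close> and T = \<open>T \<ge> 0\<close>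
  define EM where "EM = a / (\<gamma> - 1) * \<rho>M powr \<gamma> * ?V"
  have "(\<rho>, m, E) \<in> U_infinity a \<gamma> l \<beta> lam e w enum ?d"
    using assms(13-15) by (auto simp: semiflow_selection_def)
  then have "(\<rho>, m, E) \<in> U_step a \<gamma> l \<beta> lam e w enum (Suc 0) ?d"
    unfolding U_infinity_def by (rule INT_D) simp
  then have min: "(\<rho>, m, E) \<in> minimize (I_first \<beta>) (solution_set a \<gamma> l) ?d"
    by (simp add: minimize_def)
  then have sol: "dissipative_solution a \<gamma> \<rho>0 m0 E0 \<rho> m E"
    and traj: "\<rho> \<in> C_Wneg l" "m \<in> C_Wneg l" "E \<in> L1_loc"
    by (auto simp: minimize_def solution_set_def traj_space_def)
  have int: "integrable LT (\<rho> t)" "integrable LT (m t)" if "t \<ge> 0" for t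
    using traj that by (auto simp: C_Wneg_def Wneg_def)
  have \<rho>0: "integrable LT \<rho>0" "AE x in LT. \<rho>0 x \<ge> 0"
    using assms(14) by (auto simp: data_set_def Wneg_def)
  have "M \<ge> 0"
    unfolding assms(16) by (rule integral_nonneg_AE[OF \<rho>0(2)])
  then have q: "\<rho>M \<ge> 0"
    unfolding assms(17) by simp
  have above: "AE \<tau> in lebesgue_on {0<..}. EM \<le> E \<tau> \<and>
      (E \<tau> = EM \<longrightarrow> (AE x in LT. \<rho> \<tau> x = \<rho>M) \<and> (AE x in LT. m \<tau> x = 0))"
    unfolding EM_def assms(17)
    by (rule energy_above_equilibrium[OF sol a \<gamma> int assms(16)[symmetric] \<rho>0(1)])
  then have ge: "AE t in lebesgue_on {0<..}. EM \<le> E t"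
    by eventually_elim simp
  \<comment> \<open>The competitor: the solution stopped at time \<open>T\<close>.\<close>
  let ?E = "\<lambda>t. if t < T then E t else EM"
  have "dissipative_solution a \<gamma> \<rho>0 m0 E0 (\<lambda>t. \<rho> (min t T)) (\<lambda>t. m (min t T)) ?E"
    by (rule dissipative_solution_stop[OF sol a \<gamma> T q int traj(3) assms(19,20) EM_def ge])
  then have "((\<lambda>t. \<rho> (min t T)), (\<lambda>t. m (min t T)), ?E) \<in> ?S"
    using C_Wneg_stop[OF traj(1) T] C_Wneg_stop[OF traj(2) T] L1_loc_stop[OF traj(3)]
    by (simp add: solution_set_def traj_space_def)
  then have "I_first \<beta> (\<rho>, m, E) \<le> I_first \<beta> ((\<lambda>t. \<rho> (min t T)), (\<lambda>t. m (min t T)), ?E)"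
    using min unfolding minimize_def by blast
  moreover have "continuous_on UNIV \<beta>"
  proof -
    have "(deriv ^^ 0) \<beta> differentiable (at x)" for x
      using \<open>smooth \<beta>\<close> unfolding smooth_def by blast
    then show ?thesis
      by (simp add: differentiable_imp_continuous_on differentiable_on_def)
  qed
  moreover have "AE t in lebesgue_on {0<..}. ?E t \<le> E t"
    using ge by eventually_elim simp
  ultimately have "AE t in lebesgue_on {0<..}. E t = ?E t"
    using assms(6,7) L1_loc_measurable[OF traj(3)] L1_loc_measurable[OF L1_loc_stop[OF traj(3)]]
    by (intro discounted_integral_strict) (auto simp: I_first_def)
  then have rigid: "AE t in lebesgue_on {0<..}. t > T \<longrightarrow>
      (AE x in LT. \<rho> t x = \<rho>M) \<and> (AE x in LT. m t x = 0)"
    using above by eventually_elim (auto split: if_splits)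
  have spaces: "\<rho> \<in> C_weak_Lp \<gamma>" "m \<in> C_weak_Lp (2 * \<gamma> / (\<gamma> + 1))"
    using sol by (auto simp: dissipative_solution_def)
  show ?thesis
  proof (intro allI impI conjI)
    fix \<tau> assume \<tau>: "\<tau> \<ge> T"
    show "AE x in LT. \<rho> \<tau> x = \<rho>M"
      by (rule C_weak_Lp_constant_after[OF spaces(1) \<gamma> T \<tau> int(1)])
         (use rigid in \<open>auto elim: eventually_mono\<close>)
    have "2 * \<gamma> / (\<gamma> + 1) > 1"
      using \<gamma> by simp
    then show "AE x in LT. m \<tau> x = 0"
      by (rule C_weak_Lp_constant_after[OF spaces(2) _ T \<tau> int(2)])
         (use rigid in \<open>auto elim: eventually_mono\<close>)
  qed
qed

end
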